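(* Let $(f,X,\mu)$ be ergodic and conservative, where $\mu$ is a $\sigma$-finite $f$-invariant measure with $\mu(X)=\infty$. Suppose that for some $Y\subset X$ the induced system $(f_Y,Y,\mu_Y)$, with return time function $R\colon Y\to\mathbb{N}$, satisfies assumptions (A1)–(A6), with $\beta\in(0,1)$ given by (A6), and put $\alpha=1/\beta$. Let $(p_n)_{n\ge1}$ be a sequence of non-negative functions on $X$ with $p_1\ge p_2\ge\cdots$ and $\mathrm{supp}(p_n)\subset Y$ for all $n$. Then: (1) Suppose there exists $\varepsilon_1\in(0,\alpha)$ such that $\sum_{n\ge1}\mu(p_{n^{\alpha+\varepsilon_1}})=\infty$. If every subsequence $(p_{n_k})$ with $\sum_k\mu(p_{n_k})=\infty$ is a strong Borel–Cantelli sequence with respect to $f_Y$, then for all $\varepsilon\in(0,\varepsilon_1]$, for $\mu$-a.e. $x\in X$, eventually as $n\to\infty$, $$\sum_{k=1}^{n^{\frac1{\alpha+\varepsilon}}}\mu(p_{k^{\alpha+\varepsilon}})\le\sum_{k=1}^{n}p_k(f^k(x))\le\sum_{k=1}^{n^{\frac1{\alpha-\varepsilon}}}\mu(p_{k^{\alpha-\varepsilon}}).$$ (2) If there exists $\varepsilon_2\in(0,\alpha)$ such that $\sum_{n\ge1}\mu(p_{n^{\alpha-\varepsilon_2}})<\infty$, then $$\lim_{n\to\infty}\sum_{k=1}^{n}p_k(f^k(x))<\infty\qquad\text{for }\mu\text{-a.e. }x\in X.$$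
   Context: Conventions: $\mu(p)=\int p\,d\mu$; non-integer indices and summation limits are replaced by their integer parts, e.g. $p_{g(n)}$ means $p_{[g(n)]}$. $R(x)=\min\{n\ge1:f^n(x)\in Y\}$ for $x\in Y$, $f_Y(x)=f^{R(x)}(x)$, $\mu_Y=\mu|_Y$. A sequence $(p_{n_k})_k$ with $\sum_k\mu(p_{n_k})=\infty$ is a strong Borel–Cantelli sequence with respect to $f_Y$ if for $\mu_Y$-a.e. $x\in Y$, $$\lim_{N\to\infty}\frac{\sum_{k=1}^{N}p_{n_k}(f_Y^k(x))}{\sum_{k=1}^{N}\mu(p_{n_k})}=1.$$ Assumptions on the induced system ($|\cdot|$ is length; $v(n)\sim u(n)$ means $c^{-1}\le v(n)/u(n)\le c$ for some $c>0$ and all large $n$): (A1) $Y$ is an interval with a countable Markov partition $\mathcal{P}=\{Y_i:i\in\mathbb{N}\}$ into intervals such that $f_Y(Y_i)$ contains a union of elements of $\mathcal{P}$, and there is $c_0>0$ with $|f_Y(Y_i)|>c_0$ for all $i$. Let $\mathcal{P}_n=\bigvee_{i=0}^nf_Y^{-i}\mathcal{P}$. (A2) There are $\lambda>1$, $C>0$ with $|(f_Y^n)'(x)|\ge C\lambda^n$ for all $x\in Y$, $n\ge1$. (A3) There are $0<\tau<1$, $C>0$ such that for all $\omega\in\mathcal{P}_n$ and $x,y\in\omega$, $\left|\log\frac{|f_Y'(x)|}{|f_Y'(y)|}\right|\le C\tau^n$. (A4) $\mu_Y$ is the unique $f_Y$-invariant probability measure absolutely continuous with respect to Lebesgue measure.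 (A5) $R$ is constant on each $Y_i\in\mathcal{P}$. (A6) There is $\beta\in(0,1)$ such that $\mu_Y\{x\in Y:R(x)=n\}\sim n^{-\beta-1}$.
   Formalization: The interval Y in (A1) is taken to be bounded (for unbounded Y the claim fails, since large return times can cluster along infinitely many far-away images), and X is taken to be a subset of the real line. *)

theory Defs
  imports "HOL-Probability.Probability"
begin

text \<open>
  Measure preserving dynamics. The invariance predicate is stated through preimages within
  the space, so that it also makes sense for maps that send a null set of points
  outside the space (an induced map is only defined at points that return).
\<close>

definition invariant_measure :: "('a \<Rightarrow> 'a) \<Rightarrow> 'a measure \<Rightarrow> bool" where
  "invariant_measure T N \<longleftrightarrow>
     (\<forall>A\<in>sets N. T -` A \<inter> space N \<in> sets N \<and> emeasure N (T -` A \<inter> space N) = emeasure N A)"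

definition ergodic_map :: "('a \<Rightarrow> 'a) \<Rightarrow> 'a measure \<Rightarrow> bool" where
  "ergodic_map T N \<longleftrightarrow>
     (\<forall>A\<in>sets N. T -` A \<inter> space N = A \<longrightarrow> emeasure N A = 0 \<or> emeasure N (space N - A) = 0)"

text \<open>Conservative: every measurable wandering set is null.\<close>

definition conservative_map :: "('a \<Rightarrow> 'a) \<Rightarrow> 'a measure \<Rightarrow> bool" where
  "conservative_map T N \<longleftrightarrow>
     (\<forall>W\<in>sets N. disjoint_family (\<lambda>n. (T ^^ n) -` W \<inter> space N) \<longrightarrow> emeasure N W = 0)"

text \<open>
  The value is unspecified at points that never return; below, all elements of
  the partition are required to consist of returning points.
\<close>

definition return_time :: "('a \<Rightarrow> 'a) \<Rightarrow> 'a set \<Rightarrow> 'a \<Rightarrow> nat" where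
  "return_time f Y x = (LEAST n. n \<ge> 1 \<and> (f ^^ n) x \<in> Y)"

definition induced_map :: "('a \<Rightarrow> 'a) \<Rightarrow> 'a set \<Rightarrow> 'a \<Rightarrow> 'a" where
  "induced_map f Y x = (f ^^ return_time f Y x) x"

text \<open>
  A countable Markov partition of a bounded interval into intervals with big images. Partitions
  and the Markov property are understood up to Lebesgue null sets (which leaves room for
  endpoints, their preimages, and points that never return): the image of an
  element contains a union of elements and exceeds it by a null set only.
\<close>

definition markov_partition_big_images ::
  "(real \<Rightarrow> real) \<Rightarrow> real set \<Rightarrow> real set set \<Rightarrow> bool" where
  "markov_partition_big_images g Y P \<longleftrightarrow>
     is_interval Y \<and> bounded Y \<and>
     countable P \<and> disjoint P \<and>
     (\<forall>I\<in>P. is_interval I \<and> I \<subseteq> Y) \<and>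
     Y - \<Union>P \<in> null_sets lborel \<and>
     (\<forall>I\<in>P. \<exists>Q\<subseteq>P. \<Union>Q \<subseteq> g ` I \<and> g ` I - \<Union>Q \<in> null_sets lborel) \<and>
     (\<exists>c0>0. \<forall>I\<in>P. measure lborel (g ` I) > c0)"

text \<open>The join \<open>P \<or> g\<^sup>-\<^sup>1 P \<or> \<dots> \<or> g\<^sup>-\<^sup>n P\<close>, with \<open>n + 1\<close> factors.\<close>

definition cylinders :: "('a \<Rightarrow> 'a) \<Rightarrow> 'a set set \<Rightarrow> nat \<Rightarrow> 'a set set" where
  "cylinders g P n =
     {(\<Inter>i\<in>{..n}. (g ^^ i) -` w i) | w. \<forall>i\<le>n. w i \<in> P} - {{}}"

text \<open>
  The branches of the \<open>n\<close>-th iterate live on cylinders with \<open>n\<close> factors. Derivatives are taken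
  within the cylinder, i.e. one-sided at its endpoints; they are unique unless the
  cylinder is a single point (possible since the Markov property holds up to null sets), where the
  conditions hold trivially.
\<close>

definition uniformly_expanding :: "(real \<Rightarrow> real) \<Rightarrow> real set set \<Rightarrow> bool" where
  "uniformly_expanding g P \<longleftrightarrow>
     (\<exists>\<Lambda>>1. \<exists>C>0. \<forall>n\<ge>1. \<forall>\<omega>\<in>cylinders g P (n - 1). \<forall>x\<in>\<omega>.
        \<exists>D. ((g ^^ n) has_real_derivative D) (at x within \<omega>) \<and> \<bar>D\<bar> \<ge> C * \<Lambda> ^ n)"

definition bounded_distortion :: "(real \<Rightarrow> real) \<Rightarrow> real set set \<Rightarrow> bool" where
  "bounded_distortion g P \<longleftrightarrow>
     (\<exists>\<tau>. 0 < \<tau> \<and> \<tau> < 1 \<and> (\<exists>C>0. \<forall>n. \<forall>\<omega>\<in>cylinders g P n. \<forall>x\<in>\<omega>. \<forall>y\<in>\<omega>.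
        \<exists>D E. (g has_real_derivative D) (at x within \<omega>) \<and>
              (g has_real_derivative E) (at y within \<omega>) \<and>
              \<bar>ln (\<bar>D\<bar> / \<bar>E\<bar>)\<bar> \<le> C * \<tau> ^ n))"

definition acip :: "(real \<Rightarrow> real) \<Rightarrow> real set \<Rightarrow> real measure \<Rightarrow> bool" where
  "acip g Y \<nu> \<longleftrightarrow>
     sets \<nu> = sets (restrict_space borel Y) \<and> prob_space \<nu> \<and>
     invariant_measure g \<nu> \<and> absolutely_continuous (restrict_space lborel Y) \<nu>"

definition unique_acip :: "(real \<Rightarrow> real) \<Rightarrow> real set \<Rightarrow> real measure \<Rightarrow> bool" where
  "unique_acip g Y N \<longleftrightarrow> acip g Y N \<and> (\<forall>\<nu>. acip g Y \<nu> \<longrightarrow> \<nu> = N)"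

definition return_time_constant_on :: "('a \<Rightarrow> 'a) \<Rightarrow> 'a set \<Rightarrow> 'a set set \<Rightarrow> bool" where
  "return_time_constant_on f Y P \<longleftrightarrow>
     (\<forall>I\<in>P. (\<forall>x\<in>I. \<exists>n\<ge>1. (f ^^ n) x \<in> Y) \<and> return_time f Y constant_on I)"

definition same_order :: "(nat \<Rightarrow> real) \<Rightarrow> (nat \<Rightarrow> real) \<Rightarrow> bool" where
  "same_order v u \<longleftrightarrow>
     (\<exists>c>0. \<forall>\<^sub>F n in sequentially. inverse c \<le> v n / u n \<and> v n / u n \<le> c)"

definition return_time_tail ::
  "('a \<Rightarrow> 'a) \<Rightarrow> 'a set \<Rightarrow> 'a measure \<Rightarrow> real \<Rightarrow> bool" where
  "return_time_tail f Y N \<beta> \<longleftrightarrow>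
     0 < \<beta> \<and> \<beta> < 1 \<and>
     same_order (\<lambda>n. measure N {x\<in>Y. return_time f Y x = n}) (\<lambda>n. real n powr (- \<beta> - 1))"

text \<open>
  The mean of a non-negative function, possibly infinite.
\<close>

definition mean :: "'a measure \<Rightarrow> ('a \<Rightarrow> real) \<Rightarrow> ennreal" where
  "mean M q = (\<integral>\<^sup>+ x. ennreal (q x) \<partial>M)"

text \<open>
  Sequences of functions are indexed from 1; the value at index 0 is irrelevant. The quotient is
  formed in \<^typ>\<open>ennreal\<close>, where it is 0 as long as the denominator is infinite, so
  that the property forces all means to be finite.
\<close>

definition strong_Borel_Cantelli ::
  "'a measure \<Rightarrow> 'a set \<Rightarrow> ('a \<Rightarrow> 'a) \<Rightarrow> (nat \<Rightarrow> 'a \<Rightarrow> real) \<Rightarrow> bool" where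
  "strong_Borel_Cantelli M Y g q \<longleftrightarrow>
     (\<Sum>k. mean M (q (Suc k))) = \<infinity> \<and>
     (AE x in restrict_space M Y.
        (\<lambda>N. (\<Sum>k=1..N. ennreal (q k ((g ^^ k) x))) / (\<Sum>k=1..N. mean M (q k))) \<longlonglongrightarrow> 1)"

text \<open>The integer part of \<open>n\<^sup>a\<close>, used as an index or as a summation limit.\<close>

definition ipow :: "nat \<Rightarrow> real \<Rightarrow> nat" where
  "ipow n a = nat \<lfloor>real n powr a\<rfloor>"

end

theory Submission
  imports Defs "HOL-Real_Asymp.Real_Asymp"
begin

text \<open>
  Write \<open>g\<close> for the induced map, \<open>R\<close> for the return time and \<open>T\<^sub>m(y) = R(y) + \<dots> + R(g\<^sup>m\<^sup>-\<^sup>1 y)\<close>.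
  Since \<open>p\<^sub>k\<close> vanishes off \<open>Y\<close>, the sum of \<open>p\<^sub>k(f\<^sup>k x)\<close> over \<open>k \<le> n\<close> only sees the visits to
  \<open>Y\<close>; for a point \<open>y\<close> of \<open>Y\<close> it is the sum of \<open>p\<^sub>k(g\<^sup>m y)\<close> with \<open>k = T\<^sub>m(y)\<close> over those \<open>m\<close>
  with \<open>1 \<le> T\<^sub>m(y) \<le> n\<close>. Almost every \<open>x\<close> enters \<open>Y\<close> by ergodicity, and the time needed for that
  is absorbed by an arbitrarily small change of exponents.

  Hence everything rests on the estimate that \<open>T\<^sub>m\<close> lies between \<open>m\<close> to the power \<open>\<alpha> - \<delta>\<close> and
  \<open>m\<close> to the power \<open>\<alpha> + \<delta>\<close> for almost every point and all large \<open>m\<close> (\<open>return_sums_lower\<close>,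
  \<open>return_sums_upper\<close>). As \<open>p\<^sub>k\<close> decreases in \<open>k\<close>, the orbit sum is then bounded, up to an
  additive constant, by sums along the fixed subsequence of indices \<open>ipow m b\<close>, with \<open>b\<close>
  slightly larger or smaller than \<open>\<alpha>\<close>. If the means along this subsequence are summable, so are
  almost surely the values. If they are not, the strong Borel--Cantelli property replaces values
  by means up to a factor 2. This factor and the constants disappear when \<open>b\<close> is moved further
  towards \<open>\<alpha> + \<epsilon>\<close> or \<open>\<alpha> - \<epsilon>\<close>: replacing \<open>b'\<close> by a smaller \<open>b\<close> in the sum of means over \<open>k \<le>
  n\<^bsup>1/b\<^esup>\<close> increases it by a factor of at least 3, up to an additive constant (\<open>block_sum_le\<close>).

  The upper bound on \<open>T\<^sub>m\<close> is a moment estimate: \<open>R\<^bsup>\<theta>\<^esup>\<close> is integrable for every \<open>\<theta> < \<beta>\<close>, the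
  power \<open>\<theta>\<close> is subadditive, and Markov's inequality is applied along powers of 2.

  The lower bound says that a return of length at least \<open>m\<^bsup>\<gamma>\<^esup>\<close>, with \<open>\<gamma> < \<alpha>\<close>, occurs among the
  first \<open>m\<close> returns. Its expected number of occurrences is a positive power of \<open>m\<close>, but some
  independence is needed to exclude that they cluster. This is supplied by
  \<open>exponential_hitting\<close>: there are a constant \<open>C\<close> and \<open>\<rho> < 1\<close> such that a union \<open>A\<close> of partition
  elements is avoided during \<open>q\<close> consecutive periods of length about \<open>C / \<mu>(A)\<close> with probability
  at most \<open>\<rho>\<^sup>q\<close>. For its proof, fix a partition element \<open>J\<^sub>0\<close> of positive measure. By uniqueness
  of the invariant measure, almost every orbit visits \<open>J\<^sub>0\<close> infinitely often. Since images of
  partition elements are large and distortion is bounded, \<open>J\<^sub>0\<close> is reached within \<open>K\<close> steps with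
  a probability bounded below, whatever the past, as long as almost all continuations of this
  past visit \<open>J\<^sub>0\<close> infinitely often. After a visit to \<open>J\<^sub>0\<close> the law of the future is, up to a
  bounded factor, that of a point distributed on \<open>g(J\<^sub>0)\<close> according to Lebesgue measure. So the
  expected numbers of visits to \<open>A\<close> during a given time, conditioned on any two pasts, are
  comparable up to additive and multiplicative constants. They are comparable in the same way to
  the expectation under the invariant measure, because this measure has a density, and a
  measurable function is nearly constant on most long cylinders. During a period of length \<open>C /
  \<mu>(A)\<close> all these expectations are of order 1: bounded below from the start, and bounded above
  after the first visit. Therefore the probability of a visit is bounded below.

  The comparison is made through one base element and not through the density of the invariant
  measure, because nothing bounds this density from below on its support when there are
  infinitely many different images.
\<close>

section \<open>Integer parts of powers and dyadic interpolation\<close>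

lemma le_ipow_iff: "m \<le> ipow n a \<longleftrightarrow> real m \<le> real n powr a"
  by (simp add: ipow_def le_nat_iff le_floor_iff)

lemma ipow_le: "real (ipow n a) \<le> real n powr a"
  using le_ipow_iff[of "ipow n a" n a] by simp

lemma ipow_mono_exponent: "\<lbrakk>1 \<le> n; a \<le> b\<rbrakk> \<Longrightarrow> ipow n a \<le> ipow n b"
  unfolding le_ipow_iff by (rule order_trans[OF ipow_le]) (simp add: powr_mono)

lemma ipow_ge_1: "\<lbrakk>1 \<le> n; 0 \<le> a\<rbrakk> \<Longrightarrow> 1 \<le> ipow n a"
  unfolding le_ipow_iff by (simp add: ge_one_powr_ge_zero)

text \<open>
  Bernoulli's inequality for \<open>(1 + 1/k)\<^sup>a\<close>; it makes the sequence of integer parts strictly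
  increasing when the exponent exceeds 1, with gaps tending to infinity.
\<close>

lemma powr_Suc_ge:
  fixes a :: real assumes "a \<ge> 1" "k \<ge> 1"
  shows "real k powr a + real k powr (a - 1) \<le> real (Suc k) powr a"
proof -
  have k: "real k > 0" using assms by simp
  have "1 + 1 / real k \<le> (1 + 1 / real k) powr a"
    using powr_mono[of 1 a "1 + 1 / real k"] assms k by simp
  then have "real k powr a * (1 + 1 / real k) \<le> real k powr a * (1 + 1 / real k) powr a"
    by (intro mult_left_mono) auto
  also have "\<dots> = (real k * (1 + 1 / real k)) powr a" using k by (simp add: powr_mult)
  also have "real k * (1 + 1 / real k) = real (Suc k)" using k by (simp add: field_simps)
  finally show ?thesis using k by (simp add: powr_diff field_simps)
qed

lemma strict_mono_ipow:
  assumes "a > 1" shows "strict_mono (\<lambda>k. ipow k a)"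
proof (rule strict_mono_Suc_iff[THEN iffD2, rule_format])
  fix k
  show "ipow k a < ipow (Suc k) a"
  proof (cases "k = 0")
    case True
    then show ?thesis by (simp add: ipow_def)
  next
    case False
    then have k: "k \<ge> 1" by simp
    have "1 \<le> real k powr (a - 1)" using k assms by (intro ge_one_powr_ge_zero) auto
    then have "real (ipow k a) + 1 \<le> real (Suc k) powr a"
      using ipow_le[of k a] powr_Suc_ge[of a k] k assms by simp
    then have "Suc (ipow k a) \<le> ipow (Suc k) a" unfolding le_ipow_iff by (simp add: add.commute)
    then show ?thesis by simp
  qed
qed

lemma ipow_gaps:
  assumes "r > 1" shows "\<forall>\<^sub>F k in sequentially. ipow k r + 3 \<le> ipow (Suc k) r"
proof -
  have "\<forall>\<^sub>F k in sequentially. 3 \<le> real k powr (r - 1)"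
    using assms by real_asymp
  with eventually_ge_at_top[of 1] show ?thesis
  proof eventually_elim
    case (elim k)
    then have "real (ipow k r) + 3 \<le> real (Suc k) powr r"
      using ipow_le[of k r] powr_Suc_ge[of r k] assms by simp
    then show ?case unfolding le_ipow_iff by (simp add: add.commute)
  qed
qed

text \<open>
  With \<open>r = b'/b > 1\<close>, the indices \<open>m\<close> between \<open>(k-1)\<^sup>r\<close> and \<open>k\<^sup>r\<close> satisfy \<open>m\<^sup>b \<le> k\<^bsup>b'\<^esup>\<close>, so
  each contributes at least the \<open>k\<close>-th term on the left, and from some \<open>k\<close> on there are at least
  three of them. The earlier \<open>k\<close> are covered by the constant.
\<close>

lemma block_sum_le:
  fixes a :: "nat \<Rightarrow> real"
  assumes nonneg: "\<And>n. n \<ge> 1 \<Longrightarrow> 0 \<le> a n" and anti: "\<And>m n. \<lbrakk>1 \<le> m; m \<le> n\<rbrakk> \<Longrightarrow> a n \<le> a m"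
    and b: "0 < b" "b < b'"
  obtains c where "\<And>n. 3 * (\<Sum>k=1..ipow n (1 / b'). a (ipow k b')) \<le> c + (\<Sum>k=1..ipow n (1 / b). a (ipow k b))"
proof -
  define r where "r = b' / b"
  have r: "r > 1" using b by (simp add: r_def)
  obtain k0 where k0: "\<And>k. k \<ge> k0 \<Longrightarrow> ipow k r + 3 \<le> ipow (Suc k) r"
    using ipow_gaps[OF r] unfolding eventually_sequentially by blast
  have nn: "0 \<le> a (ipow k s)" if "k \<ge> 1" "s \<ge> 0" for k s
    using ipow_ge_1[OF that] nonneg by blast
  have pos: "0 \<le> b" "0 \<le> b'" using b by auto
  define c where "c = 3 * (\<Sum>k=1..k0. a (ipow k b'))"
  \<comment> \<open>Compare up to \<open>N\<^sup>r\<close> first; then \<open>N = ipow n (1 / b')\<close> gives \<open>N\<^sup>r \<le> n\<^bsup>1/b\<^esup>\<close>.\<close>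
  have main: "3 * (\<Sum>k=1..N. a (ipow k b')) \<le> c + (\<Sum>m=1..ipow N r. a (ipow m b))" for N
  proof (induction N)
    case 0
    have "0 \<le> c" "0 \<le> (\<Sum>m=1..ipow 0 r. a (ipow m b))" unfolding c_def using nn pos by (auto intro!: sum_nonneg)
    then show ?case by simp
  next
    case (Suc N)
    show ?case
    proof (cases "N < k0")
      case True
      have "(\<Sum>k=1..Suc N. a (ipow k b')) \<le> (\<Sum>k=1..k0. a (ipow k b'))"
        using True nn pos by (intro sum_mono2) auto
      moreover have "0 \<le> (\<Sum>m=1..ipow (Suc N) r. a (ipow m b))" using nn pos by (auto intro!: sum_nonneg)
      ultimately show ?thesis unfolding c_def by linarith
    next
      case False
      then have gap: "ipow N r + 3 \<le> ipow (Suc N) r" using k0 by simp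
      let ?A = "a (ipow (Suc N) b')"
      have A0: "0 \<le> ?A" using nn pos by simp
      have "3 * ?A \<le> real (card {ipow N r<..ipow (Suc N) r}) * ?A"
        using gap A0 by (intro mult_right_mono) auto
      also have "\<dots> = (\<Sum>m\<in>{ipow N r<..ipow (Suc N) r}. ?A)" by simp
      also have "\<dots> \<le> (\<Sum>m\<in>{ipow N r<..ipow (Suc N) r}. a (ipow m b))"
      proof (rule sum_mono)
        fix m assume m: "m \<in> {ipow N r<..ipow (Suc N) r}"
        then have m1: "1 \<le> m" by auto
        have "real m \<le> real (Suc N) powr r" using m le_ipow_iff by auto
        then have "real m powr b \<le> (real (Suc N) powr r) powr b" using pos by (intro powr_mono2) auto
        also have "\<dots> = real (Suc N) powr b'" using b by (simp add: powr_powr r_def)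
        finally have "ipow m b \<le> ipow (Suc N) b'"
          unfolding le_ipow_iff using ipow_le[of m b] by linarith
        then show "?A \<le> a (ipow m b)" using anti[OF ipow_ge_1[OF m1 pos(1)]] by blast
      qed
      finally have A: "3 * ?A \<le> (\<Sum>m\<in>{ipow N r<..ipow (Suc N) r}. a (ipow m b))" .
      have "{1..ipow (Suc N) r} = {1..ipow N r} \<union> {ipow N r<..ipow (Suc N) r}" using gap by auto
      then have "(\<Sum>m=1..ipow (Suc N) r. a (ipow m b))
          = (\<Sum>m=1..ipow N r. a (ipow m b)) + (\<Sum>m\<in>{ipow N r<..ipow (Suc N) r}. a (ipow m b))"
        by (subst sum.union_disjoint[symmetric]) auto
      then show ?thesis using A Suc by simp
    qed
  qed
  have "3 * (\<Sum>k=1..ipow n (1 / b'). a (ipow k b')) \<le> c + (\<Sum>k=1..ipow n (1 / b). a (ipow k b))" for n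
  proof -
    let ?N = "ipow n (1 / b')"
    have "real ?N powr r \<le> (real n powr (1 / b')) powr r"
      using r ipow_le by (intro powr_mono2) auto
    also have "\<dots> = real n powr (1 / b)" using b by (simp add: powr_powr r_def)
    finally have "ipow ?N r \<le> ipow n (1 / b)"
      unfolding le_ipow_iff using ipow_le[of ?N r] by linarith
    then have "(\<Sum>m=1..ipow ?N r. a (ipow m b)) \<le> (\<Sum>m=1..ipow n (1 / b). a (ipow m b))"
      using nn pos by (intro sum_mono2) auto
    then show ?thesis using main[of ?N] by linarith
  qed
  then show thesis using that by blast
qed

text \<open>
  Monotonicity loses a factor 2 in the argument between consecutive powers of 2, which the
  change of exponent absorbs.
\<close>

lemma dyadic_upper:
  fixes T :: "nat \<Rightarrow> nat"
  assumes mono: "mono T" and g: "0 < \<gamma>'" "\<gamma>' < \<gamma>"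
    and ev: "\<forall>\<^sub>F i in sequentially. real (T (2 ^ i)) \<le> 2 powr (\<gamma>' * real i)"
  shows "\<forall>\<^sub>F n in sequentially. real (T n) \<le> real n powr \<gamma>"
proof -
  obtain i0 where i0: "\<And>i. i \<ge> i0 \<Longrightarrow> real (T (2 ^ i)) \<le> 2 powr (\<gamma>' * real i)"
    using ev unfolding eventually_sequentially by blast
  have "\<forall>\<^sub>F n in sequentially. (2 * real n) powr \<gamma>' \<le> real n powr \<gamma>"
    using g by real_asymp
  with eventually_ge_at_top[of "2 ^ i0"] show ?thesis
  proof eventually_elim
    case (elim n)
    have "n \<ge> 1" using elim(1) by (meson one_le_numeral one_le_power order_trans)
    then obtain i where i: "2 ^ i \<le> n" "n < 2 ^ (i + 1)" using ex_power_ivl1[of 2 n] by auto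
    have "(2::nat) ^ i0 < 2 ^ (i + 1)" using elim(1) i(2) by linarith
    then have "i0 \<le> Suc i" using power_less_imp_less_exp[of "2::nat" i0 "i + 1"] by simp
    then have "real (T (2 ^ Suc i)) \<le> 2 powr (\<gamma>' * real (Suc i))" by (rule i0)
    moreover have "T n \<le> T (2 ^ Suc i)" using i(2) by (intro monoD[OF mono]) simp
    ultimately have "real (T n) \<le> 2 powr (\<gamma>' * real (Suc i))" by linarith
    also have "\<dots> = (2 powr real (Suc i)) powr \<gamma>'" by (simp add: powr_powr mult.commute)
    also have "2 powr real (Suc i) = 2 * real (2 ^ i)" by (simp add: powr_realpow del: of_nat_Suc)
    also have "(2 * real (2 ^ i)) powr \<gamma>' \<le> (2 * real n) powr \<gamma>'"
    proof (rule powr_mono2)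
      have "real (2 ^ i) \<le> real n" using i(1) by (simp only: of_nat_le_iff)
      then show "2 * real (2 ^ i) \<le> 2 * real n" by simp
    qed (use g in auto)
    also have "\<dots> \<le> real n powr \<gamma>" by (rule elim(2))
    finally show ?case .
  qed
qed

lemma dyadic_lower:
  fixes T :: "nat \<Rightarrow> nat"
  assumes mono: "mono T" and g: "0 < \<gamma>" "\<gamma> < \<gamma>'"
    and ev: "\<forall>\<^sub>F i in sequentially. 2 powr (\<gamma>' * real i) \<le> real (T (Suc (2 ^ i)))"
  shows "\<forall>\<^sub>F n in sequentially. real n powr \<gamma> \<le> real (T n)"
proof -
  obtain i0 where i0: "\<And>i. i \<ge> i0 \<Longrightarrow> 2 powr (\<gamma>' * real i) \<le> real (T (Suc (2 ^ i)))"
    using ev unfolding eventually_sequentially by blast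
  have "\<forall>\<^sub>F n in sequentially. real n powr \<gamma> \<le> (real n / 4) powr \<gamma>'"
    using g by real_asymp
  with eventually_ge_at_top[of "2 ^ (i0 + 2)"] show ?thesis
  proof eventually_elim
    case (elim n)
    have "n \<ge> 1" using elim(1) by (meson one_le_numeral one_le_power order_trans)
    then obtain j where j: "2 ^ j \<le> n" "n < 2 ^ (j + 1)" using ex_power_ivl1[of 2 n] by auto
    have "(2::nat) ^ (i0 + 2) < 2 ^ (j + 1)" using elim(1) j(2) by linarith
    then have "i0 + 2 < j + 1" using power_less_imp_less_exp[of "2::nat" "i0 + 2" "j + 1"] by simp
    then have ji': "j = Suc (j - 1)" "i0 \<le> j - 1" by simp_all
    then obtain i where ji: "j = Suc i" "i0 \<le> i" by blast
    have one: "1 \<le> (2::nat) ^ i" by simp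
    have "2 * 2 ^ i \<le> n" using j(1) ji(1) by simp
    then have "Suc (2 ^ i) \<le> n" using one by linarith
    then have "T (Suc (2 ^ i)) \<le> T n" by (rule monoD[OF mono])
    then have le: "2 powr (\<gamma>' * real i) \<le> real (T n)" using i0[OF ji(2)] by linarith
    have "real n / 4 \<le> real (2 ^ i)"
    proof -
      have "real n \<le> real (2 ^ (j + 1))" using j(2) by (simp only: of_nat_le_iff less_imp_le)
      then show ?thesis using ji(1) by simp
    qed
    then have "(real n / 4) powr \<gamma>' \<le> real (2 ^ i) powr \<gamma>'" using g by (intro powr_mono2) auto
    also have "\<dots> = 2 powr (\<gamma>' * real i)" by (simp add: powr_powr mult.commute flip: powr_realpow)
    finally show ?case using elim(2) le by linarith
  qed
qed

lemma powr_add_le: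
  fixes x y \<theta> :: real
  assumes "0 \<le> x" "0 \<le> y" "0 < \<theta>" "\<theta> \<le> 1"
  shows "(x + y) powr \<theta> \<le> x powr \<theta> + y powr \<theta>"
proof (cases "x + y = 0")
  case False
  define s where "s = x + y"
  have s: "s > 0" using assms False by (simp add: s_def)
  have *: "t / s \<le> (t / s) powr \<theta>" if "0 \<le> t" "t \<le> s" for t
  proof (cases "t = 0")
    case False
    then show ?thesis using powr_mono'[of \<theta> 1 "t / s"] that s assms by simp
  qed simp
  have "1 = x / s + y / s" using s by (simp add: s_def add_divide_distrib[symmetric])
  also have "\<dots> \<le> (x / s) powr \<theta> + (y / s) powr \<theta>"
    using assms by (intro add_mono *) (auto simp: s_def)
  also have "\<dots> = (x powr \<theta> + y powr \<theta>) / s powr \<theta>"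
    using s assms by (simp add: powr_divide add_divide_distrib)
  finally show ?thesis using s by (simp add: le_divide_eq s_def)
qed (use assms in simp)

lemma powr_sum_le:
  fixes x :: "nat \<Rightarrow> real"
  assumes "\<And>j. 0 \<le> x j" "0 < \<theta>" "\<theta> \<le> 1"
  shows "(\<Sum>j<n. x j) powr \<theta> \<le> (\<Sum>j<n. x j powr \<theta>)"
proof (induction n)
  case (Suc n)
  have "(\<Sum>j<Suc n. x j) powr \<theta> \<le> (\<Sum>j<n. x j) powr \<theta> + x n powr \<theta>"
    using powr_add_le[of "\<Sum>j<n. x j" "x n" \<theta>] assms by (simp add: sum_nonneg)
  then show ?case using Suc by simp
qed simp

section \<open>Markov measures with bounded distortion\<close>

text \<open>
  The part of the theory that uses no geometry. A point of the space has the symbols \<open>sym x\<close>,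
  \<open>sym (g x)\<close>, and so on; a cylinder of length \<open>Suc n\<close> fixes the first \<open>Suc n\<close> of them, and \<open>J
  i\<close> plays the role of the image of the element with symbol \<open>i\<close>. The distortion conditions say
  that, given a cylinder, the next state is distributed on the image of the last symbol like the
  reference measure \<open>m\<close>, up to the factor \<open>D\<close>. The last condition says that the cylinders
  generate the \<open>\<sigma>\<close>-algebra; it is used in this quantitative form.
\<close>

locale markov_measure = finite_measure m for m :: "'a measure" +
  fixes g :: "'a \<Rightarrow> 'a" and sym :: "'a \<Rightarrow> 'i" and J :: "'i \<Rightarrow> 'a set" and D c0 :: real
  assumes measurable_map [measurable]: "g \<in> m \<rightarrow>\<^sub>M m"
    and measurable_sym [measurable]: "sym \<in> m \<rightarrow>\<^sub>M count_space UNIV"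
    and countable_sym: "countable (sym ` space m)"
    and sets_image: "x \<in> space m \<Longrightarrow> J (sym x) \<in> sets m"
    and c0_pos: "c0 > 0" and D_pos: "D > 0"
    and image_ge: "x \<in> space m \<Longrightarrow> c0 \<le> measure m (J (sym x))"
    and distortion_le: "\<lbrakk>x \<in> space m; E \<in> sets m\<rbrakk> \<Longrightarrow>
      measure m ({y \<in> space m. \<forall>i\<le>n. sym ((g ^^ i) y) = sym ((g ^^ i) x)} \<inter> (g ^^ Suc n) -` E)
      \<le> D * measure m {y \<in> space m. \<forall>i\<le>n. sym ((g ^^ i) y) = sym ((g ^^ i) x)}
          * measure m (E \<inter> J (sym ((g ^^ n) x)))"
    and distortion_ge: "\<lbrakk>x \<in> space m; E \<in> sets m\<rbrakk> \<Longrightarrow>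
      measure m {y \<in> space m. \<forall>i\<le>n. sym ((g ^^ i) y) = sym ((g ^^ i) x)}
          * measure m (E \<inter> J (sym ((g ^^ n) x)))
      \<le> D * measure m ({y \<in> space m. \<forall>i\<le>n. sym ((g ^^ i) y) = sym ((g ^^ i) x)} \<inter> (g ^^ Suc n) -` E)"
    and cylinders_generate: "\<lbrakk>B \<in> sets m; \<delta> > 0\<rbrakk> \<Longrightarrow> \<forall>\<^sub>F n in sequentially. \<exists>W\<subseteq>space m.
      (\<forall>x\<in>W. {y \<in> space m. \<forall>i\<le>n. sym ((g ^^ i) y) = sym ((g ^^ i) x)} \<subseteq> W) \<and>
      measure m (B - W) + measure m (W - B) \<le> \<delta>"
begin

definition cyl :: "nat \<Rightarrow> 'a \<Rightarrow> 'a set" where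
  "cyl n x = {y \<in> space m. \<forall>i<n. sym ((g ^^ i) y) = sym ((g ^^ i) x)}"

text \<open>
  Membership in the set is decided by the first \<open>n\<close> symbols.
\<close>

definition cylinder_union :: "nat \<Rightarrow> 'a set \<Rightarrow> bool" where
  "cylinder_union n B \<longleftrightarrow> B \<subseteq> space m \<and> (\<forall>x\<in>B. cyl n x \<subseteq> B)"

abbreviation pre :: "nat \<Rightarrow> 'a set \<Rightarrow> 'a set" where
  "pre n E \<equiv> (g ^^ n) -` E \<inter> space m"

lemma measurable_iterate [measurable]: "g ^^ n \<in> m \<rightarrow>\<^sub>M m"
  by (induction n) auto

lemma iterate_space: "x \<in> space m \<Longrightarrow> (g ^^ n) x \<in> space m"
  by (rule measurable_space[OF measurable_iterate])

lemma pre_sets [measurable]: "E \<in> sets m \<Longrightarrow> pre n E \<in> sets m"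
  by (rule measurable_sets[OF measurable_iterate])

lemma pre_pre: "pre k (pre n E) = pre (n + k) E"
  using iterate_space by (auto simp: funpow_add)

lemma cyl_Suc_eq: "cyl (Suc n) x = {y \<in> space m. \<forall>i\<le>n. sym ((g ^^ i) y) = sym ((g ^^ i) x)}"
  by (simp add: cyl_def less_Suc_eq_le)

lemma cyl_sets [measurable]: "cyl n x \<in> sets m"
  unfolding cyl_def by measurable

lemma cyl_self: "x \<in> space m \<Longrightarrow> x \<in> cyl n x"
  by (simp add: cyl_def)

lemma cyl_eq: "y \<in> cyl n x \<Longrightarrow> cyl n y = cyl n x"
  by (auto simp: cyl_def)

lemma cyl_antimono: "n \<le> k \<Longrightarrow> cyl k x \<subseteq> cyl n x"
  by (auto simp: cyl_def)

lemma countable_cyl: "countable (cyl n ` space m)"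
proof -
  let ?c = "\<lambda>w. {y \<in> space m. \<forall>i<n. sym ((g ^^ i) y) = w ! i}"
  have "cyl n x \<in> ?c ` lists (sym ` space m)" if "x \<in> space m" for x
  proof
    let ?w = "map (\<lambda>i. sym ((g ^^ i) x)) [0..<n]"
    show "cyl n x = ?c ?w" by (simp add: cyl_def)
    have "sym ((g ^^ i) x) \<in> sym ` space m" for i using iterate_space[OF that] by (rule imageI)
    then show "?w \<in> lists (sym ` space m)" unfolding in_lists_conv_set set_map by blast
  qed
  then have "cyl n ` space m \<subseteq> ?c ` lists (sym ` space m)" by (rule image_subsetI)
  then show ?thesis
    by (rule countable_subset) (rule countable_image, rule countable_lists, rule countable_sym)
qed

lemma cylinder_union_Un: "cylinder_union n B \<Longrightarrow> B = \<Union>(cyl n ` B)"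
  using cyl_self by (auto simp: cylinder_union_def)

lemma cylinder_union_sets: assumes "cylinder_union n B" shows "B \<in> sets m"
proof -
  have "cyl n ` B \<subseteq> cyl n ` space m" using assms by (auto simp: cylinder_union_def)
  then have "countable (cyl n ` B)" using countable_cyl countable_subset by blast
  then have "\<Union>(cyl n ` B) \<in> sets m" by (intro sets.countable_Union) auto
  then show ?thesis using cylinder_union_Un[OF assms] by simp
qed

lemma cylinder_union_mono: "cylinder_union n B \<Longrightarrow> n \<le> k \<Longrightarrow> cylinder_union k B"
  using cyl_antimono unfolding cylinder_union_def by blast

lemma cylinder_union_Int:
  "cylinder_union n B \<Longrightarrow> cylinder_union n C \<Longrightarrow> cylinder_union n (B \<inter> C)"
  unfolding cylinder_union_def by blast

lemma cylinder_unionI: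
  assumes "B \<subseteq> space m"
    and "\<And>x y. \<lbrakk>x \<in> B; y \<in> space m; \<And>i. i < n \<Longrightarrow> sym ((g ^^ i) y) = sym ((g ^^ i) x)\<rbrakk> \<Longrightarrow> y \<in> B"
  shows "cylinder_union n B"
  unfolding cylinder_union_def using assms by (auto simp: cyl_def)

lemma cylinder_unionD:
  assumes "cylinder_union n B" "x \<in> B" "y \<in> space m"
    and "\<And>i. i < n \<Longrightarrow> sym ((g ^^ i) y) = sym ((g ^^ i) x)"
  shows "y \<in> B"
  using assms unfolding cylinder_union_def cyl_def by blast

text \<open>
  An inequality between conditional probabilities given the past integrates to every event of
  the past, as there are only countably many cylinders.
\<close>

lemma cylinder_union_measure_mono:
  assumes B: "cylinder_union n B" and [measurable]: "U \<in> sets m" "W \<in> sets m"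
    and c: "c \<ge> 0" "d \<ge> 0"
    and local: "\<And>x. x \<in> B \<Longrightarrow> c * measure m (cyl n x \<inter> U) \<le> d * measure m (cyl n x \<inter> W)"
  shows "c * measure m (B \<inter> U) \<le> d * measure m (B \<inter> W)"
proof -
  let ?I = "cyl n ` B"
  have sub: "?I \<subseteq> cyl n ` space m" using B by (auto simp: cylinder_union_def)
  have cI: "countable ?I" using countable_subset[OF sub countable_cyl] .
  have dI: "disjoint_family_on (\<lambda>\<omega>. \<omega> \<inter> E) ?I" for E
    unfolding disjoint_family_on_def
  proof (intro ballI impI)
    fix \<omega> \<omega>' assume \<omega>: "\<omega> \<in> ?I" "\<omega>' \<in> ?I" "\<omega> \<noteq> \<omega>'"
    then obtain x y where "\<omega> = cyl n x" "\<omega>' = cyl n y" by blast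
    then have "\<omega> \<inter> \<omega>' = {}" using \<omega>(3) cyl_eq[of _ n x] cyl_eq[of _ n y] by blast
    then show "\<omega> \<inter> E \<inter> (\<omega>' \<inter> E) = {}" by blast
  qed
  have *: "emeasure m (B \<inter> E) = (\<integral>\<^sup>+ \<omega>. emeasure m (\<omega> \<inter> E) \<partial>count_space ?I)" if [measurable]: "E \<in> sets m" for E
  proof -
    have "B \<inter> E = (\<Union>\<omega>\<in>?I. \<omega> \<inter> E)" using cylinder_union_Un[OF B] by blast
    then show ?thesis by (simp only:) (intro emeasure_UN_countable cI dI, auto)
  qed
  have "ennreal c * emeasure m (B \<inter> U) = (\<integral>\<^sup>+ \<omega>. ennreal c * emeasure m (\<omega> \<inter> U) \<partial>count_space ?I)"
    by (simp add: * nn_integral_cmult)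
  also have "\<dots> \<le> (\<integral>\<^sup>+ \<omega>. ennreal d * emeasure m (\<omega> \<inter> W) \<partial>count_space ?I)"
  proof (rule nn_integral_mono)
    fix \<omega> assume "\<omega> \<in> space (count_space ?I)"
    then obtain x where x: "x \<in> B" "\<omega> = cyl n x" by auto
    show "ennreal c * emeasure m (\<omega> \<inter> U) \<le> ennreal d * emeasure m (\<omega> \<inter> W)"
      using local[OF x(1)] c x(2)
      by (simp add: emeasure_eq_measure flip: ennreal_mult)
  qed
  also have "\<dots> = ennreal d * emeasure m (B \<inter> W)"
    by (simp add: * nn_integral_cmult)
  finally show ?thesis using c
    by (simp add: emeasure_eq_measure flip: ennreal_mult)
qed

lemma union_distortion_le:
  assumes B: "cylinder_union (Suc n) B" and E: "E \<in> sets m" and b: "b \<ge> 0"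
    and le: "\<And>x. x \<in> B \<Longrightarrow> measure m (E \<inter> J (sym ((g ^^ n) x))) \<le> b"
  shows "measure m (B \<inter> pre (Suc n) E) \<le> D * b * measure m B"
proof -
  have "1 * measure m (B \<inter> pre (Suc n) E) \<le> (D * b) * measure m (B \<inter> space m)"
  proof (rule cylinder_union_measure_mono[OF B])
    fix x assume x: "x \<in> B"
    then have xs: "x \<in> space m" using B by (auto simp: cylinder_union_def)
    have eq: "cyl (Suc n) x \<inter> pre (Suc n) E = cyl (Suc n) x \<inter> (g ^^ Suc n) -` E"
      by (auto simp: cyl_def)
    have eq2: "cyl (Suc n) x \<inter> space m = cyl (Suc n) x" by (auto simp: cyl_def)
    have "measure m (cyl (Suc n) x \<inter> pre (Suc n) E)
        \<le> D * measure m (cyl (Suc n) x) * measure m (E \<inter> J (sym ((g ^^ n) x)))"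
      using distortion_le[OF xs E, of n] unfolding eq unfolding cyl_Suc_eq .
    also have "\<dots> \<le> D * measure m (cyl (Suc n) x) * b"
      using D_pos le[OF x] by (intro mult_left_mono) auto
    finally show "1 * measure m (cyl (Suc n) x \<inter> pre (Suc n) E) \<le> D * b * measure m (cyl (Suc n) x \<inter> space m)"
      by (simp add: eq2 mult_ac)
  qed (use D_pos b E in auto)
  moreover have "B \<inter> space m = B" using B by (auto simp: cylinder_union_def)
  ultimately show ?thesis by simp
qed

lemma union_distortion_ge:
  assumes B: "cylinder_union (Suc n) B" and E: "E \<in> sets m" and b: "b \<ge> 0"
    and ge: "\<And>x. \<lbrakk>x \<in> B; measure m (cyl (Suc n) x) > 0\<rbrakk> \<Longrightarrow> b \<le> measure m (E \<inter> J (sym ((g ^^ n) x)))"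
  shows "b * measure m B \<le> D * measure m (B \<inter> pre (Suc n) E)"
proof -
  have "b * measure m (B \<inter> space m) \<le> D * measure m (B \<inter> pre (Suc n) E)"
  proof (rule cylinder_union_measure_mono[OF B])
    fix x assume x: "x \<in> B"
    then have xs: "x \<in> space m" using B by (auto simp: cylinder_union_def)
    have eq: "cyl (Suc n) x \<inter> pre (Suc n) E = cyl (Suc n) x \<inter> (g ^^ Suc n) -` E"
      by (auto simp: cyl_def)
    have eq2: "cyl (Suc n) x \<inter> space m = cyl (Suc n) x" by (auto simp: cyl_def)
    show "b * measure m (cyl (Suc n) x \<inter> space m) \<le> D * measure m (cyl (Suc n) x \<inter> pre (Suc n) E)"
    proof (cases "measure m (cyl (Suc n) x) > 0")
      case True
      have "b * measure m (cyl (Suc n) x) \<le> measure m (cyl (Suc n) x) * measure m (E \<inter> J (sym ((g ^^ n) x)))"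
        using mult_right_mono[OF ge[OF x True] measure_nonneg] by (simp add: mult.commute)
      also have "\<dots> \<le> D * measure m (cyl (Suc n) x \<inter> pre (Suc n) E)"
        using distortion_ge[OF xs E, of n] unfolding eq unfolding cyl_Suc_eq .
      finally show ?thesis by (simp add: eq2)
    next
      case False
      then have "measure m (cyl (Suc n) x) = 0" by (simp add: zero_less_measure_iff)
      then show ?thesis using D_pos by (simp add: eq2)
    qed
  qed (use D_pos b E in auto)
  moreover have "B \<inter> space m = B" using B by (auto simp: cylinder_union_def)
  ultimately show ?thesis by simp
qed

text \<open>
  The clock starts after the first \<open>n\<close> symbols, which describe the past event \<open>B\<close>.
\<close>

definition first_hit :: "'i set \<Rightarrow> nat \<Rightarrow> 'a set \<Rightarrow> nat \<Rightarrow> 'a set" where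
  "first_hit S n B j = {x \<in> B. sym ((g ^^ (n + j)) x) \<in> S \<and> (\<forall>i<j. sym ((g ^^ (n + i)) x) \<notin> S)}"

definition no_hit :: "'i set \<Rightarrow> nat \<Rightarrow> 'a set \<Rightarrow> nat \<Rightarrow> 'a set" where
  "no_hit S n B k = {x \<in> B. \<forall>i<k. sym ((g ^^ (n + i)) x) \<notin> S}"

lemma cylinder_union_first_hit:
  assumes "cylinder_union n B" shows "cylinder_union (Suc (n + j)) (first_hit S n B j)"
proof (rule cylinder_unionI)
  show "first_hit S n B j \<subseteq> space m" using assms by (auto simp: first_hit_def cylinder_union_def)
  fix x y assume x: "x \<in> first_hit S n B j" and y: "y \<in> space m"
    and eq: "\<And>i. i < Suc (n + j) \<Longrightarrow> sym ((g ^^ i) y) = sym ((g ^^ i) x)"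
  have "y \<in> B"
    by (rule cylinder_unionD[OF assms _ y, of x]) (use x in \<open>auto simp: first_hit_def intro!: eq\<close>)
  moreover have "sym ((g ^^ (n + i)) y) = sym ((g ^^ (n + i)) x)" if "i \<le> j" for i
    using that by (intro eq) simp
  ultimately show "y \<in> first_hit S n B j" using x by (simp add: first_hit_def)
qed

lemma cylinder_union_no_hit:
  assumes "cylinder_union n B" shows "cylinder_union (n + k) (no_hit S n B k)"
proof (rule cylinder_unionI)
  show "no_hit S n B k \<subseteq> space m" using assms by (auto simp: no_hit_def cylinder_union_def)
  fix x y assume x: "x \<in> no_hit S n B k" and y: "y \<in> space m"
    and eq: "\<And>i. i < n + k \<Longrightarrow> sym ((g ^^ i) y) = sym ((g ^^ i) x)"
  have "y \<in> B"
    by (rule cylinder_unionD[OF assms _ y, of x]) (use x in \<open>auto simp: no_hit_def intro!: eq\<close>)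
  moreover have "sym ((g ^^ (n + i)) y) = sym ((g ^^ (n + i)) x)" if "i < k" for i
    using that by (intro eq) simp
  ultimately show "y \<in> no_hit S n B k" using x by (simp add: no_hit_def)
qed

lemma first_hit_decomposition:
  assumes B: "cylinder_union n B" and E[measurable]: "E \<in> sets m"
  shows "measure m (B \<inter> E) = (\<Sum>j<k. measure m (first_hit S n B j \<inter> E)) + measure m (no_hit S n B k \<inter> E)"
proof (induction k)
  case 0
  then show ?case by (simp add: no_hit_def)
next
  case (Suc k)
  have [measurable]: "first_hit S n B k \<in> sets m" "no_hit S n B (Suc k) \<in> sets m"
    using cylinder_union_first_hit[OF B] cylinder_union_no_hit[OF B] cylinder_union_sets by blast+
  have "no_hit S n B k \<inter> E = (first_hit S n B k \<inter> E) \<union> (no_hit S n B (Suc k) \<inter> E)"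
    by (auto simp: no_hit_def first_hit_def less_Suc_eq)
  moreover have "(first_hit S n B k \<inter> E) \<inter> (no_hit S n B (Suc k) \<inter> E) = {}"
    by (auto simp: no_hit_def first_hit_def)
  ultimately have "measure m (no_hit S n B k \<inter> E)
    = measure m (first_hit S n B k \<inter> E) + measure m (no_hit S n B (Suc k) \<inter> E)"
    by (simp add: finite_measure_Union)
  then show ?case using Suc by simp
qed

abbreviation region :: "'i set \<Rightarrow> 'a set" where
  "region S \<equiv> {x \<in> space m. sym x \<in> S}"

lemma region_sets [measurable]: "region S \<in> sets m"
  using measurable_sets[OF measurable_sym, of S] by (simp add: vimage_def Int_def conj_commute)

text \<open>
  The expected number of visits, at times \<open>n, \<dots>, n + N - 1\<close>, to the set of points with symbol in
  \<open>S\<close>, on the event \<open>B\<close>. Finite sums of measures replace integrals of the counting function.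
\<close>

definition visits :: "'i set \<Rightarrow> nat \<Rightarrow> 'a set \<Rightarrow> nat \<Rightarrow> real" where
  "visits S n B N = (\<Sum>j<N. measure m (B \<inter> pre (n + j) (region S)))"

lemma visits_mono: "N \<le> N' \<Longrightarrow> visits S n B N \<le> visits S n B N'"
  unfolding visits_def by (intro sum_mono2) auto

lemma visits_le: assumes "B \<in> sets m" shows "visits S n B N \<le> real N * measure m B"
proof -
  have "visits S n B N \<le> (\<Sum>j<N. measure m B)"
    unfolding visits_def by (intro sum_mono finite_measure_mono) (use assms in auto)
  then show ?thesis by simp
qed

lemma visits_add: "visits S n B (k + N) = visits S n B k + visits S (n + k) B N"
  by (induction N) (simp_all add: visits_def add.assoc)

lemma visits_shift_le:
  assumes "B \<in> sets m" shows "visits S n B N \<le> real k * measure m B + visits S (n + k) B (N - k)"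
proof (cases "N \<le> k")
  case True
  have "visits S n B N \<le> real k * measure m B"
    using visits_le[OF assms, of S n N] True
    by (meson measure_nonneg mult_right_mono of_nat_mono order_trans)
  then show ?thesis using True by (simp add: visits_def)
next
  case False
  then have "visits S n B N = visits S n B k + visits S (n + k) B (N - k)"
    using visits_add[of S n B k "N - k"] by simp
  then show ?thesis using visits_le[OF assms, of S n k] by simp
qed

text \<open>
  The visits counted and the hits used for the decomposition may refer to different sets of
  symbols: one decomposes at visits to the base symbol when counting visits to \<open>S\<close>.
\<close>

lemma visits_first_hit_decomposition:
  assumes B: "cylinder_union n B"
  shows "visits S l B N = (\<Sum>j<k. visits S l (first_hit S' n B j) N) + visits S l (no_hit S' n B k) N"
proof -
  have "visits S l B N = (\<Sum>i<N. (\<Sum>j<k. measure m (first_hit S' n B j \<inter> pre (l + i) (region S)))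
      + measure m (no_hit S' n B k \<inter> pre (l + i) (region S)))"
    unfolding visits_def by (intro sum.cong refl first_hit_decomposition B) auto
  then show ?thesis
    by (simp add: visits_def sum.distrib sum.swap[of _ "{..<N}" "{..<k}"])
qed

lemma first_hit_measure:
  assumes B: "cylinder_union n B"
  shows "measure m B = (\<Sum>j<k. measure m (first_hit S n B j)) + measure m (no_hit S n B k)"
proof -
  have sub: "B \<subseteq> space m" using B by (simp add: cylinder_union_def)
  then have "first_hit S n B j \<subseteq> space m" "no_hit S n B k \<subseteq> space m" for j
    unfolding first_hit_def no_hit_def by blast+
  then show ?thesis
    using first_hit_decomposition[OF B sets.top, where S = S and k = k] sub by (simp add: Int_absorb2)
qed

end

section \<open>Recurrence to a base symbol and exponential hitting\<close>

text \<open>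
  The base symbol \<open>i0\<close> is visited infinitely often by almost every orbit of the invariant
  measure \<open>\<nu>\<close>. Its density with respect to \<open>m\<close> may be arbitrarily small on its support, and may
  be unbounded.
\<close>

locale recurrent_markov_measure = markov_measure m g sym J D c0 + nu: prob_space \<nu>
  for m :: "'a measure" and g and sym :: "'a \<Rightarrow> 'i" and J D c0 and \<nu> :: "'a measure" +
  fixes i0 :: 'i
  assumes sets_nu: "sets \<nu> = sets m"
    and nu_ac: "absolutely_continuous m \<nu>"
    and nu_invariant: "E \<in> sets m \<Longrightarrow> measure \<nu> (g -` E \<inter> space m) = measure \<nu> E"
    and i0_used: "i0 \<in> sym ` space m"
    and nu_recurrent: "measure \<nu> {x \<in> space m. \<exists>\<^sub>\<infinity>n. sym ((g ^^ n) x) = i0} = 1"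
begin

definition recurrent :: "'a set" where
  "recurrent = {x \<in> space m. \<exists>\<^sub>\<infinity>n. sym ((g ^^ n) x) = i0}"

text \<open>
  Past events all of whose continuations (up to measure 0) return to the base symbol infinitely
  often. The reference measure may also charge orbits that escape from the support of \<open>\<nu>\<close>; these
  have to be excluded before anything uniform can hold. The property passes to every event of a
  longer past contained in \<open>B\<close>.
\<close>

definition core :: "nat \<Rightarrow> 'a set \<Rightarrow> bool" where
  "core n B \<longleftrightarrow> cylinder_union (Suc n) B \<and> measure m (B - recurrent) = 0"

definition visited :: "nat \<Rightarrow> 'a set" where
  "visited K = {x \<in> space m. \<exists>j<K. sym ((g ^^ j) x) = i0}"

lemma recurrent_sets [measurable]: "recurrent \<in> sets m"
proof -
  have "recurrent = (\<Inter>n. \<Union>k\<in>{n..}. pre k (region {i0}))"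
    unfolding recurrent_def INFM_nat_le by (auto simp: iterate_space Bex_def)
  also have "\<dots> \<in> sets m"
    by (intro sets.countable_INT' sets.countable_UN') (auto intro!: pre_sets region_sets simp del: mem_Collect_eq)
  finally show ?thesis .
qed

lemma recurrent_subset: "recurrent \<subseteq> space m"
  by (auto simp: recurrent_def)

lemma visited_sets [measurable]: "visited K \<in> sets m"
proof -
  have "visited K = (\<Union>j\<in>{..<K}. pre j (region {i0}))"
    unfolding visited_def using iterate_space by auto
  also have "\<dots> \<in> sets m"
    by (intro sets.finite_UN) (auto intro!: pre_sets region_sets simp del: mem_Collect_eq)
  finally show ?thesis .
qed

lemma pre_recurrent: "pre n recurrent = recurrent"
proof -
  have "(\<exists>\<^sub>\<infinity>k. sym ((g ^^ k) ((g ^^ n) x)) = i0) \<longleftrightarrow> (\<exists>\<^sub>\<infinity>k. sym ((g ^^ k) x) = i0)" for x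
  proof -
    have "(\<exists>\<^sub>\<infinity>k. sym ((g ^^ k) ((g ^^ n) x)) = i0) \<longleftrightarrow> (\<exists>\<^sub>\<infinity>k. sym ((g ^^ (k + n)) x) = i0)"
      by (simp add: funpow_add)
    also have "\<dots> \<longleftrightarrow> (\<exists>\<^sub>\<infinity>k. sym ((g ^^ k) x) = i0)"
      using eventually_sequentially_seg[of "\<lambda>k. sym ((g ^^ k) x) \<noteq> i0" n]
      by (simp add: frequently_def cofinite_eq_sequentially)
    finally show ?thesis .
  qed
  then show ?thesis using iterate_space by (auto simp: recurrent_def)
qed

lemma measure_recurrent_visited: "(\<lambda>K. measure m (recurrent - visited K)) \<longlonglongrightarrow> 0"
proof -
  have "(\<lambda>K. measure m (recurrent - visited K)) \<longlonglongrightarrow> measure m (\<Inter>K. recurrent - visited K)"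
  proof (rule finite_Lim_measure_decseq)
    show "range (\<lambda>K. recurrent - visited K) \<subseteq> sets m" by auto
    show "decseq (\<lambda>K. recurrent - visited K)"
      unfolding decseq_def visited_def by (auto dest: less_le_trans)
  qed
  moreover have "(\<Inter>K. recurrent - visited K) = {}"
  proof (rule equals0I)
    fix x assume x: "x \<in> (\<Inter>K. recurrent - visited K)"
    then have "x \<in> recurrent" by blast
    then obtain n where n: "sym ((g ^^ n) x) = i0" "x \<in> space m"
      unfolding recurrent_def using INFM_EX by blast
    then have "x \<in> visited (Suc n)" unfolding visited_def by blast
    then show False using x by blast
  qed
  ultimately show ?thesis by (simp only: measure_empty)
qed

text \<open>
  Recurrence is invariant under \<open>g\<close>. So if a cylinder consists of recurrent points, the lower
  distortion bound forces its image to consist of recurrent points.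
\<close>

lemma core_image_subset_recurrent:
  assumes B: "core n B" and x: "x \<in> B" "measure m (cyl (Suc n) x) > 0"
  shows "measure m (J (sym ((g ^^ n) x)) - recurrent) = 0"
proof -
  let ?C = "cyl (Suc n) x" and ?E = "space m - recurrent"
  have xs: "x \<in> space m" using B x unfolding core_def cylinder_union_def by blast
  have sub: "?C \<subseteq> B" using B x unfolding core_def cylinder_union_def by blast
  have Bs: "B \<in> sets m" using B cylinder_union_sets unfolding core_def by blast
  have "?C \<inter> (g ^^ Suc n) -` ?E \<subseteq> B - recurrent"
    using sub pre_recurrent[of "Suc n"] recurrent_subset cylinder_union_def[of "Suc n"] B unfolding core_def by blast
  then have "measure m (?C \<inter> (g ^^ Suc n) -` ?E) \<le> measure m (B - recurrent)"
    by (intro finite_measure_mono) (use Bs in auto)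
  then have "measure m (?C \<inter> (g ^^ Suc n) -` ?E) \<le> 0"
    using B by (simp add: core_def)
  then have "measure m ?C * measure m (?E \<inter> J (sym ((g ^^ n) x))) \<le> 0"
    using distortion_ge[OF xs, of ?E n] D_pos unfolding cyl_Suc_eq
    by (smt (verit) recurrent_sets mult_nonneg_nonpos sets.compl_sets)
  moreover have "measure m (?E \<inter> J (sym ((g ^^ n) x))) \<ge> 0" by simp
  ultimately have "measure m (?E \<inter> J (sym ((g ^^ n) x))) = 0"
    using x(2) by (smt (verit) mult_pos_pos)
  moreover have "?E \<inter> J (sym ((g ^^ n) x)) = J (sym ((g ^^ n) x)) - recurrent"
    using sets.sets_into_space[OF sets_image[OF iterate_space[OF xs]]] by blast
  ultimately show ?thesis by simp
qed

lemma core_subset: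
  assumes "core n B" "cylinder_union (Suc k) C" "C \<subseteq> B"
  shows "core k C"
proof -
  have "B \<in> sets m" using assms cylinder_union_sets unfolding core_def by blast
  then have "measure m (C - recurrent) \<le> measure m (B - recurrent)"
    using assms by (intro finite_measure_mono) auto
  then show ?thesis using assms measure_nonneg[of m "C - recurrent"] unfolding core_def by linarith
qed

text \<open>
  On the recurrent set, the set of points that have not visited the base symbol by time \<open>K\<close>
  decreases to the empty set. Images have measure at least \<open>c0\<close>, so once this remainder has
  measure below \<open>c0 / 2\<close>, at least half of that amount remains in every image, and one \<open>K\<close>
  serves all pasts.
\<close>

lemma core_hits:
  obtains K where "K > 0" "\<And>n B. core n B \<Longrightarrow> c0 / 2 * measure m B \<le> D * measure m (B \<inter> pre (Suc n) (visited K))"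
proof -
  have "\<forall>\<^sub>F K in sequentially. measure m (recurrent - visited K) < c0 / 2"
    using order_tendstoD(2)[OF measure_recurrent_visited, of "c0 / 2"] c0_pos by simp
  then obtain K where K: "measure m (recurrent - visited K) < c0 / 2" "K > 0"
    using eventually_conj[OF _ eventually_gt_at_top[of 0]] eventually_happens'[OF sequentially_bot] by blast
  have "c0 / 2 * measure m B \<le> D * measure m (B \<inter> pre (Suc n) (visited K))" if B: "core n B" for n B
  proof (rule union_distortion_ge)
    show "cylinder_union (Suc n) B" using B by (simp add: core_def)
    fix x assume x: "x \<in> B" "0 < measure m (cyl (Suc n) x)"
    let ?J = "J (sym ((g ^^ n) x))"
    have xs: "x \<in> space m" using B x unfolding core_def cylinder_union_def by blast
    have Js[measurable]: "?J \<in> sets m" using sets_image iterate_space[OF xs] by blast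
    have "measure m ?J \<le> measure m ((visited K \<inter> ?J) \<union> ((?J - recurrent) \<union> (recurrent - visited K)))"
      by (intro finite_measure_mono) auto
    also have "\<dots> \<le> measure m (visited K \<inter> ?J) + measure m ((?J - recurrent) \<union> (recurrent - visited K))"
      by (rule measure_Un_le) auto
    also have "\<dots> \<le> measure m (visited K \<inter> ?J) + (measure m (?J - recurrent) + measure m (recurrent - visited K))"
      by (intro add_left_mono measure_Un_le) auto
    finally show "c0 / 2 \<le> measure m (visited K \<inter> ?J)"
      using K core_image_subset_recurrent[OF B x] image_ge[OF iterate_space[OF xs, of n]] by simp
  qed (use c0_pos in auto)
  then show thesis using that K by blast
qed

text \<open>
  The expected number of visits of an orbit that starts in the image of the base symbol,
  distributed like the reference measure. All other expectations are compared with it.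
\<close>

definition base_visits :: "'i set \<Rightarrow> nat \<Rightarrow> real" where
  "base_visits S N = (\<Sum>j<N. measure m (J i0 \<inter> pre j (region S)))"

lemma base_image_sets [measurable]: "J i0 \<in> sets m"
  using i0_used sets_image by blast

lemma base_visits_nonneg: "base_visits S N \<ge> 0"
  by (simp add: base_visits_def sum_nonneg)

lemma base_visits_mono: "N \<le> N' \<Longrightarrow> base_visits S N \<le> base_visits S N'"
  unfolding base_visits_def by (intro sum_mono2) auto

text \<open>
  After the base symbol the past is forgotten up to the factor \<open>D\<close>.
\<close>

lemma visits_after_base:
  assumes B: "cylinder_union (Suc n) B" and last: "\<And>x. x \<in> B \<Longrightarrow> sym ((g ^^ n) x) = i0"
  shows "visits S (Suc n) B N \<le> D * base_visits S N * measure m B"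
    and "base_visits S N * measure m B \<le> D * visits S (Suc n) B N"
proof -
  have eq: "pre (Suc n + j) E = pre (Suc n) (pre j E)" for j E by (simp only: pre_pre add.commute)
  have "visits S (Suc n) B N \<le> (\<Sum>j<N. D * measure m (pre j (region S) \<inter> J i0) * measure m B)"
    unfolding visits_def eq
    by (intro sum_mono union_distortion_le[OF B]) (auto simp: last simp del: mem_Collect_eq intro!: pre_sets region_sets)
  also have "\<dots> = D * base_visits S N * measure m B"
    by (simp add: base_visits_def sum_distrib_left sum_distrib_right Int_commute)
  finally show "visits S (Suc n) B N \<le> D * base_visits S N * measure m B" .
  have "(\<Sum>j<N. measure m (pre j (region S) \<inter> J i0) * measure m B) \<le> (\<Sum>j<N. D * measure m (B \<inter> pre (Suc n + j) (region S)))"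
    unfolding eq
    by (intro sum_mono union_distortion_ge[OF B]) (auto simp: last simp del: mem_Collect_eq intro!: pre_sets region_sets)
  then show "base_visits S N * measure m B \<le> D * visits S (Suc n) B N"
    by (simp add: base_visits_def visits_def sum_distrib_left sum_distrib_right Int_commute)
qed

lemma first_hit_base_ge:
  assumes hits: "\<And>n B. core n B \<Longrightarrow> c * measure m B \<le> measure m (B \<inter> pre (Suc n) (visited K))"
    and B: "core n B"
  shows "c * measure m B \<le> (\<Sum>i<K. measure m (first_hit {i0} (Suc n) B i))"
proof -
  have Bu: "cylinder_union (Suc n) B" using B by (simp add: core_def)
  have [measurable]: "B \<in> sets m" using cylinder_union_sets[OF Bu] .
  let ?R = "no_hit {i0} (Suc n) B K"
  have R: "?R \<in> sets m" using cylinder_union_sets[OF cylinder_union_no_hit[OF Bu]] .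
  have eq: "(g ^^ j) ((g ^^ Suc n) x) = (g ^^ (Suc n + j)) x" for j x
    by (simp only: funpow_add o_apply add.commute[of "Suc n" j])
  have "B \<inter> pre (Suc n) (visited K) \<subseteq> B - ?R"
    unfolding visited_def no_hit_def vimage_def mem_Collect_eq eq by blast
  then have "measure m (B \<inter> pre (Suc n) (visited K)) \<le> measure m (B - ?R)"
    using R by (intro finite_measure_mono) auto
  also have "\<dots> = measure m B - measure m ?R"
    using R by (subst finite_measure_Diff) (auto simp: no_hit_def)
  finally show ?thesis
    using hits[OF B] first_hit_measure[OF Bu, where k = K and S = "{i0}"] by linarith
qed

text \<open>
  With probability at least \<open>c\<close> the base symbol is reached within \<open>K\<close> steps, after which at most
  \<open>D * base_visits S N0\<close> visits are expected; otherwise one starts afresh after \<open>K\<close> steps. At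
  most \<open>K\<close> visits are lost in each round, so a bound \<open>M\<close> has to satisfy \<open>K + D * base_visits S
  N0 + (1 - c) * M \<le> M\<close>. The stated value gives equality. The induction is on the number of
  steps.
\<close>

lemma visits_le_iterated:
  assumes hits: "\<And>n B. core n B \<Longrightarrow> c * measure m B \<le> measure m (B \<inter> pre (Suc n) (visited K))"
    and c: "0 < c" "c \<le> 1" and K: "K > 0"
    and B: "core n B" and N: "N \<le> N0"
  shows "visits S (Suc n) B N \<le> (real K + D * base_visits S N0) / c * measure m B"
  using B N
proof (induction N arbitrary: n B rule: less_induct)
  case (less N)
  let ?e = "base_visits S N0"
  define M where "M = (real K + D * base_visits S N0) / c"
  have B: "cylinder_union (Suc n) B" using less.prems by (simp add: core_def)
  have [measurable]: "B \<in> sets m" using cylinder_union_sets[OF B] .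
  have M0: "M \<ge> 0" unfolding M_def using c D_pos base_visits_nonneg[of S N0] by simp
  define F where "F i = first_hit {i0} (Suc n) B i" for i
  define R where "R = no_hit {i0} (Suc n) B K"
  have F: "cylinder_union (Suc (Suc n + i)) (F i)" for i
    unfolding F_def by (rule cylinder_union_first_hit[OF B])
  have Fs: "F i \<in> sets m" for i using cylinder_union_sets[OF F] .
  have R: "cylinder_union (Suc (n + K)) R"
    using cylinder_union_no_hit[OF B, where S = "{i0}" and k = K] by (simp add: R_def)
  have Rs: "R \<in> sets m" using cylinder_union_sets[OF R] .
  have F_le: "visits S (Suc n) (F i) N \<le> (real K + D * ?e) * measure m (F i)" if i: "i < K" for i
  proof -
    have "visits S (Suc n) (F i) N \<le> real (Suc i) * measure m (F i) + visits S (Suc n + Suc i) (F i) (N - Suc i)"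
      by (rule visits_shift_le[OF Fs])
    also have "visits S (Suc n + Suc i) (F i) (N - Suc i) \<le> D * base_visits S (N - Suc i) * measure m (F i)"
      using visits_after_base(1)[OF F] by (auto simp: F_def first_hit_def)
    also have "\<dots> \<le> D * ?e * measure m (F i)"
      using less.prems D_pos by (intro mult_right_mono mult_left_mono base_visits_mono) auto
    also have "real (Suc i) * measure m (F i) \<le> real K * measure m (F i)"
      using i by (intro mult_right_mono) auto
    finally show ?thesis by (simp add: algebra_simps)
  qed
  have R_le: "visits S (Suc n) R N \<le> (real K + M) * measure m R"
  proof (cases "N = 0")
    case True
    then show ?thesis using M0 by (simp add: visits_def)
  next
    case False
    have "core (n + K) R"
      by (rule core_subset[OF less.prems(1) R]) (auto simp: R_def no_hit_def)
    then have "visits S (Suc (n + K)) R (N - K) \<le> M * measure m R"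
      using less.prems False K unfolding M_def by (intro less.IH) auto
    then show ?thesis
      using visits_shift_le[OF Rs, of S "Suc n" N K] by (simp add: algebra_simps)
  qed
  define h where "h = (\<Sum>i<K. measure m (F i))"
  have hR: "measure m B = h + measure m R"
    unfolding h_def F_def R_def by (rule first_hit_measure[OF B])
  have ch: "c * measure m B \<le> h"
    unfolding h_def F_def by (rule first_hit_base_ge[OF hits less.prems(1)])
  have "visits S (Suc n) B N = (\<Sum>i<K. visits S (Suc n) (F i) N) + visits S (Suc n) R N"
    unfolding F_def R_def by (rule visits_first_hit_decomposition[OF B])
  also have "\<dots> \<le> (\<Sum>i<K. (real K + D * ?e) * measure m (F i)) + (real K + M) * measure m R"
    by (intro add_mono sum_mono F_le R_le) auto
  also have "\<dots> = (real K + D * ?e) * h + (real K + M) * (measure m B - h)"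
    using hR by (simp add: h_def sum_distrib_left)
  also have "\<dots> = real K * measure m B + D * ?e * h + M * (measure m B - h)"
    by (simp add: algebra_simps)
  also have "\<dots> \<le> real K * measure m B + D * ?e * measure m B + M * (measure m B - c * measure m B)"
    using hR ch M0 D_pos base_visits_nonneg[of S N0]
    by (intro add_mono mult_left_mono) auto
  also have "\<dots> = (real K + D * ?e) * measure m B + M * measure m B - (M * c) * measure m B"
    by (simp add: algebra_simps)
  also have "M * c = real K + D * ?e" using c by (simp add: M_def)
  finally show ?case by (simp add: M_def)
qed

text \<open>
  Only the visits after the first passage through the base symbol are counted.
\<close>

lemma visits_ge:
  assumes hits: "\<And>n B. core n B \<Longrightarrow> c * measure m B \<le> measure m (B \<inter> pre (Suc n) (visited K))"
    and B: "core n B"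
  shows "base_visits S N * c * measure m B \<le> D * visits S (Suc n) B (K + N)"
proof -
  have Bu: "cylinder_union (Suc n) B" using B by (simp add: core_def)
  have [measurable]: "B \<in> sets m" using cylinder_union_sets[OF Bu] .
  define F where "F i = first_hit {i0} (Suc n) B i" for i
  have F: "cylinder_union (Suc (Suc n + i)) (F i)" for i
    unfolding F_def by (rule cylinder_union_first_hit[OF Bu])
  define h where "h = (\<Sum>i<K. measure m (F i))"
  have ch: "c * measure m B \<le> h"
    unfolding h_def F_def by (rule first_hit_base_ge[OF hits B])
  have "base_visits S N * (c * measure m B) \<le> base_visits S N * h"
    using ch base_visits_nonneg by (intro mult_left_mono)
  also have "\<dots> = (\<Sum>i<K. base_visits S N * measure m (F i))"
    by (simp add: h_def sum_distrib_left)
  also have "\<dots> \<le> (\<Sum>i<K. D * visits S (Suc n) (F i) (K + N))"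
  proof (rule sum_mono)
    fix i assume i: "i \<in> {..<K}"
    have "base_visits S N * measure m (F i) \<le> D * visits S (Suc (Suc n + i)) (F i) N"
      using visits_after_base(2)[OF F] by (auto simp: F_def first_hit_def)
    also have "visits S (Suc (Suc n + i)) (F i) N \<le> visits S (Suc n) (F i) (Suc i + N)"
      unfolding visits_add by (simp add: visits_def sum_nonneg)
    also have "\<dots> \<le> visits S (Suc n) (F i) (K + N)"
      using i by (intro visits_mono) auto
    finally show "base_visits S N * measure m (F i) \<le> D * visits S (Suc n) (F i) (K + N)"
      using D_pos by simp
  qed
  also have "\<dots> = D * (\<Sum>i<K. visits S (Suc n) (F i) (K + N))"
    by (simp add: sum_distrib_left)
  also have "\<dots> \<le> D * visits S (Suc n) B (K + N)"
    unfolding visits_first_hit_decomposition[OF Bu, where S = S and l = "Suc n" and N = "K + N" and k = K and S' = "{i0}"] F_def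
    using D_pos by (intro mult_left_mono) (auto simp: visits_def sum_nonneg)
  finally show ?thesis by (simp add: mult.assoc)
qed

text \<open>
  At most \<open>M\<close> visits are expected after the first one, so a large expected number of visits must
  come from a large probability of at least one visit.
\<close>

lemma visits_le_hit:
  assumes B: "core n B"
    and M: "\<And>n B N'. \<lbrakk>core n B; N' \<le> N\<rbrakk> \<Longrightarrow> visits S (Suc n) B N' \<le> M * measure m B"
  shows "visits S (Suc n) B N \<le> (1 + M) * (measure m B - measure m (no_hit S (Suc n) B N))"
proof -
  have Bu: "cylinder_union (Suc n) B" using B by (simp add: core_def)
  define F where "F i = first_hit S (Suc n) B i" for i
  define R where "R = no_hit S (Suc n) B N"
  have F: "cylinder_union (Suc (Suc n + i)) (F i)" for i
    unfolding F_def by (rule cylinder_union_first_hit[OF Bu])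
  have coreF: "core (Suc n + i) (F i)" for i
    by (rule core_subset[OF B F]) (auto simp: F_def first_hit_def)
  have F_le: "visits S (Suc n) (F i) N \<le> (1 + M) * measure m (F i)" if "i < N" for i
  proof -
    have N: "N = i + (1 + (N - Suc i))" using that by simp
    have "visits S (Suc n) (F i) i = 0"
    proof -
      have "F i \<inter> pre (Suc n + j) (region S) = {}" if "j < i" for j
        using that by (auto simp: F_def first_hit_def)
      then show ?thesis by (simp add: visits_def del: add_Suc)
    qed
    moreover have "visits S (Suc n + i) (F i) 1 \<le> measure m (F i)"
      using visits_le[OF cylinder_union_sets[OF F], of S "Suc n + i" i 1] by simp
    moreover have "visits S (Suc n + i + 1) (F i) (N - Suc i) \<le> M * measure m (F i)"
      using M[OF coreF[of i], of "N - Suc i"] by simp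
    ultimately have "visits S (Suc n) (F i) (i + (1 + (N - Suc i))) \<le> measure m (F i) + M * measure m (F i)"
      unfolding visits_add by linarith
    then show ?thesis using N by (simp add: algebra_simps)
  qed
  have R0: "visits S (Suc n) R N = 0"
  proof -
    have "R \<inter> pre (Suc n + j) (region S) = {}" if "j < N" for j
      using that by (auto simp: R_def no_hit_def)
    then show ?thesis by (simp add: visits_def del: add_Suc)
  qed
  have "visits S (Suc n) B N = (\<Sum>i<N. visits S (Suc n) (F i) N) + visits S (Suc n) R N"
    unfolding F_def R_def by (rule visits_first_hit_decomposition[OF Bu])
  also have "\<dots> \<le> (\<Sum>i<N. (1 + M) * measure m (F i))"
    unfolding R0 by (auto intro!: sum_mono F_le)
  also have "\<dots> = (1 + M) * (\<Sum>i<N. measure m (F i))" by (simp add: sum_distrib_left)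
  also have "(\<Sum>i<N. measure m (F i)) = measure m B - measure m R"
    unfolding F_def R_def using first_hit_measure[OF Bu, where S = S and k = N] by simp
  finally show ?thesis by (simp add: R_def)
qed

text \<open>
  Avoiding the symbols during one period is again a past event, so the estimate can be repeated.
\<close>

lemma no_hit_iterate_le:
  assumes r: "\<And>n B. core n B \<Longrightarrow> measure m (no_hit S (Suc n) B L) \<le> r * measure m B" and "r \<ge> 0"
    and B: "core n B"
  shows "measure m (no_hit S (Suc n) B (q * L)) \<le> r ^ q * measure m B"
proof (induction q)
  case 0
  have "no_hit S (Suc n) B 0 = B" by (auto simp: no_hit_def)
  then show ?case by simp
next
  case (Suc q)
  have Bu: "cylinder_union (Suc n) B" using B by (simp add: core_def)
  have eq: "no_hit S (Suc n) B (Suc q * L) = no_hit S (Suc (n + q * L)) (no_hit S (Suc n) B (q * L)) L"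
    (is "?l = ?r")
  proof (rule set_eqI)
    fix x
    have "(\<forall>i<Suc q * L. P i) \<longleftrightarrow> (\<forall>i<q * L. P i) \<and> (\<forall>i<L. P (q * L + i))" for P :: "nat \<Rightarrow> bool"
    proof (intro iffI conjI allI impI)
      fix i assume *: "(\<forall>i<q * L. P i) \<and> (\<forall>i<L. P (q * L + i))" and i: "i < Suc q * L"
      show "P i"
      proof (cases "i < q * L")
        case False
        then have "i - q * L < L" "q * L + (i - q * L) = i" using i by auto
        then show ?thesis using * by metis
      qed (use * in blast)
    qed auto
    from this[of "\<lambda>i. sym ((g ^^ (Suc n + i)) x) \<notin> S"]
    show "x \<in> ?l \<longleftrightarrow> x \<in> ?r"
      by (simp add: no_hit_def add.assoc)
  qed
  have "core (n + q * L) (no_hit S (Suc n) B (q * L))"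
    using cylinder_union_no_hit[OF Bu, where S = S and k = "q * L"]
    by (intro core_subset[OF B]) (auto simp: no_hit_def)
  then have "measure m (no_hit S (Suc n) B (Suc q * L)) \<le> r * measure m (no_hit S (Suc n) B (q * L))"
    unfolding eq by (rule r)
  also have "\<dots> \<le> r * (r ^ q * measure m B)"
    using Suc \<open>r \<ge> 0\<close> by (rule mult_left_mono)
  finally show ?case by simp
qed

lemma nu_space: "space \<nu> = space m"
  using sets_nu by (rule sets_eq_imp_space_eq)

lemma nu_pre: "E \<in> sets m \<Longrightarrow> measure \<nu> (pre n E) = measure \<nu> E"
proof (induction n)
  case 0
  then show ?case using sets.sets_into_space by (auto simp: Int_absorb2)
next
  case (Suc n)
  have one: "g ^^ 1 = g" by simp
  have "measure \<nu> (pre (Suc n) E) = measure \<nu> (pre 1 (pre n E))"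
    by (simp only: pre_pre add_0_right add_Suc_right One_nat_def)
  also have "\<dots> = measure \<nu> (pre n E)"
    unfolding one by (rule nu_invariant[OF pre_sets[OF Suc.prems]])
  also have "\<dots> = measure \<nu> E" using Suc by blast
  finally show ?case .
qed

text \<open>
  The density is only used through comparison of the two measures on its level sets.
\<close>

lemma nu_density:
  obtains h :: "'a \<Rightarrow> real" where "h \<in> borel_measurable m" "\<And>x. h x \<ge> 0"
    and "\<And>U b. \<lbrakk>U \<in> sets m; b \<ge> 0; \<And>x. x \<in> U \<Longrightarrow> h x \<le> b\<rbrakk> \<Longrightarrow> measure \<nu> U \<le> b * measure m U"
    and "\<And>U a. \<lbrakk>U \<in> sets m; a \<ge> 0; \<And>x. x \<in> U \<Longrightarrow> a \<le> h x\<rbrakk> \<Longrightarrow> a * measure m U \<le> measure \<nu> U"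
proof -
  obtain h where h[measurable]: "h \<in> borel_measurable m" and hRN: "AE x in m. RN_deriv m \<nu> x = ennreal (h x)"
    and h0: "\<And>x. h x \<ge> 0"
    using real_RN_deriv[OF _ nu_ac sets_nu] nu.finite_measure_axioms by metis
  have em: "emeasure \<nu> U = (\<integral>\<^sup>+ x. ennreal (h x) * indicator U x \<partial>m)" if U: "U \<in> sets m" for U
  proof -
    have "emeasure \<nu> U = emeasure (density m (RN_deriv m \<nu>)) U"
      using density_RN_deriv[OF nu_ac sets_nu] by simp
    also have "\<dots> = (\<integral>\<^sup>+ x. RN_deriv m \<nu> x * indicator U x \<partial>m)"
      by (rule emeasure_density) (use U in auto)
    also have "\<dots> = (\<integral>\<^sup>+ x. ennreal (h x) * indicator U x \<partial>m)"
      by (rule nn_integral_cong_AE) (use hRN in auto)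
    finally show ?thesis .
  qed
  have const: "(\<integral>\<^sup>+ x. ennreal b * indicator U x \<partial>m) = ennreal (b * measure m U)"
    if "U \<in> sets m" "b \<ge> 0" for U b
    using that by (simp add: nn_integral_cmult_indicator emeasure_eq_measure ennreal_mult)
  show thesis
  proof (rule that[OF h h0])
    fix U b assume U: "U \<in> sets m" "b \<ge> 0" "\<And>x. x \<in> U \<Longrightarrow> h x \<le> b"
    have "emeasure \<nu> U \<le> (\<integral>\<^sup>+ x. ennreal b * indicator U x \<partial>m)"
      unfolding em[OF U(1)] by (intro nn_integral_mono) (auto split: split_indicator intro: ennreal_leI U(3))
    then show "measure \<nu> U \<le> b * measure m U"
      using U by (simp add: const nu.emeasure_eq_measure)
  next
    fix U a assume U: "U \<in> sets m" "a \<ge> 0" "\<And>x. x \<in> U \<Longrightarrow> a \<le> h x"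
    have "(\<integral>\<^sup>+ x. ennreal a * indicator U x \<partial>m) \<le> emeasure \<nu> U"
      unfolding em[OF U(1)] by (intro nn_integral_mono) (auto split: split_indicator intro: ennreal_leI U(3))
    then show "a * measure m U \<le> measure \<nu> U"
      using U by (simp add: const nu.emeasure_eq_measure)
  qed
qed

lemma nu_density_tail:
  assumes [measurable]: "h \<in> borel_measurable m" and "\<eta> > 0" "\<delta> > 0"
  obtains k :: nat where "measure \<nu> {x \<in> space m. real k * \<eta> \<le> h x} < \<delta>"
proof -
  have sets: "{x \<in> space m. real k * \<eta> \<le> h x} \<in> sets \<nu>" for k :: nat
    unfolding sets_nu by measurable
  have "(\<lambda>k. measure \<nu> {x \<in> space m. real k * \<eta> \<le> h x}) \<longlonglongrightarrow> measure \<nu> (\<Inter>k::nat. {x \<in> space m. real k * \<eta> \<le> h x})"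
  proof (rule nu.finite_Lim_measure_decseq)
    show "decseq (\<lambda>k::nat. {x \<in> space m. real k * \<eta> \<le> h x})"
    proof (rule decseq_SucI, safe)
      fix k x assume "real (Suc k) * \<eta> \<le> h x"
      then show "real k * \<eta> \<le> h x" using \<open>\<eta> > 0\<close> by (simp add: algebra_simps)
    qed
  qed (use sets in auto)
  moreover have "(\<Inter>k::nat. {x \<in> space m. real k * \<eta> \<le> h x}) = {}"
  proof (rule equals0I)
    fix x assume x: "x \<in> (\<Inter>k::nat. {x \<in> space m. real k * \<eta> \<le> h x})"
    obtain k :: nat where "h x < real k * \<eta>" using ex_less_of_nat_mult[OF \<open>\<eta> > 0\<close>] by blast
    moreover have "real k * \<eta> \<le> h x" using x by blast
    ultimately show False by simp
  qed
  ultimately have "(\<lambda>k. measure \<nu> {x \<in> space m. real k * \<eta> \<le> h x}) \<longlonglongrightarrow> 0"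
    by (simp only: measure_empty)
  from order_tendstoD(2)[OF this \<open>\<delta> > 0\<close>] show thesis
    using that eventually_happens'[OF sequentially_bot] by blast
qed

lemma nu_le_measure:
  assumes "\<delta> > 0"
  obtains b where "b \<ge> 0" "\<And>U. U \<in> sets m \<Longrightarrow> measure \<nu> U \<le> b * measure m U + \<delta>"
proof -
  obtain h where h[measurable]: "h \<in> borel_measurable m" "\<And>x. h x \<ge> 0"
    and le: "\<And>U b. \<lbrakk>U \<in> sets m; b \<ge> 0; \<And>x. x \<in> U \<Longrightarrow> h x \<le> b\<rbrakk> \<Longrightarrow> measure \<nu> U \<le> b * measure m U"
    by (rule nu_density) blast
  obtain k :: nat where k: "measure \<nu> {x \<in> space m. real k * 1 \<le> h x} < \<delta>"
    by (rule nu_density_tail[OF h(1) zero_less_one assms])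
  have "measure \<nu> U \<le> real k * measure m U + \<delta>" if U[measurable]: "U \<in> sets m" for U
  proof -
    let ?T = "{x \<in> space m. real k * 1 \<le> h x}"
    have T[measurable]: "?T \<in> sets m" by measurable
    have "U = (U - ?T) \<union> (U \<inter> ?T)" by blast
    then have "measure \<nu> U \<le> measure \<nu> (U - ?T) + measure \<nu> (U \<inter> ?T)"
      using measure_Un_le[of "U - ?T" \<nu> "U \<inter> ?T"] U T sets_nu by (metis sets.Diff sets.Int)
    also have "measure \<nu> (U - ?T) \<le> real k * measure m (U - ?T)"
      using sets.sets_into_space[OF U] by (intro le) auto
    also have "\<dots> \<le> real k * measure m U"
      by (intro mult_left_mono finite_measure_mono) auto
    also have "measure \<nu> (U \<inter> ?T) \<le> measure \<nu> ?T"
      by (intro nu.finite_measure_mono) (use T sets_nu in auto)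
    finally show ?thesis using k by simp
  qed
  then show thesis using that[of "real k"] by simp
qed

text \<open>
  The past event from which hitting probabilities are estimated: \<open>\<nu>\<close>-almost every point belongs
  to it, and almost all continuations, in the sense of the reference measure, are recurrent.
\<close>

definition good :: "'a set" where
  "good = {x \<in> space m. measure m (J (sym x) - recurrent) = 0}"

lemma cylinder_union_symbol: "cylinder_union (Suc 0) {x \<in> space m. P (sym x)}"
  by (rule cylinder_unionI) auto

lemma core_good: "core 0 good"
  unfolding core_def
proof
  show cu: "cylinder_union (Suc 0) good" unfolding good_def by (rule cylinder_union_symbol)
  have [measurable]: "good \<in> sets m" using cylinder_union_sets[OF cu] .
  have "measure m (good \<inter> pre (Suc 0) (space m - recurrent)) \<le> D * 0 * measure m good"
  proof (rule union_distortion_le[OF cu])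
    fix x assume x: "x \<in> good"
    then have "(space m - recurrent) \<inter> J (sym x) = J (sym x) - recurrent"
      using sets.sets_into_space[OF sets_image, of x] by (auto simp: good_def)
    then show "measure m ((space m - recurrent) \<inter> J (sym ((g ^^ 0) x))) \<le> 0"
      using x by (simp add: good_def)
  qed auto
  moreover have "good \<inter> pre (Suc 0) (space m - recurrent) = good - recurrent"
  proof -
    have "pre (Suc 0) (space m - recurrent) = space m - pre (Suc 0) recurrent"
      using iterate_space[of _ "Suc 0"] by blast
    then show ?thesis using pre_recurrent[of "Suc 0"] by (auto simp: good_def)
  qed
  ultimately have "measure m (good - recurrent) \<le> 0" by simp
  then show "measure m (good - recurrent) = 0"
    using measure_nonneg[of m "good - recurrent"] by linarith
qed

text \<open>
  Suppose the image of the current symbol contains non-recurrent points of measure at least \<open>c\<close>.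
  Then a fixed proportion of the current cylinder is not recurrent. But the recurrent set is
  approximated by unions of long cylinders, so cylinders of this kind cover hardly any of it.
  This bounds the probability of such a symbol at a large time \<open>n\<close>, and by invariance this
  probability does not depend on \<open>n\<close>.
\<close>

lemma nu_escaping_symbols_null:
  assumes "c > 0"
  shows "measure \<nu> {x \<in> space m. c \<le> measure m (J (sym x) - recurrent)} = 0"
proof -
  let ?B = "{x \<in> space m. c \<le> measure m (J (sym x) - recurrent)}"
  have B[measurable]: "?B \<in> sets m" using cylinder_union_sets[OF cylinder_union_symbol] .
  have "measure \<nu> ?B \<le> 0 + \<delta>" if "\<delta> > 0" for \<delta>
  proof -
    obtain b where b: "b \<ge> 0" "\<And>U. U \<in> sets m \<Longrightarrow> measure \<nu> U \<le> b * measure m U + \<delta> / 2"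
      by (rule nu_le_measure[OF half_gt_zero[OF \<open>\<delta> > 0\<close>]]) blast
    \<comment> \<open>Chosen such that \<open>b * ((1 + D / c) * \<delta>') \<le> \<delta> / 2\<close> in the final estimate.\<close>
    define \<delta>' where "\<delta>' = \<delta> / (2 * (b + 1) * (1 + D / c))"
    have d': "\<delta>' > 0" unfolding \<delta>'_def using that b(1) D_pos assms by (simp add: add_pos_pos)
    have "\<forall>\<^sub>F n in sequentially. \<exists>W\<subseteq>space m. (\<forall>x\<in>W. cyl (Suc n) x \<subseteq> W) \<and> measure m (recurrent - W) + measure m (W - recurrent) \<le> \<delta>'"
      unfolding cyl_Suc_eq by (rule cylinders_generate[OF recurrent_sets d'])
    from eventually_happens'[OF sequentially_bot this]
    obtain n W where "W \<subseteq> space m" "\<forall>x\<in>W. cyl (Suc n) x \<subseteq> W"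
      and diff: "measure m (recurrent - W) + measure m (W - recurrent) \<le> \<delta>'" by blast
    then have W: "cylinder_union (Suc n) W" by (simp add: cylinder_union_def)
    have diffs: "measure m (recurrent - W) \<le> \<delta>'" "measure m (W - recurrent) \<le> \<delta>'"
      using diff measure_nonneg[of m "recurrent - W"] measure_nonneg[of m "W - recurrent"] by linarith+
    have [measurable]: "W \<in> sets m" using cylinder_union_sets[OF W] .
    let ?W = "W \<inter> pre n ?B"
    have W': "cylinder_union (Suc n) ?W"
    proof (rule cylinder_unionI)
      fix x y assume x: "x \<in> ?W" and y: "y \<in> space m"
        and eq: "\<And>i. i < Suc n \<Longrightarrow> sym ((g ^^ i) y) = sym ((g ^^ i) x)"
      have "y \<in> W" by (rule cylinder_unionD[OF W _ y eq]) (use x in auto)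
      moreover have "y \<in> pre n ?B" using x y eq[of n] iterate_space[OF y, of n] by auto
      ultimately show "y \<in> ?W" by blast
    qed blast
    have "c * measure m ?W \<le> D * measure m (?W \<inter> pre (Suc n) (space m - recurrent))"
    proof (rule union_distortion_ge[OF W'])
      fix x assume x: "x \<in> ?W"
      then have "x \<in> space m" by blast
      then have "(space m - recurrent) \<inter> J (sym ((g ^^ n) x)) = J (sym ((g ^^ n) x)) - recurrent"
        using sets.sets_into_space[OF sets_image[OF iterate_space, of x n]] by blast
      then show "c \<le> measure m ((space m - recurrent) \<inter> J (sym ((g ^^ n) x)))"
        using x by simp
    qed (use assms in auto)
    also have "\<dots> \<le> D * measure m (W - recurrent)"
      using D_pos pre_recurrent[of "Suc n"] by (intro mult_left_mono finite_measure_mono) auto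
    finally have "measure m ?W \<le> D / c * measure m (W - recurrent)"
      using assms by (simp add: field_simps)
    also have "\<dots> \<le> D / c * \<delta>'"
      using diffs D_pos assms by (intro mult_left_mono) auto
    finally have W_le: "measure m ?W \<le> D / c * \<delta>'" .
    have "measure m (recurrent \<inter> pre n ?B) \<le> measure m ((recurrent - W) \<union> ?W)"
      by (intro finite_measure_mono) auto
    also have "\<dots> \<le> measure m (recurrent - W) + measure m ?W"
      by (intro measure_Un_le) auto
    also have "\<dots> \<le> (1 + D / c) * \<delta>'"
      using W_le diffs by (simp add: algebra_simps)
    finally have recurrent_le: "measure m (recurrent \<inter> pre n ?B) \<le> (1 + D / c) * \<delta>'" .
    have "measure \<nu> ?B = measure \<nu> (pre n ?B)" using nu_pre[OF B] by simp
    also have "\<dots> = measure \<nu> (recurrent \<inter> pre n ?B)"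
    proof -
      have "AE x in \<nu>. x \<in> recurrent"
        using nu.prob_eq_1[of recurrent] nu_recurrent recurrent_sets unfolding recurrent_def[symmetric] sets_nu by simp
      then show ?thesis
        by (intro nu.finite_measure_eq_AE) (auto simp: sets_nu intro!: pre_sets B sets.Int)
    qed
    also have "\<dots> \<le> b * ((1 + D / c) * \<delta>') + \<delta> / 2"
      using b(2)[of "recurrent \<inter> pre n ?B"] mult_left_mono[OF recurrent_le b(1)] by auto
    also have "(1 + D / c) * \<delta>' = \<delta> / (2 * (b + 1))"
    proof -
      have "1 + D / c \<noteq> 0" using D_pos assms by (smt (verit) divide_pos_pos)
      then show ?thesis by (simp add: \<delta>'_def)
    qed
    also have "b * (\<delta> / (2 * (b + 1))) \<le> \<delta> / 2"
      using b(1) that by (simp add: field_simps)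
    finally show ?thesis by simp
  qed
  then have "measure \<nu> ?B \<le> 0" by (rule field_le_epsilon)
  then show ?thesis using measure_nonneg[of \<nu> ?B] by linarith
qed

lemma nu_good: "measure \<nu> good = 1"
proof -
  let ?B = "\<lambda>j::nat. {x \<in> space m. 1 / real (Suc j) \<le> measure m (J (sym x) - recurrent)}"
  have sets: "?B j \<in> sets \<nu>" for j
    unfolding sets_nu using cylinder_union_sets[OF cylinder_union_symbol] .
  have "measure \<nu> (?B j) = 0" for j by (rule nu_escaping_symbols_null) simp
  then have "?B j \<in> null_sets \<nu>" for j
    using sets[of j] by (auto simp: null_sets_def nu.emeasure_eq_measure)
  then have "(\<Union>j. ?B j) \<in> null_sets \<nu>" by blast
  moreover have "space m - good = (\<Union>j. ?B j)"
  proof (intro equalityI subsetI)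
    fix x assume "x \<in> space m - good"
    then have x: "x \<in> space m" "measure m (J (sym x) - recurrent) > 0"
      by (auto simp: good_def zero_less_measure_iff)
    then obtain j where "1 / real (Suc j) < measure m (J (sym x) - recurrent)" using nat_approx_posE by metis
    then show "x \<in> (\<Union>j. ?B j)" using x by (auto intro: less_imp_le)
  next
    fix x assume "x \<in> (\<Union>j. ?B j)"
    then obtain j where "x \<in> space m" "1 / real (Suc j) \<le> measure m (J (sym x) - recurrent)" by blast
    moreover have "0 < 1 / real (Suc j)" by simp
    ultimately show "x \<in> space m - good" by (auto simp: good_def simp del: of_nat_Suc)
  qed
  ultimately have "AE x in \<nu>. x \<in> good"
    by (intro AE_I'[of "space m - good"]) (auto simp: nu_space)
  then show ?thesis
    using core_good cylinder_union_sets nu.prob_eq_1[of good] unfolding core_def sets_nu by blast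
qed

end

context recurrent_markov_measure begin

text \<open>
  The bound for past events extends to an arbitrary measurable set in the limit, since at large
  times this set is nearly a past event.
\<close>

lemma visits_asymptotic_le:
  assumes M: "\<And>n B. core n B \<Longrightarrow> visits S (Suc n) B N \<le> M * measure m B" and "M \<ge> 0"
    and E[measurable]: "E \<in> sets m" "E \<subseteq> good" and "\<delta> > 0"
  shows "\<forall>\<^sub>F n in sequentially. visits S (Suc n) E N \<le> M * measure m E + \<delta>"
proof -
  define \<delta>' where "\<delta>' = \<delta> / (M + real N + 1)"
  have d': "\<delta>' > 0" using assms by (simp add: \<delta>'_def add_nonneg_pos)
  have "\<forall>\<^sub>F n in sequentially. \<exists>W\<subseteq>space m. (\<forall>x\<in>W. cyl (Suc n) x \<subseteq> W) \<and> measure m (E - W) + measure m (W - E) \<le> \<delta>'"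
    unfolding cyl_Suc_eq by (rule cylinders_generate[OF E(1) d'])
  then show ?thesis
  proof eventually_elim
    case (elim n)
    then obtain W where W: "cylinder_union (Suc n) W" "measure m (E - W) + measure m (W - E) \<le> \<delta>'"
      unfolding cylinder_union_def by blast
    have diffs: "measure m (E - W) \<le> \<delta>'" "measure m (W - E) \<le> \<delta>'"
      using W(2) measure_nonneg[of m "E - W"] measure_nonneg[of m "W - E"] by linarith+
    have good: "cylinder_union (Suc n) good"
      using core_good cylinder_union_mono unfolding core_def by (meson Suc_le_mono le0)
    have cW: "core n (W \<inter> good)"
      using cylinder_union_Int[OF W(1) good] core_good core_subset[OF core_good, of n "W \<inter> good"] by blast
    have [measurable]: "W \<in> sets m" "good \<in> sets m"
      using cylinder_union_sets[OF W(1)] cylinder_union_sets[OF good] by auto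
    have "visits S (Suc n) E N \<le> (\<Sum>j<N. measure m (W \<inter> good \<inter> pre (Suc n + j) (region S)) + measure m (E - W))"
      unfolding visits_def
    proof (rule sum_mono)
      fix j
      have [measurable]: "pre (Suc n + j) (region S) \<in> sets m" by (intro pre_sets region_sets)
      have "measure m (E \<inter> pre (Suc n + j) (region S))
          \<le> measure m ((W \<inter> good \<inter> pre (Suc n + j) (region S)) \<union> (E - W))"
        using E by (intro finite_measure_mono) auto
      also have "\<dots> \<le> measure m (W \<inter> good \<inter> pre (Suc n + j) (region S)) + measure m (E - W)"
        by (intro measure_Un_le) auto
      finally show "measure m (E \<inter> pre (Suc n + j) (region S))
          \<le> measure m (W \<inter> good \<inter> pre (Suc n + j) (region S)) + measure m (E - W)" .
    qed
    also have "\<dots> = visits S (Suc n) (W \<inter> good) N + real N * measure m (E - W)"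
      by (simp add: visits_def sum.distrib)
    also have "\<dots> \<le> M * measure m (W \<inter> good) + real N * \<delta>'"
      using M[OF cW] diffs by (intro add_mono mult_left_mono) auto
    also have "measure m (W \<inter> good) \<le> measure m (E \<union> (W - E))"
      by (intro finite_measure_mono) auto
    also have "\<dots> \<le> measure m E + measure m (W - E)"
      by (intro measure_Un_le) auto
    also have "\<dots> \<le> measure m E + \<delta>'"
      using diffs by simp
    finally have "visits S (Suc n) E N \<le> M * (measure m E + \<delta>') + real N * \<delta>'"
      using \<open>M \<ge> 0\<close> by (simp add: mult_left_mono)
    also have "\<dots> = M * measure m E + (M + real N) * \<delta>'" by (simp add: algebra_simps)
    also have "(M + real N) * \<delta>' \<le> (M + real N + 1) * \<delta>'" using d' by simp
    also have "\<dots> = \<delta>" using \<open>M \<ge> 0\<close> by (simp add: \<delta>'_def)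
    finally show ?case by simp
  qed
qed

text \<open>
  Decompose the space into the sets on which the density lies between \<open>k * \<eta>\<close> and \<open>(k + 1) * \<eta>\<close>.
  On each of finitely many of them the bound holds asymptotically, and the rest has small
  \<open>\<nu>\<close>-measure. By invariance the expected number of visits under \<open>\<nu>\<close> does not depend on the
  starting time, so that time may tend to infinity.
\<close>

lemma nu_visits_le:
  assumes M: "\<And>n B. core n B \<Longrightarrow> visits S (Suc n) B N \<le> M * measure m B" and "M \<ge> 0"
  shows "real N * measure \<nu> (region S) \<le> M"
proof -
  obtain h where h[measurable]: "h \<in> borel_measurable m" and h0: "\<And>x. h x \<ge> 0"
    and le: "\<And>U b. \<lbrakk>U \<in> sets m; b \<ge> 0; \<And>x. x \<in> U \<Longrightarrow> h x \<le> b\<rbrakk> \<Longrightarrow> measure \<nu> U \<le> b * measure m U"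
    and ge: "\<And>U a. \<lbrakk>U \<in> sets m; a \<ge> 0; \<And>x. x \<in> U \<Longrightarrow> a \<le> h x\<rbrakk> \<Longrightarrow> a * measure m U \<le> measure \<nu> U"
    by (rule nu_density) blast
  have goods[measurable]: "good \<in> sets m" using core_good cylinder_union_sets unfolding core_def by blast
  \<comment> \<open>The total error of the approximation is at most \<open>Q * \<eta>\<close>.\<close>
  define Q where "Q = M * measure m (space m) + real N + 1"
  have Q: "Q > 0" using \<open>M \<ge> 0\<close> by (simp add: Q_def add_nonneg_pos)
  have main: "real N * measure \<nu> (region S) \<le> M + Q * \<eta>" if "\<eta> > 0" for \<eta>
  proof -
    obtain k0 :: nat where k0: "measure \<nu> {x \<in> space m. real k0 * \<eta> \<le> h x} < \<eta>"
      by (rule nu_density_tail[OF h \<open>\<eta> > 0\<close> \<open>\<eta> > 0\<close>])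
    define E where "E k = {x \<in> good. real k * \<eta> \<le> h x \<and> h x < real (Suc k) * \<eta>}" for k :: nat
    let ?T = "{x \<in> space m. real k0 * \<eta> \<le> h x}"
    have gs: "good \<subseteq> space m" by (auto simp: good_def)
    have E_sets[measurable]: "E k \<in> sets m" for k
    proof -
      have "E k = good \<inter> {x \<in> space m. real k * \<eta> \<le> h x \<and> h x < real (Suc k) * \<eta>}"
        using gs by (auto simp: E_def)
      then show ?thesis by simp
    qed
    have E_disj: "disjoint_family_on E A" for A
      unfolding disjoint_family_on_def
    proof (intro ballI impI)
      have "E i \<inter> E j = {}" if "i < j" for i j
      proof (rule equals0I)
        fix x assume "x \<in> E i \<inter> E j"
        then have "real j * \<eta> < real (Suc i) * \<eta>" by (auto simp: E_def)
        moreover have "real (Suc i) * \<eta> \<le> real j * \<eta>" using that \<open>\<eta> > 0\<close> by (intro mult_right_mono) auto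
        ultimately show False by simp
      qed
      then show "E i \<inter> E j = {}" if "i \<noteq> j" for i j using that by (metis Int_commute nat_neq_iff)
    qed
    have cover: "good \<subseteq> (\<Union>k<k0. E k) \<union> ?T"
    proof
      fix x assume x: "x \<in> good"
      show "x \<in> (\<Union>k<k0. E k) \<union> ?T"
      proof (cases "real k0 * \<eta> \<le> h x")
        case False
        define k where "k = nat \<lfloor>h x / \<eta>\<rfloor>"
        have fl: "of_int \<lfloor>h x / \<eta>\<rfloor> \<le> h x / \<eta>" "h x / \<eta> < of_int \<lfloor>h x / \<eta>\<rfloor> + 1" by linarith+
        have "real k = of_int \<lfloor>h x / \<eta>\<rfloor>" using h0[of x] \<open>\<eta> > 0\<close> by (simp add: k_def)
        then have "real k \<le> h x / \<eta>" "h x / \<eta> < real (Suc k)" using fl by linarith+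
        then have 1: "real k * \<eta> \<le> h x" "h x < real (Suc k) * \<eta>"
          using \<open>\<eta> > 0\<close> by (simp_all only: pos_le_divide_eq pos_divide_less_eq)
        then have "real k * \<eta> < real k0 * \<eta>" using False by linarith
        then have "k < k0" using \<open>\<eta> > 0\<close> by simp
        then show ?thesis using x 1 by (auto simp: E_def)
      qed (use x gs in auto)
    qed
    define w where "w = (\<Sum>k<k0. real (Suc k) * \<eta>)"
    have w: "w \<ge> 0" using \<open>\<eta> > 0\<close> by (simp add: w_def sum_nonneg)
    define \<delta> where "\<delta> = \<eta> / (w + 1)"
    have \<delta>: "\<delta> > 0" using \<open>\<eta> > 0\<close> w by (simp add: \<delta>_def add_nonneg_pos)
    have "\<forall>\<^sub>F n in sequentially. \<forall>k\<in>{..<k0}. visits S (Suc n) (E k) N \<le> M * measure m (E k) + \<delta>"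
      using visits_asymptotic_le[OF M \<open>M \<ge> 0\<close> E_sets _ \<delta>]
      by (intro eventually_ball_finite) (auto simp: E_def)
    then obtain n where n: "\<And>k. k < k0 \<Longrightarrow> visits S (Suc n) (E k) N \<le> M * measure m (E k) + \<delta>"
      using eventually_happens'[OF sequentially_bot] by blast
    have step: "measure \<nu> (region S) \<le> (\<Sum>k<k0. real (Suc k) * \<eta> * measure m (E k \<inter> pre (Suc n + j) (region S))) + \<eta>" for j
    proof -
      define A where "A = pre (Suc n + j) (region S)"
      have A[measurable]: "A \<in> sets m" unfolding A_def by (intro pre_sets region_sets)
      have "AE x in \<nu>. x \<in> good" using nu.prob_eq_1[of good] nu_good goods sets_nu by simp
      then have "measure \<nu> A = measure \<nu> (A \<inter> good)"
        by (intro nu.finite_measure_eq_AE) (auto simp: sets_nu)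
      also have "\<dots> \<le> measure \<nu> ((\<Union>k<k0. E k \<inter> A) \<union> ?T)"
        using cover by (intro nu.finite_measure_mono) (auto simp: sets_nu)
      also have "\<dots> \<le> measure \<nu> (\<Union>k<k0. E k \<inter> A) + measure \<nu> ?T"
        by (intro measure_Un_le) (auto simp: sets_nu)
      also have "measure \<nu> (\<Union>k<k0. E k \<inter> A) \<le> (\<Sum>k<k0. measure \<nu> (E k \<inter> A))"
        by (intro nu.finite_measure_subadditive_finite) (auto simp: sets_nu)
      also have "\<dots> \<le> (\<Sum>k<k0. real (Suc k) * \<eta> * measure m (E k \<inter> A))"
        using \<open>\<eta> > 0\<close> by (intro sum_mono le) (auto simp: E_def)
      finally show ?thesis using k0 nu_pre[OF region_sets, of "Suc n + j" S] by (simp add: A_def)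
    qed
    have "real N * measure \<nu> (region S)
        \<le> (\<Sum>j<N. (\<Sum>k<k0. real (Suc k) * \<eta> * measure m (E k \<inter> pre (Suc n + j) (region S))) + \<eta>)"
      using sum_mono[of "{..<N}" "\<lambda>_. measure \<nu> (region S)", OF step] by simp
    also have "\<dots> = (\<Sum>k<k0. real (Suc k) * \<eta> * visits S (Suc n) (E k) N) + real N * \<eta>"
      by (simp add: sum.distrib visits_def sum.swap[of _ "{..<N}"] sum_distrib_left)
    also have "\<dots> \<le> (\<Sum>k<k0. real (Suc k) * \<eta> * (M * measure m (E k) + \<delta>)) + real N * \<eta>"
      using n \<open>\<eta> > 0\<close> by (intro add_right_mono sum_mono mult_left_mono) auto
    also have "\<dots> = M * (\<Sum>k<k0. real k * \<eta> * measure m (E k)) + M * \<eta> * (\<Sum>k<k0. measure m (E k)) + w * \<delta> + real N * \<eta>"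
      by (simp add: algebra_simps sum.distrib sum_distrib_left w_def sum_distrib_right)
    also have "\<dots> \<le> M * 1 + M * \<eta> * measure m (space m) + \<eta> + real N * \<eta>"
    proof (intro add_mono mult_left_mono order_refl)
      have "(\<Sum>k<k0. real k * \<eta> * measure m (E k)) \<le> (\<Sum>k<k0. measure \<nu> (E k))"
        using \<open>\<eta> > 0\<close> by (intro sum_mono ge) (auto simp: E_def)
      also have "\<dots> = measure \<nu> (\<Union>k<k0. E k)"
        by (intro nu.finite_measure_finite_Union[symmetric] E_disj) (auto simp: sets_nu)
      finally show "(\<Sum>k<k0. real k * \<eta> * measure m (E k)) \<le> 1"
        using nu.prob_le_1 order_trans by blast
      have "(\<Sum>k<k0. measure m (E k)) = measure m (\<Union>k<k0. E k)"
        by (intro finite_measure_finite_Union[symmetric] E_disj) auto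
      also have "\<dots> \<le> measure m (space m)" by (rule bounded_measure)
      finally show "(\<Sum>k<k0. measure m (E k)) \<le> measure m (space m)" .
      have "w * \<delta> \<le> (w + 1) * \<delta>" using \<delta> by simp
      then show "w * \<delta> \<le> \<eta>" using w by (simp add: \<delta>_def)
    qed (use \<open>M \<ge> 0\<close> \<open>\<eta> > 0\<close> in auto)
    finally show ?thesis by (simp add: Q_def algebra_simps)
  qed
  show ?thesis
  proof (rule field_le_epsilon)
    fix e :: real assume "e > 0"
    then show "real N * measure \<nu> (region S) \<le> M + e"
      using main[of "e / Q"] Q by simp
  qed
qed

text \<open>
  If \<open>N\<close> is so large that \<open>N\<close> times the \<open>\<nu>\<close>-measure exceeds \<open>(K + D) / c\<close>, then \<open>nu_visits_le\<close>
  together with \<open>visits_le_iterated\<close> shows \<open>base_visits S N \<ge> 1\<close>. In this regime the lower bound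
  for the expected number of visits and the upper bound for the number after the first visit are
  both proportional to \<open>base_visits S N\<close>, so their quotient, which bounds the hitting
  probability from below, does not depend on the set of symbols.
\<close>

theorem exponential_hitting:
  obtains G K C \<rho> where "G \<in> sets m" "measure \<nu> G = 1" "0 \<le> \<rho>" "\<rho> < (1::real)"
    and "\<And>S N q. C \<le> real N * measure \<nu> (region S) \<Longrightarrow>
      measure m {x \<in> G. \<forall>j<q * (K + N). sym ((g ^^ Suc j) x) \<notin> S} \<le> \<rho> ^ q * measure m G"
proof -
  obtain K where K: "K > 0"
    and hit: "\<And>n B. core n B \<Longrightarrow> c0 / 2 * measure m B \<le> D * measure m (B \<inter> pre (Suc n) (visited K))"
    by (rule core_hits) blast
  define c where "c = min 1 (c0 / (2 * D))"
  have c: "0 < c" "c \<le> 1" using c0_pos D_pos by (auto simp: c_def)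
  have hits: "c * measure m B \<le> measure m (B \<inter> pre (Suc n) (visited K))" if "core n B" for n B
  proof -
    have "c * measure m B \<le> c0 / (2 * D) * measure m B"
      by (intro mult_right_mono) (auto simp: c_def)
    also have "\<dots> \<le> measure m (B \<inter> pre (Suc n) (visited K))"
      using hit[OF that] D_pos by (simp add: field_simps)
    finally show ?thesis .
  qed
  define \<mu> where "\<mu> = measure m (space m)"
  \<comment> \<open>For \<open>base_visits S N \<ge> 1\<close> this times \<open>base_visits S N\<close> bounds one plus the expected number of visits after the first one.\<close>
  define Q where "Q = 1 + (real K + D * real K * \<mu> + D) / c"
  define \<rho> where "\<rho> = max 0 (1 - c / (D * Q))"
  have Q: "Q > 0" unfolding Q_def \<mu>_def using c D_pos by (intro add_pos_nonneg) auto
  have \<rho>: "0 \<le> \<rho>" "\<rho> < 1" using c D_pos Q by (auto simp: \<rho>_def)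
  have no_hit: "measure m (no_hit S (Suc n) B (K + N)) \<le> \<rho> * measure m B"
    if NS: "(real K + D) / c \<le> real N * measure \<nu> (region S)" and B: "core n B" for S N n B
  proof -
    let ?e = "base_visits S N" and ?e' = "base_visits S (K + N)"
    let ?M = "\<lambda>e. (real K + D * e) / c"
    have M0: "?M (base_visits S L) \<ge> 0" for L using c D_pos base_visits_nonneg[of S L] by simp
    have "real N * measure \<nu> (region S) \<le> ?M ?e"
      by (rule nu_visits_le[OF visits_le_iterated[OF hits c K _ order_refl] M0])
    then have "(real K + D) / c \<le> ?M ?e" using NS by linarith
    then have e: "1 \<le> ?e" using c D_pos by (simp add: divide_le_cancel)
    have "?e' \<le> ?e + real K * \<mu>"
    proof -
      have "?e' = ?e + (\<Sum>j<K. measure m (J i0 \<inter> pre (N + j) (region S)))"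
      proof -
        have "(\<Sum>j<K + N. f j) = (\<Sum>j<N. f j) + (\<Sum>j<K. f (N + j))" for f :: "nat \<Rightarrow> real"
          by (induction K) (simp_all add: add.commute)
        then show ?thesis unfolding base_visits_def .
      qed
      also have "\<dots> \<le> ?e + (\<Sum>j<K. \<mu>)"
        unfolding \<mu>_def by (intro add_left_mono sum_mono bounded_measure)
      finally show ?thesis by simp
    qed
    then have "?M ?e' \<le> ?M (?e + real K * \<mu>)"
      using c D_pos by (intro divide_right_mono add_left_mono mult_left_mono) auto
    also have "1 + ?M (?e + real K * \<mu>) \<le> ?e * Q"
    proof -
      have "1 * (1 + (real K + D * real K * \<mu>) / c) \<le> ?e * (1 + (real K + D * real K * \<mu>) / c)"
        using e c D_pos by (intro mult_right_mono) (auto simp: \<mu>_def)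
      then show ?thesis unfolding Q_def by (simp add: algebra_simps add_divide_distrib)
    qed
    finally have M'_le: "1 + ?M ?e' \<le> ?e * Q" by simp
    define r where "r = measure m B - measure m (no_hit S (Suc n) B (K + N))"
    have Bs: "B \<in> sets m" using B cylinder_union_sets unfolding core_def by blast
    have r0: "r \<ge> 0"
      unfolding r_def using finite_measure_mono[of "no_hit S (Suc n) B (K + N)" B] Bs by (auto simp: no_hit_def)
    have "?e * c * measure m B \<le> D * visits S (Suc n) B (K + N)"
      by (rule visits_ge[OF hits B])
    also have "visits S (Suc n) B (K + N) \<le> (1 + ?M ?e') * r"
      unfolding r_def by (rule visits_le_hit[OF B visits_le_iterated[OF hits c K]])
    also have "\<dots> \<le> ?e * Q * r" using M'_le r0 by (rule mult_right_mono)
    finally have "?e * (c * measure m B) \<le> ?e * (D * Q * r)"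
      using D_pos by (simp add: mult_ac)
    then have "c * measure m B \<le> D * Q * r" using e by simp
    then have "c / (D * Q) * measure m B \<le> r" using D_pos Q by (simp add: field_simps)
    then have "measure m (no_hit S (Suc n) B (K + N)) \<le> (1 - c / (D * Q)) * measure m B"
      unfolding r_def by (simp add: algebra_simps)
    also have "\<dots> \<le> \<rho> * measure m B" by (intro mult_right_mono) (auto simp: \<rho>_def)
    finally show ?thesis .
  qed
  show thesis
  proof (rule that[OF _ nu_good \<rho>])
    show "good \<in> sets m" using core_good cylinder_union_sets unfolding core_def by blast
    fix S N q assume "(real K + D) / c \<le> real N * measure \<nu> (region S)"
    then have "measure m (no_hit S (Suc 0) good (q * (K + N))) \<le> \<rho> ^ q * measure m good"
      by (intro no_hit_iterate_le no_hit \<rho> core_good)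
    then show "measure m {x \<in> good. \<forall>j<q * (K + N). sym ((g ^^ Suc j) x) \<notin> S} \<le> \<rho> ^ q * measure m good"
      by (simp add: no_hit_def del: funpow.simps)
  qed
qed

end

section \<open>Expanding interval maps\<close>

lemma has_real_derivative_within_unique:
  fixes f :: "real \<Rightarrow> real"
  assumes "is_interval S" "x \<in> S" "S \<noteq> {x}"
    and D: "(f has_real_derivative D) (at x within S)" and E: "(f has_real_derivative E) (at x within S)"
  shows "D = E"
proof -
  have "connected S" using assms(1) by (simp add: is_interval_connected_1)
  moreover have "S \<noteq> {y}" for y using assms(2,3) by auto
  ultimately have "x islimpt S" using connected_imp_perfect[OF _ assms(2)] by blast
  then have "at x within S \<noteq> bot" by (simp add: trivial_limit_within)
  from tendsto_unique[OF this D[unfolded has_field_derivative_iff] E[unfolded has_field_derivative_iff]]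
  show ?thesis .
qed

lemma interval_expansion:
  fixes f :: "real \<Rightarrow> real"
  assumes S: "is_interval S"
    and der: "\<And>x. x \<in> S \<Longrightarrow> \<exists>D. (f has_real_derivative D) (at x within S) \<and> k \<le> \<bar>D\<bar>"
    and xy: "x \<in> S" "y \<in> S"
  shows "k * \<bar>x - y\<bar> \<le> \<bar>f x - f y\<bar>"
proof -
  obtain d where d: "\<And>x. x \<in> S \<Longrightarrow> (f has_real_derivative d x) (at x within S) \<and> k \<le> \<bar>d x\<bar>"
    using bchoice[of S "\<lambda>x D. (f has_real_derivative D) (at x within S) \<and> k \<le> \<bar>D\<bar>"] der by blast
  have *: "k * \<bar>b - a\<bar> \<le> \<bar>f b - f a\<bar>" if ab: "a \<in> S" "b \<in> S" "a \<le> b" for a b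
  proof -
    have sub: "{a..b} \<subseteq> S" using mem_is_interval_1_I[OF S ab(1,2)] by auto
    have "(f has_derivative (*) (d z)) (at z within {a..b})" if "a \<le> z" "z \<le> b" for z
      using d[of z] sub that has_derivative_subset[of f "(*) (d z)" z S "{a..b}"]
      by (auto simp: has_field_derivative_def)
    from mvt_very_simple[OF ab(3) this]
    obtain z where z: "z \<in> {a..b}" "f b - f a = d z * (b - a)" by blast
    then have "k \<le> \<bar>d z\<bar>" using d sub by blast
    then show ?thesis using z(2) by (simp add: abs_mult mult_right_mono)
  qed
  show ?thesis
  proof (cases "x \<le> y")
    case True
    then show ?thesis using *[OF xy] by (simp add: abs_minus_commute)
  next
    case False
    then show ?thesis using *[of y x] xy by simp
  qed
qed

lemma interval_preimage:
  fixes f :: "real \<Rightarrow> real"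
  assumes I: "is_interval I" "continuous_on I f" "inj_on f I" and S: "is_interval S"
  shows "is_interval (I \<inter> f -` S)"
  unfolding is_interval_1
proof (intro ballI allI impI)
  fix a b x assume a: "a \<in> I \<inter> f -` S" and b: "b \<in> I \<inter> f -` S" and "a \<le> x \<and> x \<le> b"
  then have x: "a \<le> x" "x \<le> b" by auto
  have sub: "{a..b} \<subseteq> I" using mem_is_interval_1_I[OF I(1), of a b] a b by auto
  show "x \<in> I \<inter> f -` S"
  proof (cases "x = a \<or> x = b")
    case False
    then have ax: "a < x" "x < b" using x by auto
    have "(f a < f x \<and> f x < f b) \<or> (f b < f x \<and> f x < f a)"
      using continuous_inj_imp_mono[OF ax] continuous_on_subset[OF I(2) sub] inj_on_subset[OF I(3) sub] by blast
    then have "f x \<in> S"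
      using mem_is_interval_1_I[OF S, of "f a" "f b" "f x"] mem_is_interval_1_I[OF S, of "f b" "f a" "f x"] a b by auto
    then show ?thesis using sub x by auto
  qed (use a b in auto)
qed

text \<open>
  Change of variables for the constant function 1; integrability of the derivative is part of
  the conclusion.
\<close>

lemma measure_image_integral:
  fixes f :: "real \<Rightarrow> real"
  assumes S: "S \<in> lmeasurable" and T: "f ` S \<in> lmeasurable"
    and der: "\<And>x. x \<in> S \<Longrightarrow> (f has_real_derivative h x) (at x within S)" and inj: "inj_on f S"
  shows "(\<lambda>x. \<bar>h x\<bar>) integrable_on S" "integral S (\<lambda>x. \<bar>h x\<bar>) = measure lebesgue (f ` S)"
proof -
  have "(\<lambda>_. 1::real) absolutely_integrable_on f ` S"
    using integrable_on_const[OF T] by (intro nonnegative_absolutely_integrable_1) auto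
  moreover have "integral (f ` S) (\<lambda>_. 1::real) = measure lebesgue (f ` S)"
    using lmeasure_integral[OF T] by simp
  ultimately have "(\<lambda>x. \<bar>h x\<bar> * 1) absolutely_integrable_on S \<and>
      integral S (\<lambda>x. \<bar>h x\<bar> * 1) = measure lebesgue (f ` S)"
    by (subst has_absolute_integral_change_of_variables_1'[OF fmeasurableD[OF S] der inj, where f = "\<lambda>_. 1"])
      auto
  then show "(\<lambda>x. \<bar>h x\<bar>) integrable_on S" "integral S (\<lambda>x. \<bar>h x\<bar>) = measure lebesgue (f ` S)"
    by (auto simp: absolutely_integrable_on_def)
qed

lemma integral_const_lmeasurable:
  assumes "S \<in> lmeasurable" shows "integral S (\<lambda>_. c :: real) = c * measure lebesgue S"
  using lmeasure_integral[OF assms] integral_mult_right[of S c "\<lambda>_. 1"] by simp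

lemma measure_image_ge:
  fixes f :: "real \<Rightarrow> real"
  assumes S: "S \<in> lmeasurable" and T: "f ` S \<in> lmeasurable"
    and der: "\<And>x. x \<in> S \<Longrightarrow> (f has_real_derivative h x) (at x within S)" and inj: "inj_on f S"
    and h: "\<And>x. x \<in> S \<Longrightarrow> a \<le> \<bar>h x\<bar>"
  shows "a * measure lebesgue S \<le> measure lebesgue (f ` S)"
proof -
  have "integral S (\<lambda>_. a) \<le> integral S (\<lambda>x. \<bar>h x\<bar>)"
    by (intro integral_le integrable_on_const S measure_image_integral(1)[OF S T der inj] h)
  moreover have "integral S (\<lambda>x. \<bar>h x\<bar>) = measure lebesgue (f ` S)"
    by (rule measure_image_integral(2)[OF S T der inj])
  ultimately show ?thesis by (simp only: integral_const_lmeasurable[OF S])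
qed

lemma measure_image_le:
  fixes f :: "real \<Rightarrow> real"
  assumes S: "S \<in> lmeasurable" and T: "f ` S \<in> lmeasurable"
    and der: "\<And>x. x \<in> S \<Longrightarrow> (f has_real_derivative h x) (at x within S)" and inj: "inj_on f S"
    and h: "\<And>x. x \<in> S \<Longrightarrow> \<bar>h x\<bar> \<le> b"
  shows "measure lebesgue (f ` S) \<le> b * measure lebesgue S"
proof -
  have "integral S (\<lambda>x. \<bar>h x\<bar>) \<le> integral S (\<lambda>_. b)"
    by (intro integral_le integrable_on_const S measure_image_integral(1)[OF S T der inj] h)
  moreover have "integral S (\<lambda>x. \<bar>h x\<bar>) = measure lebesgue (f ` S)"
    by (rule measure_image_integral(2)[OF S T der inj])
  ultimately show ?thesis by (simp only: integral_const_lmeasurable[OF S])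
qed

locale expanding_interval_map =
  fixes g :: "real \<Rightarrow> real" and Y :: "real set" and P :: "real set set"
  assumes markov: "markov_partition_big_images g Y P"
    and expanding: "uniformly_expanding g P"
    and distortion: "bounded_distortion g P"
begin

lemma Y_interval: "is_interval Y" and Y_bounded: "bounded Y"
  and P_countable: "countable P" and P_disjoint: "disjoint P"
  and P_interval: "I \<in> P \<Longrightarrow> is_interval I" and P_subset: "I \<in> P \<Longrightarrow> I \<subseteq> Y"
  and P_cover: "Y - \<Union>P \<in> null_sets lborel"
  using markov unfolding markov_partition_big_images_def by blast+

lemma image_union:
  assumes "I \<in> P" obtains Q where "Q \<subseteq> P" "\<Union>Q \<subseteq> g ` I" "g ` I - \<Union>Q \<in> null_sets lborel"
  using markov assms unfolding markov_partition_big_images_def by blast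

lemma big_images: obtains c0 where "c0 > 0" "\<And>I. I \<in> P \<Longrightarrow> c0 < measure lborel (g ` I)"
  using markov unfolding markov_partition_big_images_def by blast

lemma P_nonempty: "I \<in> P \<Longrightarrow> I \<noteq> {}"
  using big_images by (metis image_empty measure_empty less_asym)

lemma P_borel: "I \<in> P \<Longrightarrow> I \<in> sets borel"
  using P_interval real_interval_borel_measurable by blast

lemma P_bounded: "I \<in> P \<Longrightarrow> bounded I"
  using P_subset Y_bounded bounded_subset by blast

lemma in_cylinders:
  assumes "\<And>i. i \<le> n \<Longrightarrow> w i \<in> P" and "x \<in> (\<Inter>i\<in>{..n}. (g ^^ i) -` w i)"
  shows "(\<Inter>i\<in>{..n}. (g ^^ i) -` w i) \<in> cylinders g P n"
  unfolding cylinders_def using assms by blast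

lemma element_cylinder: assumes "I \<in> P" shows "I \<in> cylinders g P 0"
proof -
  obtain x where "x \<in> I" using P_nonempty[OF assms] by blast
  then show ?thesis using in_cylinders[of 0 "\<lambda>_. I" x] assms by simp
qed

lemma derivative_on_elements:
  obtains k where "k > 0"
    "\<And>I x. \<lbrakk>I \<in> P; x \<in> I\<rbrakk> \<Longrightarrow> \<exists>D. (g has_real_derivative D) (at x within I) \<and> k \<le> \<bar>D\<bar>"
proof -
  obtain L C where LC: "L > 1" "C > 0"
    and *: "\<And>n \<omega> x. \<lbrakk>n \<ge> 1; \<omega> \<in> cylinders g P (n - 1); x \<in> \<omega>\<rbrakk> \<Longrightarrow>
        \<exists>D. ((g ^^ n) has_real_derivative D) (at x within \<omega>) \<and> \<bar>D\<bar> \<ge> C * L ^ n"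
    using expanding unfolding uniformly_expanding_def by blast
  show thesis
  proof (rule that[of "C * L"])
    show "C * L > 0" using LC by simp
    fix I x assume I: "I \<in> P" "x \<in> I"
    show "\<exists>D. (g has_real_derivative D) (at x within I) \<and> C * L \<le> \<bar>D\<bar>"
      using *[of 1 I x] element_cylinder[OF I(1)] I(2) by simp
  qed
qed

lemma g_continuous: assumes "I \<in> P" shows "continuous_on I g"
proof -
  obtain k where "\<And>x. x \<in> I \<Longrightarrow> \<exists>D. (g has_real_derivative D) (at x within I) \<and> k \<le> \<bar>D\<bar>"
    using derivative_on_elements assms by metis
  then show ?thesis
    unfolding continuous_on_eq_continuous_within using DERIV_continuous by blast
qed

lemma g_inj: assumes "I \<in> P" shows "inj_on g I"
proof -
  obtain k where k: "k > 0" and d: "\<And>x. x \<in> I \<Longrightarrow> \<exists>D. (g has_real_derivative D) (at x within I) \<and> k \<le> \<bar>D\<bar>"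
    using derivative_on_elements assms by metis
  show ?thesis
  proof (rule inj_onI)
    fix x y assume "x \<in> I" "y \<in> I" "g x = g y"
    then have "k * \<bar>x - y\<bar> \<le> 0"
      using interval_expansion[OF P_interval[OF assms] d, of x y] by simp
    then show "x = y" using k by (simp add: mult_le_0_iff)
  qed
qed

lemma image_interval: assumes "I \<in> P" shows "is_interval (g ` I)"
  using connected_continuous_image[OF g_continuous[OF assms]] P_interval[OF assms]
  by (simp add: is_interval_connected_1)

lemma image_borel: "I \<in> P \<Longrightarrow> g ` I \<in> sets borel"
  using image_interval real_interval_borel_measurable by blast

lemma element_preimage_borel:
  assumes "I \<in> P" "E \<in> sets borel" shows "I \<inter> g -` E \<in> sets borel"
proof -
  have "g -` E \<inter> space (restrict_space borel I) \<in> sets (restrict_space borel I)"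
    by (rule measurable_sets[OF borel_measurable_continuous_on_restrict[OF g_continuous[OF assms(1)]] assms(2)])
  then have "I \<inter> g -` E \<in> sets (restrict_space borel I)"
    by (simp add: space_restrict_space Int_commute)
  then show ?thesis using P_borel[OF assms(1)] by (auto simp: sets_restrict_space_iff)
qed

lemma union_preimage_borel:
  assumes "E \<in> sets borel" shows "\<Union>P \<inter> g -` E \<in> sets borel"
proof -
  have "\<Union>P \<inter> g -` E = (\<Union>I\<in>P. I \<inter> g -` E)" by blast
  also have "\<dots> \<in> sets borel"
    using element_preimage_borel assms P_countable by (intro sets.countable_UN'') auto
  finally show ?thesis .
qed

text \<open>
  The derivative is bounded away from 0 on an element, so a null image has a null preimage.
\<close>

lemma null_preimage:
  assumes I: "I \<in> P" and E: "E \<in> null_sets lborel" shows "I \<inter> g -` E \<in> null_sets lborel"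
proof -
  obtain k where k: "k > 0" and d: "\<And>x. x \<in> I \<Longrightarrow> \<exists>D. (g has_real_derivative D) (at x within I) \<and> k \<le> \<bar>D\<bar>"
    using derivative_on_elements I by metis
  define h where "h x = (SOME D. (g has_real_derivative D) (at x within I) \<and> k \<le> \<bar>D\<bar>)" for x
  have h: "(g has_real_derivative h x) (at x within I)" "k \<le> \<bar>h x\<bar>" if "x \<in> I" for x
    using someI_ex[OF d[OF that]] unfolding h_def by auto
  let ?S = "I \<inter> g -` E"
  have Sb: "?S \<in> sets borel" using element_preimage_borel[OF I] E by (auto simp: null_sets_def)
  have Sl: "?S \<in> lmeasurable"
    by (intro bounded_set_imp_lmeasurable bounded_subset[OF P_bounded[OF I]]) (use Sb in auto)
  have T0: "g ` ?S \<in> null_sets lebesgue"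
    by (rule null_sets_completion_subset[OF _ null_sets_completionI[OF E]]) auto
  have "k * measure lebesgue ?S \<le> measure lebesgue (g ` ?S)"
  proof (rule measure_image_ge[OF Sl fmeasurableI_null_sets[OF T0]])
    show "inj_on g ?S" using g_inj[OF I] by (rule inj_on_subset) auto
    fix x assume x: "x \<in> ?S"
    show "(g has_real_derivative h x) (at x within ?S)"
      by (rule has_field_derivative_subset[OF h(1)]) (use x in auto)
    show "k \<le> \<bar>h x\<bar>" using h(2) x by blast
  qed
  also have "measure lebesgue (g ` ?S) = 0"
    using T0 by (simp add: null_sets_def measure_def)
  finally have "measure lebesgue ?S \<le> 0" using k by (simp add: mult_le_0_iff)
  then have "measure lebesgue ?S = 0"
    using measure_nonneg[of lebesgue ?S] by linarith
  then have "measure lborel ?S = 0"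
    using Sb by (simp add: measure_completion)
  moreover have "emeasure lborel ?S \<noteq> \<infinity>"
    using Sl Sb by (auto simp: fmeasurable_def emeasure_completion)
  ultimately show ?thesis using Sb
    by (auto simp: null_sets_def emeasure_eq_ennreal_measure)
qed

text \<open>
  The points whose orbit stays in the partition elements. It has full measure in \<open>Y\<close>, and on it
  symbols and iterates are defined without exception.
\<close>

definition \<Omega> :: "real set" where
  "\<Omega> = {y. \<forall>n. (g ^^ n) y \<in> \<Union>P}"

definition sym :: "real \<Rightarrow> real set" where
  "sym y = (THE I. I \<in> P \<and> y \<in> I)"

lemma sym_eq: "\<lbrakk>I \<in> P; y \<in> I\<rbrakk> \<Longrightarrow> sym y = I"
  unfolding sym_def using P_disjoint by (intro the_equality) (auto simp: disjoint_def)

lemma \<Omega>_sym: assumes "x \<in> \<Omega>" shows "sym x \<in> P" "x \<in> sym x"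
proof -
  have "x \<in> \<Union>P" using assms unfolding \<Omega>_def by (metis (mono_tags) funpow_0 mem_Collect_eq)
  then obtain I where "I \<in> P" "x \<in> I" by blast
  then show "sym x \<in> P" "x \<in> sym x" using sym_eq by auto
qed

lemma \<Omega>_iterate: "x \<in> \<Omega> \<Longrightarrow> (g ^^ n) x \<in> \<Omega>"
  by (auto simp: \<Omega>_def simp flip: funpow_add[THEN fun_cong, unfolded o_apply])

lemma \<Omega>_step: "x \<in> \<Omega> \<Longrightarrow> g x \<in> \<Omega>"
  using \<Omega>_iterate[of x 1] by simp

lemma \<Omega>_iff: "y \<in> \<Omega> \<longleftrightarrow> y \<in> \<Union>P \<and> g y \<in> \<Omega>"
proof
  assume "y \<in> \<Union>P \<and> g y \<in> \<Omega>"
  then have "(g ^^ n) y \<in> \<Union>P" for n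
    by (cases n) (simp_all add: \<Omega>_def funpow_Suc_right del: funpow.simps(2))
  then show "y \<in> \<Omega>" by (simp add: \<Omega>_def)
qed (use \<Omega>_step \<Omega>_sym in blast)

lemma \<Omega>_subset: "\<Omega> \<subseteq> Y"
  using \<Omega>_sym P_subset by blast

definition stay :: "nat \<Rightarrow> real set" where
  "stay n = {y. \<forall>i\<le>n. (g ^^ i) y \<in> \<Union>P}"

lemma stay_Suc: "stay (Suc n) = \<Union>P \<inter> g -` stay n"
proof (rule set_eqI)
  fix y
  have "(\<forall>i\<le>Suc n. Q i) \<longleftrightarrow> Q 0 \<and> (\<forall>i\<le>n. Q (Suc i))" for Q
    by (metis Suc_le_mono le0 not0_implies_Suc)
  from this[of "\<lambda>i. (g ^^ i) y \<in> \<Union>P"]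
  show "y \<in> stay (Suc n) \<longleftrightarrow> y \<in> \<Union>P \<inter> g -` stay n"
    by (simp add: stay_def funpow_Suc_right del: funpow.simps(2) Union_iff)
qed

lemma P_Union_borel: "\<Union>P \<in> sets borel"
  using P_borel P_countable by (intro sets.countable_Union) auto

lemma stay_0: "stay 0 = \<Union>P"
  by (simp add: stay_def del: Union_iff)

lemma stay_borel: "stay n \<in> sets borel"
proof (induction n)
  case 0
  show ?case unfolding stay_0 by (rule P_Union_borel)
next
  case (Suc n)
  then show ?case unfolding stay_Suc by (rule union_preimage_borel)
qed

lemma \<Omega>_stay: "\<Omega> = (\<Inter>n. stay n)"
  by (auto simp: \<Omega>_def stay_def)

lemma \<Omega>_borel: "\<Omega> \<in> sets borel"
  unfolding \<Omega>_stay using stay_borel by (intro sets.countable_INT) auto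

lemma Y_borel: "Y \<in> sets borel"
  using Y_interval real_interval_borel_measurable by blast

text \<open>
  Null sets of excess in the Markov property, and hence points that leave the partition elements
  later, have null preimages.
\<close>

lemma stay_null: "Y - stay n \<in> null_sets lborel"
proof (induction n)
  case 0
  show ?case unfolding stay_0 by (rule P_cover)
next
  case (Suc n)
  have one: "I \<inter> g -` (- stay n) \<in> null_sets lborel" if I: "I \<in> P" for I
  proof -
    obtain Q where Q: "Q \<subseteq> P" "\<Union>Q \<subseteq> g ` I" "g ` I - \<Union>Q \<in> null_sets lborel"
      using image_union[OF I] by blast
    let ?E = "(g ` I - \<Union>Q) \<union> (Y - stay n)"
    have "?E \<in> null_sets lborel" using Q(3) Suc by blast
    then have "I \<inter> g -` ?E \<in> null_sets lborel" by (rule null_preimage[OF I])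
    moreover have "I \<inter> g -` (- stay n) \<subseteq> I \<inter> g -` ?E"
      using Q(1) P_subset by blast
    moreover have "I \<inter> g -` (- stay n) \<in> sets lborel"
      using element_preimage_borel[OF I, of "- stay n"] stay_borel[of n] by (simp add: borel_comp)
    ultimately show ?thesis using null_sets_subset by blast
  qed
  have "(\<Union>I\<in>P. I \<inter> g -` (- stay n)) \<in> null_sets lborel"
    using one P_countable by (intro null_sets_UN') auto
  with P_cover have "(Y - \<Union>P) \<union> (\<Union>I\<in>P. I \<inter> g -` (- stay n)) \<in> null_sets lborel" by blast
  moreover have "Y - stay (Suc n) \<in> sets lborel" using Y_borel stay_borel by simp
  moreover have "Y - stay (Suc n) \<subseteq> (Y - \<Union>P) \<union> (\<Union>I\<in>P. I \<inter> g -` (- stay n))"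
    unfolding stay_Suc by blast
  ultimately show ?case using null_sets_subset by blast
qed

lemma \<Omega>_null: "Y - \<Omega> \<in> null_sets lborel"
proof -
  have "(\<Union>n. Y - stay n) \<in> null_sets lborel" using stay_null by blast
  moreover have "Y - \<Omega> = (\<Union>n. Y - stay n)" by (auto simp: \<Omega>_stay)
  ultimately show ?thesis by simp
qed

end

lemma interval_length_le_measure:
  fixes S :: "real set"
  assumes "is_interval S" "S \<in> lmeasurable" "x \<in> S" "y \<in> S"
  shows "\<bar>x - y\<bar> \<le> measure lebesgue S"
proof -
  have "{min x y..max x y} \<subseteq> S"
    using mem_is_interval_1_I[OF assms(1), of "min x y" "max x y"] assms(3,4) by (auto simp: min_def max_def split: if_splits)
  then have "measure lebesgue {min x y..max x y} \<le> measure lebesgue S"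
    by (intro measure_mono_fmeasurable) (use assms in auto)
  then show ?thesis by (simp add: min_def max_def split: if_splits)
qed

lemma nontrivial_interval_not_null:
  fixes S :: "real set"
  assumes "is_interval S" "x \<in> S" "S \<noteq> {x}" "S \<subseteq> T" "T \<in> null_sets lborel" shows False
proof -
  obtain y where y: "y \<in> S" "y \<noteq> x" using assms by blast
  have T: "T \<in> null_sets lebesgue" using assms(5) by (rule null_sets_completionI)
  have S0: "S \<in> null_sets lebesgue" by (rule null_sets_completion_subset[OF assms(4) T])
  then have "\<bar>x - y\<bar> \<le> measure lebesgue S"
    by (intro interval_length_le_measure assms y fmeasurableI_null_sets)
  also have "\<dots> = 0" using S0 by (simp add: null_sets_def measure_def)
  finally show False using y by simp
qed

context expanding_interval_map begin

text \<open>
  The cylinder of \<open>x\<close> in the sense of \<^const>\<open>cylinders\<close>. It is an interval, unlike its intersection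
  with the set of points that stay in the partition elements forever.
\<close>

definition branch_domain :: "nat \<Rightarrow> real \<Rightarrow> real set" where
  "branch_domain n x = {y. \<forall>i\<le>n. (g ^^ i) y \<in> sym ((g ^^ i) x)}"

lemma branch_domain_0: "branch_domain 0 x = sym x"
  by (simp add: branch_domain_def)

lemma branch_domain_Suc: "branch_domain (Suc n) x = sym x \<inter> g -` branch_domain n (g x)"
proof (rule set_eqI)
  fix y
  have "(\<forall>i\<le>Suc n. Q i) \<longleftrightarrow> Q 0 \<and> (\<forall>i\<le>n. Q (Suc i))" for Q
    by (metis Suc_le_mono le0 not0_implies_Suc)
  from this[of "\<lambda>i. (g ^^ i) y \<in> sym ((g ^^ i) x)"]
  show "y \<in> branch_domain (Suc n) x \<longleftrightarrow> y \<in> sym x \<inter> g -` branch_domain n (g x)"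
    by (simp add: branch_domain_def funpow_Suc_right del: funpow.simps(2))
qed

lemma branch_domain_self: "x \<in> \<Omega> \<Longrightarrow> x \<in> branch_domain n x"
  using \<Omega>_sym \<Omega>_iterate by (simp add: branch_domain_def)

lemma branch_domain_cylinder: assumes "x \<in> \<Omega>" shows "branch_domain n x \<in> cylinders g P n"
proof -
  have "branch_domain n x = (\<Inter>i\<in>{..n}. (g ^^ i) -` sym ((g ^^ i) x))"
    by (auto simp: branch_domain_def)
  then show ?thesis
    using in_cylinders[of n "\<lambda>i. sym ((g ^^ i) x)" x] \<Omega>_sym(1)[OF \<Omega>_iterate[OF assms]] branch_domain_self[OF assms, of n] by simp
qed

lemma branch_domain_interval: "x \<in> \<Omega> \<Longrightarrow> is_interval (branch_domain n x)"
proof (induction n arbitrary: x)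
  case 0
  then show ?case using \<Omega>_sym P_interval by (simp add: branch_domain_0)
next
  case (Suc n)
  note I = \<Omega>_sym(1)[OF Suc.prems]
  show ?case unfolding branch_domain_Suc
    by (rule interval_preimage[OF P_interval[OF I] g_continuous[OF I] g_inj[OF I] Suc.IH[OF \<Omega>_step[OF Suc.prems]]])
qed

lemma branch_domain_subset: "branch_domain n x \<subseteq> sym x"
  by (auto simp: branch_domain_def dest: spec[of _ 0])

lemma iterate_inj_on_branch_domain: "x \<in> \<Omega> \<Longrightarrow> inj_on (g ^^ Suc n) (branch_domain n x)"
proof (induction n arbitrary: x)
  case 0
  then show ?case using g_inj \<Omega>_sym by (simp add: branch_domain_0)
next
  case (Suc n)
  have "inj_on g (branch_domain (Suc n) x)"
    by (rule inj_on_subset[OF g_inj[OF \<Omega>_sym(1)[OF Suc.prems]] branch_domain_subset])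
  moreover have "inj_on (g ^^ Suc n) (g ` branch_domain (Suc n) x)"
    by (rule inj_on_subset[OF Suc.IH[OF \<Omega>_step[OF Suc.prems]]]) (auto simp: branch_domain_Suc)
  ultimately show ?case
    unfolding funpow_Suc_right[of "Suc n"] by (rule comp_inj_on)
qed

text \<open>
  Cylinders consisting of a single point carry no information about derivatives; those with more
  points are mapped to cylinders with more points.
\<close>

lemma branch_domain_nontrivial_step:
  assumes x: "x \<in> \<Omega>" and nt: "branch_domain (Suc n) x \<noteq> {x}" shows "branch_domain n (g x) \<noteq> {g x}"
proof
  assume eq: "branch_domain n (g x) = {g x}"
  have "branch_domain (Suc n) x = {x}"
  proof (intro equalityI subsetI)
    fix y assume y: "y \<in> branch_domain (Suc n) x"
    then have "g y = g x" using eq by (auto simp: branch_domain_Suc)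
    then show "y \<in> {x}"
      using inj_onD[OF g_inj[OF \<Omega>_sym(1)[OF x]], of y x] y branch_domain_subset \<Omega>_sym(2)[OF x] by auto
  qed (use branch_domain_self[OF x] in auto)
  then show False using nt by blast
qed

text \<open>
  The image of an element contains the next element or meets it in a null set only. The second
  alternative is impossible when the cylinder is a nondegenerate interval, because its image
  lies in that intersection and is again a nondegenerate interval.
\<close>

lemma next_element_subset_image:
  assumes x: "x \<in> \<Omega>" and nt: "branch_domain (Suc n) x \<noteq> {x}"
  shows "sym (g x) \<subseteq> g ` sym x"
proof -
  note I = \<Omega>_sym(1)[OF x]
  obtain Q where Q: "Q \<subseteq> P" "\<Union>Q \<subseteq> g ` sym x" "g ` sym x - \<Union>Q \<in> null_sets lborel"
    using image_union[OF I] by blast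
  have I': "sym (g x) \<in> P" using \<Omega>_sym(1)[OF \<Omega>_step[OF x]] .
  show ?thesis
  proof (cases "sym (g x) \<in> Q")
    case False
    have "sym (g x) \<inter> \<Union>Q = {}"
      using False Q(1) I' P_disjoint by (auto simp: disjoint_def) (metis disjoint_iff subsetD)
    moreover have im: "g ` branch_domain (Suc n) x \<subseteq> g ` sym x \<inter> sym (g x)"
      using branch_domain_subset[of n "g x"] by (auto simp: branch_domain_Suc)
    ultimately have sub: "g ` branch_domain (Suc n) x \<subseteq> g ` sym x - \<Union>Q" by blast
    have "is_interval (g ` branch_domain (Suc n) x)"
      using connected_continuous_image[OF continuous_on_subset[OF g_continuous[OF I] branch_domain_subset[of "Suc n" x]]] branch_domain_interval[OF x]
      by (simp add: is_interval_connected_1)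
    moreover have "g x \<in> g ` branch_domain (Suc n) x" using branch_domain_self[OF x] by blast
    moreover have "g ` branch_domain (Suc n) x \<noteq> {g x}"
    proof
      assume eq: "g ` branch_domain (Suc n) x = {g x}"
      have "y = x" if y: "y \<in> branch_domain (Suc n) x" for y
      proof (rule inj_onD[OF g_inj[OF I]])
        show "g y = g x" using eq y by blast
      qed (use y branch_domain_subset \<Omega>_sym(2)[OF x] in auto)
      then show False using nt branch_domain_self[OF x] by blast
    qed
    ultimately show ?thesis using nontrivial_interval_not_null[OF _ _ _ sub Q(3)] by blast
  qed (use Q in blast)
qed

text \<open>
  The Markov property: the image of a cylinder depends only on its last symbol.
\<close>

lemma iterate_image_branch_domain:
  "\<lbrakk>x \<in> \<Omega>; branch_domain n x \<noteq> {x}\<rbrakk> \<Longrightarrow> (g ^^ Suc n) ` branch_domain n x = g ` sym ((g ^^ n) x)"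
proof (induction n arbitrary: x)
  case 0
  then show ?case by (simp add: branch_domain_0)
next
  case (Suc n)
  have "branch_domain n (g x) \<subseteq> g ` sym x"
    using next_element_subset_image[OF Suc.prems] branch_domain_subset by blast
  then have "g ` branch_domain (Suc n) x = branch_domain n (g x)" unfolding branch_domain_Suc by blast
  then have "(g ^^ Suc (Suc n)) ` branch_domain (Suc n) x = (g ^^ Suc n) ` branch_domain n (g x)"
    unfolding funpow_Suc_right[of "Suc n"] image_comp[symmetric] by simp
  also have "\<dots> = g ` sym ((g ^^ n) (g x))"
    by (rule Suc.IH[OF \<Omega>_step[OF Suc.prems(1)] branch_domain_nontrivial_step[OF Suc.prems]])
  finally show ?case by (simp add: funpow_swap1)
qed

text \<open>
  Derivatives within a nondegenerate interval are unique, so the derivatives provided separately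
  by expansion and distortion coincide; expansion shows that they do not vanish.
\<close>

lemma step_distortion:
  obtains \<tau> C where "0 < \<tau>" "\<tau> < 1" "0 < C"
    "\<And>n x. \<lbrakk>x \<in> \<Omega>; branch_domain n x \<noteq> {x}\<rbrakk> \<Longrightarrow> \<exists>d. \<forall>y\<in>branch_domain n x. (g has_real_derivative d y) (at y within branch_domain n x) \<and>
       d y \<noteq> 0 \<and> (\<forall>y'\<in>branch_domain n x. \<bar>d y\<bar> \<le> exp (C * \<tau> ^ n) * \<bar>d y'\<bar>)"
proof -
  obtain k where k: "k > 0"
    "\<And>I x. \<lbrakk>I \<in> P; x \<in> I\<rbrakk> \<Longrightarrow> \<exists>D. (g has_real_derivative D) (at x within I) \<and> k \<le> \<bar>D\<bar>"
    using derivative_on_elements by blast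
  obtain \<tau> C where \<tau>: "0 < \<tau>" "\<tau> < 1" "0 < C"
    and dist: "\<forall>n. \<forall>\<omega>\<in>cylinders g P n. \<forall>x\<in>\<omega>. \<forall>y\<in>\<omega>.
        \<exists>D E. (g has_real_derivative D) (at x within \<omega>) \<and>
              (g has_real_derivative E) (at y within \<omega>) \<and> \<bar>ln (\<bar>D\<bar> / \<bar>E\<bar>)\<bar> \<le> C * \<tau> ^ n"
    using distortion unfolding bounded_distortion_def by (elim exE conjE)
  have "\<exists>d. \<forall>y\<in>branch_domain n x. (g has_real_derivative d y) (at y within branch_domain n x) \<and>
       d y \<noteq> 0 \<and> (\<forall>y'\<in>branch_domain n x. \<bar>d y\<bar> \<le> exp (C * \<tau> ^ n) * \<bar>d y'\<bar>)"
    if x: "x \<in> \<Omega>" and nt: "branch_domain n x \<noteq> {x}" for n x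
  proof -
    have uniq: "D = E" if "y \<in> branch_domain n x" "(g has_real_derivative D) (at y within branch_domain n x)"
      "(g has_real_derivative E) (at y within branch_domain n x)" for y D E
    proof (rule has_real_derivative_within_unique[OF branch_domain_interval[OF x] that(1) _ that(2,3)])
      show "branch_domain n x \<noteq> {y}" using nt branch_domain_self[OF x, of n] by auto
    qed
    have "\<exists>D. (g has_real_derivative D) (at y within branch_domain n x) \<and> D \<noteq> 0" if y: "y \<in> branch_domain n x" for y
    proof -
      obtain D where D: "(g has_real_derivative D) (at y within sym x)" "k \<le> \<bar>D\<bar>"
        using k(2)[OF \<Omega>_sym(1)[OF x], of y] y branch_domain_subset by blast
      have "(g has_real_derivative D) (at y within branch_domain n x)"
        by (rule has_field_derivative_subset[OF D(1) branch_domain_subset])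
      then show ?thesis using D(2) k(1) by (intro exI[of _ D]) auto
    qed
    then obtain d where d: "\<And>y. y \<in> branch_domain n x \<Longrightarrow> (g has_real_derivative d y) (at y within branch_domain n x) \<and> d y \<noteq> 0"
      using bchoice[of "branch_domain n x" "\<lambda>y D. (g has_real_derivative D) (at y within branch_domain n x) \<and> D \<noteq> 0"] by blast
    have "\<bar>d y\<bar> \<le> exp (C * \<tau> ^ n) * \<bar>d y'\<bar>" if y: "y \<in> branch_domain n x" and y': "y' \<in> branch_domain n x" for y y'
    proof -
      obtain D E where DE: "(g has_real_derivative D) (at y within branch_domain n x)"
        "(g has_real_derivative E) (at y' within branch_domain n x)" "\<bar>ln (\<bar>D\<bar> / \<bar>E\<bar>)\<bar> \<le> C * \<tau> ^ n"
        using bspec[OF bspec[OF bspec[OF spec[OF dist] branch_domain_cylinder[OF x]] y] y'] by blast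
      have eqs: "D = d y" "E = d y'" using uniq[OF y DE(1)] uniq[OF y' DE(2)] d y y' by blast+
      have "\<bar>d y\<bar> / \<bar>d y'\<bar> = exp (ln (\<bar>d y\<bar> / \<bar>d y'\<bar>))" using d[OF y] d[OF y'] by simp
      also have "\<dots> \<le> exp (C * \<tau> ^ n)" using DE(3) unfolding eqs by (intro iffD2[OF exp_le_cancel_iff]) linarith
      finally show ?thesis using d[OF y'] by (simp add: divide_le_eq)
    qed
    then show ?thesis using d by blast
  qed
  then show thesis using that \<tau> by blast
qed

text \<open>
  By the chain rule the logarithmic distortions along the orbit add up; the \<open>i\<close>-th image of a
  cylinder is a cylinder that is shorter by \<open>i\<close> symbols, so the sum is geometric.
\<close>

lemma iterate_distortion:
  obtains K where "K \<ge> 1"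
    "\<And>n x. \<lbrakk>x \<in> \<Omega>; branch_domain n x \<noteq> {x}\<rbrakk> \<Longrightarrow> \<exists>h. \<forall>y\<in>branch_domain n x. ((g ^^ Suc n) has_real_derivative h y) (at y within branch_domain n x) \<and>
       h y \<noteq> 0 \<and> (\<forall>y'\<in>branch_domain n x. \<bar>h y\<bar> \<le> K * \<bar>h y'\<bar>)"
proof -
  obtain \<tau> C where \<tau>: "0 < \<tau>" "\<tau> < 1" "0 < C" and step:
    "\<And>n x. \<lbrakk>x \<in> \<Omega>; branch_domain n x \<noteq> {x}\<rbrakk> \<Longrightarrow> \<exists>d. \<forall>y\<in>branch_domain n x. (g has_real_derivative d y) (at y within branch_domain n x) \<and>
       d y \<noteq> 0 \<and> (\<forall>y'\<in>branch_domain n x. \<bar>d y\<bar> \<le> exp (C * \<tau> ^ n) * \<bar>d y'\<bar>)"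
    by (rule step_distortion) blast
  have main: "\<exists>h. \<forall>y\<in>branch_domain n x. ((g ^^ Suc n) has_real_derivative h y) (at y within branch_domain n x) \<and>
       h y \<noteq> 0 \<and> (\<forall>y'\<in>branch_domain n x. \<bar>h y\<bar> \<le> exp (C * (\<Sum>i\<le>n. \<tau> ^ i)) * \<bar>h y'\<bar>)"
    if "x \<in> \<Omega>" "branch_domain n x \<noteq> {x}" for n x
    using that
  proof (induction n arbitrary: x)
    case 0
    then show ?case using step[OF 0] by simp
  next
    case (Suc n)
    obtain d where d: "\<And>y. y \<in> branch_domain (Suc n) x \<Longrightarrow> (g has_real_derivative d y) (at y within branch_domain (Suc n) x) \<and>
       d y \<noteq> 0 \<and> (\<forall>y'\<in>branch_domain (Suc n) x. \<bar>d y\<bar> \<le> exp (C * \<tau> ^ Suc n) * \<bar>d y'\<bar>)"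
      using step[OF Suc.prems] by blast
    obtain h where h: "\<And>y. y \<in> branch_domain n (g x) \<Longrightarrow> ((g ^^ Suc n) has_real_derivative h y) (at y within branch_domain n (g x)) \<and>
       h y \<noteq> 0 \<and> (\<forall>y'\<in>branch_domain n (g x). \<bar>h y\<bar> \<le> exp (C * (\<Sum>i\<le>n. \<tau> ^ i)) * \<bar>h y'\<bar>)"
      using Suc.IH[OF \<Omega>_step[OF Suc.prems(1)] branch_domain_nontrivial_step[OF Suc.prems]] by blast
    have im: "g y \<in> branch_domain n (g x)" if "y \<in> branch_domain (Suc n) x" for y using that by (auto simp: branch_domain_Suc)
    have "((g ^^ Suc (Suc n)) has_real_derivative h (g y) * d y) (at y within branch_domain (Suc n) x) \<and>
       h (g y) * d y \<noteq> 0 \<and>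
       (\<forall>y'\<in>branch_domain (Suc n) x. \<bar>h (g y) * d y\<bar> \<le> exp (C * (\<Sum>i\<le>Suc n. \<tau> ^ i)) * \<bar>h (g y') * d y'\<bar>)"
      if y: "y \<in> branch_domain (Suc n) x" for y
    proof (intro conjI ballI)
      have "((g ^^ Suc n) has_real_derivative h (g y)) (at (g y) within g ` branch_domain (Suc n) x)"
        by (rule has_field_derivative_subset[of _ _ _ "branch_domain n (g x)"]) (use h[OF im[OF y]] im in auto)
      then show "((g ^^ Suc (Suc n)) has_real_derivative h (g y) * d y) (at y within branch_domain (Suc n) x)"
        unfolding funpow_Suc_right[of "Suc n"] using d[OF y] by (intro DERIV_image_chain) auto
      show "h (g y) * d y \<noteq> 0" using h[OF im[OF y]] d[OF y] by simp
      fix y' assume y': "y' \<in> branch_domain (Suc n) x"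
      have "\<bar>h (g y)\<bar> * \<bar>d y\<bar> \<le> (exp (C * (\<Sum>i\<le>n. \<tau> ^ i)) * \<bar>h (g y')\<bar>) * (exp (C * \<tau> ^ Suc n) * \<bar>d y'\<bar>)"
        using h[OF im[OF y]] d[OF y] im[OF y'] y' by (intro mult_mono) auto
      also have "\<dots> = exp (C * (\<Sum>i\<le>Suc n. \<tau> ^ i)) * \<bar>h (g y') * d y'\<bar>"
        by (simp add: abs_mult distrib_left exp_add mult_ac)
      finally show "\<bar>h (g y) * d y\<bar> \<le> exp (C * (\<Sum>i\<le>Suc n. \<tau> ^ i)) * \<bar>h (g y') * d y'\<bar>"
        by (simp add: abs_mult)
    qed
    then show ?case by (intro exI[of _ "\<lambda>y. h (g y) * d y"] ballI)
  qed
  show thesis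
  proof (rule that[of "exp (C * (1 / (1 - \<tau>)))"])
    show "1 \<le> exp (C * (1 / (1 - \<tau>)))" using \<tau> by simp
    fix n x assume x: "x \<in> \<Omega>" "branch_domain n x \<noteq> {x}"
    have "(\<Sum>i\<le>n. \<tau> ^ i) \<le> (\<Sum>i. \<tau> ^ i)"
      using \<tau> by (intro sum_le_suminf summable_geometric) auto
    then have "C * (\<Sum>i\<le>n. \<tau> ^ i) \<le> C * (1 / (1 - \<tau>))"
      using \<tau> suminf_geometric[of \<tau>] by (intro mult_left_mono) auto
    then have "exp (C * (\<Sum>i\<le>n. \<tau> ^ i)) * a \<le> exp (C * (1 / (1 - \<tau>))) * a" if "a \<ge> 0" for a
      using that by (intro mult_right_mono) auto
    then show "\<exists>h. \<forall>y\<in>branch_domain n x. ((g ^^ Suc n) has_real_derivative h y) (at y within branch_domain n x) \<and>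
       h y \<noteq> 0 \<and> (\<forall>y'\<in>branch_domain n x. \<bar>h y\<bar> \<le> exp (C * (1 / (1 - \<tau>))) * \<bar>h y'\<bar>)"
      using main[OF x] by (meson abs_ge_zero order_trans)
  qed
qed

end

context expanding_interval_map begin

lemma cyl_eq_branch_domain:
  assumes x: "x \<in> \<Omega>"
  shows "{y \<in> \<Omega>. \<forall>i\<le>n. sym ((g ^^ i) y) = sym ((g ^^ i) x)} = branch_domain n x \<inter> \<Omega>"
proof (intro equalityI subsetI)
  fix y assume y: "y \<in> {y \<in> \<Omega>. \<forall>i\<le>n. sym ((g ^^ i) y) = sym ((g ^^ i) x)}"
  have "(g ^^ i) y \<in> sym ((g ^^ i) x)" if "i \<le> n" for i
    using \<Omega>_sym(2)[OF \<Omega>_iterate, of y i] y that by auto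
  then show "y \<in> branch_domain n x \<inter> \<Omega>" using y by (simp add: branch_domain_def)
next
  fix y assume y: "y \<in> branch_domain n x \<inter> \<Omega>"
  have "sym ((g ^^ i) y) = sym ((g ^^ i) x)" if "i \<le> n" for i
    by (rule sym_eq) (use \<Omega>_sym(1)[OF \<Omega>_iterate[OF x]] y that in \<open>auto simp: branch_domain_def\<close>)
  then show "y \<in> {y \<in> \<Omega>. \<forall>i\<le>n. sym ((g ^^ i) y) = sym ((g ^^ i) x)}" using y by simp
qed

lemma stay_in_branch_domain: "\<lbrakk>x \<in> \<Omega>; y \<in> branch_domain n x; (g ^^ Suc n) y \<in> \<Omega>\<rbrakk> \<Longrightarrow> y \<in> \<Omega>"
proof (induction n arbitrary: x y)
  case 0
  then show ?case using \<Omega>_sym(1) by (subst \<Omega>_iff) (auto simp: branch_domain_0)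
next
  case (Suc n)
  have "g y \<in> branch_domain n (g x)" using Suc.prems(2) by (auto simp: branch_domain_Suc)
  moreover have "(g ^^ Suc n) (g y) \<in> \<Omega>" using Suc.prems(3) unfolding funpow_Suc_right[of "Suc n"] by simp
  ultimately have "g y \<in> \<Omega>" by (rule Suc.IH[OF \<Omega>_step[OF Suc.prems(1)]])
  moreover have "y \<in> \<Union>P" using Suc.prems(2) branch_domain_subset \<Omega>_sym(1)[OF Suc.prems(1)] by blast
  ultimately show ?case by (subst \<Omega>_iff) blast
qed

abbreviation "leb \<equiv> restrict_space lborel \<Omega>"

lemma space_leb: "space leb = \<Omega>"
  by (simp add: space_restrict_space)

lemma sets_leb: "E \<in> sets leb \<longleftrightarrow> E \<in> sets borel \<and> E \<subseteq> \<Omega>"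
  using \<Omega>_borel by (auto simp: sets_restrict_space_iff)

lemma lmeasurable_leb: "E \<in> sets leb \<Longrightarrow> E \<in> lmeasurable"
  by (intro bounded_set_imp_lmeasurable bounded_subset[OF Y_bounded]) (use \<Omega>_subset in \<open>auto simp: sets_leb\<close>)

lemma measure_leb: "E \<in> sets leb \<Longrightarrow> measure leb E = measure lebesgue E"
  by (simp add: sets_leb measure_restrict_space \<Omega>_borel measure_completion)

lemma finite_leb: "finite_measure leb"
proof
  have "\<Omega> \<in> lmeasurable" by (rule lmeasurable_leb) (simp add: sets_leb \<Omega>_borel)
  then have "emeasure lborel \<Omega> \<noteq> \<infinity>" using \<Omega>_borel by (auto simp: fmeasurable_def emeasure_completion)
  then show "emeasure leb (space leb) \<noteq> \<infinity>"
    by (simp add: space_leb emeasure_restrict_space \<Omega>_borel)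
qed

lemma measurable_g_leb: "g \<in> leb \<rightarrow>\<^sub>M leb"
proof (rule measurableI)
  fix E assume E: "E \<in> sets leb"
  have "g -` E \<inter> \<Omega> = (\<Union>P \<inter> g -` E) \<inter> \<Omega>" using \<Omega>_sym by blast
  also have "\<dots> \<in> sets borel" using union_preimage_borel[of E] E \<Omega>_borel by (auto simp: sets_leb)
  finally show "g -` E \<inter> space leb \<in> sets leb" by (simp add: sets_leb space_leb)
qed (simp add: space_leb \<Omega>_step)

lemma measurable_iterate_leb: "g ^^ n \<in> leb \<rightarrow>\<^sub>M leb"
proof (induction n)
  case (Suc n)
  show ?case unfolding funpow.simps(2) by (rule measurable_comp[OF Suc measurable_g_leb])
qed (simp add: id_def)

lemma countable_sym_\<Omega>: "countable (sym ` \<Omega>)"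
  using \<Omega>_sym(1) by (intro countable_subset[OF _ P_countable]) auto

lemma measurable_sym_leb: "sym \<in> leb \<rightarrow>\<^sub>M count_space UNIV"
proof (rule measurableI)
  fix A :: "real set set"
  have "sym -` A \<inter> \<Omega> = (\<Union>I\<in>A \<inter> P. I \<inter> \<Omega>)"
    using \<Omega>_sym sym_eq by blast
  also have "\<dots> \<in> sets borel"
    using P_borel \<Omega>_borel by (intro sets.countable_UN'' countable_Int2 P_countable) auto
  finally show "sym -` A \<inter> space leb \<in> sets leb" by (simp add: sets_leb space_leb)
qed simp

lemma image_leb: "I \<in> P \<Longrightarrow> g ` I \<inter> \<Omega> \<in> sets leb"
  using image_borel \<Omega>_borel by (simp add: sets_leb)

lemma measure_image_leb: assumes "I \<in> P" shows "measure leb (g ` I \<inter> \<Omega>) = measure lborel (g ` I)"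
proof -
  obtain Q where Q: "Q \<subseteq> P" "\<Union>Q \<subseteq> g ` I" "g ` I - \<Union>Q \<in> null_sets lborel"
    using image_union[OF assms] by blast
  let ?N = "(g ` I - \<Union>Q) \<union> (Y - \<Omega>)"
  have N: "?N \<in> null_sets lborel" using Q(3) \<Omega>_null by blast
  have "measure lborel (g ` I) = measure lborel (g ` I - ?N)"
    using image_borel[OF assms] N by (intro measure_Diff_null_set[symmetric]) auto
  also have "g ` I - ?N = (g ` I \<inter> \<Omega>) - ?N" using Q P_subset by blast
  also have "measure lborel \<dots> = measure lborel (g ` I \<inter> \<Omega>)"
    using image_borel[OF assms] \<Omega>_borel N by (intro measure_Diff_null_set) auto
  finally show ?thesis
    using image_leb[OF assms] by (simp add: measure_restrict_space \<Omega>_borel)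
qed

text \<open>
  The number \<open>a\<close> is the absolute value of the derivative of the iterate at \<open>x\<close>, divided by the
  distortion constant.
\<close>

lemma cylinder_measure_bounds:
  obtains K where "K \<ge> 1"
    "\<And>n x. \<lbrakk>x \<in> \<Omega>; branch_domain n x \<noteq> {x}\<rbrakk> \<Longrightarrow> \<exists>a>0. \<forall>E\<in>sets leb.
       a * measure leb (branch_domain n x \<inter> (g ^^ Suc n) -` E) \<le> measure leb (E \<inter> g ` sym ((g ^^ n) x)) \<and>
       measure leb (E \<inter> g ` sym ((g ^^ n) x)) \<le> a * K * measure leb (branch_domain n x \<inter> (g ^^ Suc n) -` E)"
proof -
  obtain K where K: "K \<ge> 1" and h:
    "\<And>n x. \<lbrakk>x \<in> \<Omega>; branch_domain n x \<noteq> {x}\<rbrakk> \<Longrightarrow> \<exists>h. \<forall>y\<in>branch_domain n x. ((g ^^ Suc n) has_real_derivative h y) (at y within branch_domain n x) \<and>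
       h y \<noteq> 0 \<and> (\<forall>y'\<in>branch_domain n x. \<bar>h y\<bar> \<le> K * \<bar>h y'\<bar>)"
    by (rule iterate_distortion) blast
  show thesis
  proof (rule that[of "K * K"])
    show "1 \<le> K * K" using mult_mono[OF K K] K by simp
    fix n x assume x: "x \<in> \<Omega>" "branch_domain n x \<noteq> {x}"
    let ?Z = "branch_domain n x" and ?f = "g ^^ Suc n" and ?J = "g ` sym ((g ^^ n) x)"
    obtain h where h: "\<And>y. y \<in> ?Z \<Longrightarrow> (?f has_real_derivative h y) (at y within ?Z) \<and>
       h y \<noteq> 0 \<and> (\<forall>y'\<in>?Z. \<bar>h y\<bar> \<le> K * \<bar>h y'\<bar>)"
      using h[OF x] by blast
    define a where "a = \<bar>h x\<bar> / K"
    have a: "a > 0" using h[OF branch_domain_self[OF x(1)]] K by (simp add: a_def)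
    have h_ge: "a \<le> \<bar>h y\<bar>" if "y \<in> ?Z" for y
      using h[OF branch_domain_self[OF x(1)]] that K by (simp add: a_def divide_le_eq mult.commute)
    have h_le: "\<bar>h y\<bar> \<le> a * (K * K)" if "y \<in> ?Z" for y
      using h[OF that] branch_domain_self[OF x(1)] K by (simp add: a_def mult.commute)
    have "a * measure leb (?Z \<inter> ?f -` E) \<le> measure leb (E \<inter> ?J) \<and>
       measure leb (E \<inter> ?J) \<le> a * (K * K) * measure leb (?Z \<inter> ?f -` E)" if E: "E \<in> sets leb" for E
    proof -
      let ?S = "?Z \<inter> ?f -` E"
      have E\<Omega>: "E \<subseteq> \<Omega>" using E by (simp add: sets_leb)
      have S\<Omega>: "?S \<subseteq> \<Omega>" using stay_in_branch_domain[OF x(1)] E\<Omega> by blast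
      have pre: "?f -` E \<inter> \<Omega> \<in> sets leb"
        using measurable_sets[OF measurable_iterate_leb E] by (simp only: space_leb)
      have "?Z \<inter> (?f -` E \<inter> \<Omega>) \<in> sets borel"
        by (rule sets.Int[OF real_interval_borel_measurable[OF branch_domain_interval[OF x(1)]] conjunct1[OF pre[unfolded sets_leb]]])
      moreover have "?Z \<inter> (?f -` E \<inter> \<Omega>) = ?S" using S\<Omega> by blast
      ultimately have S: "?S \<in> sets leb" using S\<Omega> by (simp only: sets_leb)
      have "?f ` ?S = E \<inter> ?f ` ?Z" by blast
      then have im: "?f ` ?S = E \<inter> ?J" by (simp only: iterate_image_branch_domain[OF x])
      have "sym ((g ^^ n) x) \<in> P" using \<Omega>_sym(1)[OF \<Omega>_iterate[OF x(1)]] .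
      then have T: "E \<inter> ?J \<in> sets leb" using E image_borel by (auto simp: sets_leb)
      have inj: "inj_on ?f ?S" using iterate_inj_on_branch_domain[OF x(1)] by (rule inj_on_subset) blast
      have der: "(?f has_real_derivative h y) (at y within ?S)" if "y \<in> ?S" for y
        by (rule has_field_derivative_subset[of _ _ _ ?Z]) (use h that in auto)
      note T' = lmeasurable_leb[OF T, folded im]
      have "a * measure lebesgue ?S \<le> measure lebesgue (?f ` ?S)"
        by (rule measure_image_ge[OF lmeasurable_leb[OF S] T' der inj]) (use h_ge in auto)
      moreover have "measure lebesgue (?f ` ?S) \<le> a * (K * K) * measure lebesgue ?S"
        by (rule measure_image_le[OF lmeasurable_leb[OF S] T' der inj]) (use h_le in auto)
      ultimately show ?thesis unfolding im measure_leb[OF S] measure_leb[OF T] by blast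
    qed
    then show "\<exists>a>0. \<forall>E\<in>sets leb.
       a * measure leb (?Z \<inter> ?f -` E) \<le> measure leb (E \<inter> ?J) \<and>
       measure leb (E \<inter> ?J) \<le> a * (K * K) * measure leb (?Z \<inter> ?f -` E)"
      using a by blast
  qed
qed

end

context expanding_interval_map begin

text \<open>
  The expanded image stays in the bounded set \<open>Y\<close>.
\<close>

lemma branch_domain_diameter:
  obtains L C where "L > 1" "C > 0"
    "\<And>n x y y'. \<lbrakk>x \<in> \<Omega>; y \<in> branch_domain n x \<inter> \<Omega>; y' \<in> branch_domain n x \<inter> \<Omega>\<rbrakk> \<Longrightarrow> C * L ^ n * \<bar>y - y'\<bar> \<le> 1"
proof -
  obtain L C where LC: "L > 1" "C > 0" and expand: "\<forall>n\<ge>1. \<forall>\<omega>\<in>cylinders g P (n - 1). \<forall>x\<in>\<omega>.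
        \<exists>D. ((g ^^ n) has_real_derivative D) (at x within \<omega>) \<and> \<bar>D\<bar> \<ge> C * L ^ n"
    using expanding unfolding uniformly_expanding_def by (elim exE conjE)
  obtain b where b: "b > 0" "\<And>x. x \<in> Y \<Longrightarrow> \<bar>x\<bar> \<le> b"
    using Y_bounded unfolding bounded_pos by auto
  have le: "C * L ^ Suc n * \<bar>y - y'\<bar> \<le> 2 * b"
    if x: "x \<in> \<Omega>" and y: "y \<in> branch_domain n x \<inter> \<Omega>" and y': "y' \<in> branch_domain n x \<inter> \<Omega>" for n x y y'
  proof -
    have "\<exists>D. ((g ^^ Suc n) has_real_derivative D) (at z within branch_domain n x) \<and> C * L ^ Suc n \<le> \<bar>D\<bar>"
      if "z \<in> branch_domain n x" for z
      using spec[OF expand, of "Suc n"] branch_domain_cylinder[OF x, of n] that by simp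
    then have "C * L ^ Suc n * \<bar>y - y'\<bar> \<le> \<bar>(g ^^ Suc n) y - (g ^^ Suc n) y'\<bar>"
      by (rule interval_expansion[OF branch_domain_interval[OF x]]) (use y y' in auto)
    also have "\<dots> \<le> \<bar>(g ^^ Suc n) y\<bar> + \<bar>(g ^^ Suc n) y'\<bar>" by (rule abs_triangle_ineq4)
    also have "\<dots> \<le> b + b"
      using y y' \<Omega>_iterate \<Omega>_subset by (intro add_mono b(2)) blast+
    finally show ?thesis by simp
  qed
  show thesis
  proof (rule that[of L "C * L / (2 * b)"])
    show "L > 1" "C * L / (2 * b) > 0" using LC b by auto
    fix n x y y' assume a: "x \<in> \<Omega>" "y \<in> branch_domain n x \<inter> \<Omega>" "y' \<in> branch_domain n x \<inter> \<Omega>"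
    then show "C * L / (2 * b) * L ^ n * \<bar>y - y'\<bar> \<le> 1"
      using le[OF a] b(1) by (simp add: field_simps)
  qed
qed

lemma branch_domain_eq: assumes x: "x \<in> \<Omega>" and y: "y \<in> branch_domain n x" shows "branch_domain n y = branch_domain n x"
proof -
  have "sym ((g ^^ i) y) = sym ((g ^^ i) x)" if "i \<le> n" for i
    by (rule sym_eq) (use \<Omega>_sym(1)[OF \<Omega>_iterate[OF x]] y that in \<open>auto simp: branch_domain_def\<close>)
  then show ?thesis by (simp add: branch_domain_def)
qed

text \<open>
  Squeeze the set between a compact set and an open set of nearly the same measure. Long
  cylinders that meet the compact set lie in the open set, because their diameters tend to 0.
\<close>

lemma cylinders_approximate:
  assumes B: "B \<in> sets leb" and \<delta>: "\<delta> > 0"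
  shows "\<forall>\<^sub>F n in sequentially. \<exists>W\<subseteq>\<Omega>. (\<forall>x\<in>W. branch_domain n x \<inter> \<Omega> \<subseteq> W) \<and> W \<in> sets leb \<and>
      measure leb (B - W) + measure leb (W - B) \<le> \<delta>"
proof -
  have Bl: "B \<in> sets lebesgue" using B by (simp add: sets_leb)
  obtain T where T: "closed T" "T \<subseteq> B" "B - T \<in> lmeasurable" "emeasure lebesgue (B - T) < ennreal (\<delta> / 2)"
    using sets_lebesgue_inner_closed[OF Bl, of "\<delta> / 2"] \<delta> by auto
  have "bounded T" using T(2) B \<Omega>_subset by (intro bounded_subset[OF Y_bounded]) (auto simp: sets_leb)
  then have cT: "compact T" using T(1) by (simp add: compact_eq_bounded_closed)
  have Tb: "T \<in> sets borel" using T(1) by simp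
  obtain U where U: "open U" "T \<subseteq> U" "U - T \<in> lmeasurable" "emeasure lebesgue (U - T) < ennreal (\<delta> / 2)"
    using sets_lebesgue_outer_open[of T "\<delta> / 2"] Tb \<delta> by auto
  have lessD: "measure lebesgue E \<le> \<delta> / 2" if "E \<in> lmeasurable" "emeasure lebesgue E < ennreal (\<delta> / 2)" for E
    using that \<delta> by (simp add: emeasure_eq_measure2 ennreal_less_iff)
  have \<Omega>l: "E \<in> sets leb" if "E \<in> sets borel" "E \<subseteq> \<Omega>" for E using that by (simp add: sets_leb)
  have "\<exists>\<eta>>0. \<forall>x\<in>T. \<forall>y. \<bar>x - y\<bar> < \<eta> \<longrightarrow> y \<in> U"
  proof (cases "T = {}")
    case False
    obtain \<eta> where \<eta>: "\<eta> > 0" "{x. infdist x T \<le> \<eta>} \<subseteq> U"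
      using compact_in_open_separated[OF False cT U(1,2)] by blast
    have "y \<in> U" if "x \<in> T" "\<bar>x - y\<bar> < \<eta>" for x y
      using infdist_le[OF that(1), of y] that(2) \<eta>(2) by (auto simp: dist_real_def abs_minus_commute)
    then show ?thesis using \<eta>(1) by blast
  qed (auto intro: exI[of _ 1])
  then obtain \<eta> where \<eta>: "\<eta> > 0" "\<And>x y. \<lbrakk>x \<in> T; \<bar>x - y\<bar> < \<eta>\<rbrakk> \<Longrightarrow> y \<in> U" by blast
  obtain L C where LC: "L > 1" "C > 0"
    and diam: "\<And>n x y y'. \<lbrakk>x \<in> \<Omega>; y \<in> branch_domain n x \<inter> \<Omega>; y' \<in> branch_domain n x \<inter> \<Omega>\<rbrakk> \<Longrightarrow> C * L ^ n * \<bar>y - y'\<bar> \<le> 1"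
    by (rule branch_domain_diameter) blast
  obtain n0 where n0: "1 / (C * \<eta>) < L ^ n0" using real_arch_pow[OF LC(1)] by blast
  show ?thesis
    unfolding eventually_sequentially
  proof (intro exI[of _ n0] allI impI)
    fix n assume n: "n0 \<le> n"
    have "L ^ n0 \<le> L ^ n" using LC n by (intro power_increasing) auto
    then have "1 / (C * \<eta>) < L ^ n" using n0 by linarith
    then have big: "1 < C * L ^ n * \<eta>" using LC \<eta> by (simp add: field_simps)
    define W where "W = (\<Union>x\<in>T. branch_domain n x \<inter> \<Omega>)"
    have T\<Omega>: "T \<subseteq> \<Omega>" using T(2) B by (auto simp: sets_leb)
    have TW: "T \<subseteq> W" using T\<Omega> branch_domain_self by (auto simp: W_def)
    have WU: "W \<subseteq> U"
    proof
      fix y assume "y \<in> W"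
      then obtain x where x: "x \<in> T" "y \<in> branch_domain n x \<inter> \<Omega>" by (auto simp: W_def)
      have "C * L ^ n * \<bar>x - y\<bar> \<le> 1"
        by (rule diam[of x]) (use x T\<Omega> branch_domain_self in auto)
      then have "C * L ^ n * \<bar>x - y\<bar> < C * L ^ n * \<eta>" using big by linarith
      then have "\<bar>x - y\<bar> < \<eta>" using LC by simp
      then show "y \<in> U" using \<eta>(2) x(1) by blast
    qed
    have Wcl: "branch_domain n x \<inter> \<Omega> \<subseteq> W" if "x \<in> W" for x
    proof -
      obtain z where z: "z \<in> T" "x \<in> branch_domain n z \<inter> \<Omega>" using \<open>x \<in> W\<close> by (auto simp: W_def)
      then have "branch_domain n x = branch_domain n z" using branch_domain_eq T\<Omega> by blast
      then show ?thesis using z(1) by (auto simp: W_def)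
    qed
    have Zb: "branch_domain n x \<inter> \<Omega> \<in> sets borel" if "x \<in> T" for x
      by (rule sets.Int[OF real_interval_borel_measurable[OF branch_domain_interval] \<Omega>_borel]) (use that T\<Omega> in blast)
    have "countable ((\<lambda>x. branch_domain n x \<inter> \<Omega>) ` T)"
    proof -
      let ?c = "\<lambda>w. {y. \<forall>i\<le>n. (g ^^ i) y \<in> w ! i} \<inter> \<Omega>"
      have "branch_domain n x \<inter> \<Omega> \<in> ?c ` lists P" if "x \<in> T" for x
      proof
        let ?w = "map (\<lambda>i. sym ((g ^^ i) x)) [0..<Suc n]"
        have "?w ! i = sym ((g ^^ i) x)" if "i \<le> n" for i using that by (simp del: upt_Suc)
        then show "branch_domain n x \<inter> \<Omega> = ?c ?w" unfolding branch_domain_def by auto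
        have "sym ((g ^^ i) x) \<in> P" for i using \<Omega>_sym(1)[OF \<Omega>_iterate] that T\<Omega> by blast
        then show "?w \<in> lists P" unfolding in_lists_conv_set set_map by blast
      qed
      then have "(\<lambda>x. branch_domain n x \<inter> \<Omega>) ` T \<subseteq> ?c ` lists P" by (rule image_subsetI)
      then show ?thesis
        by (rule countable_subset) (rule countable_image, rule countable_lists, rule P_countable)
    qed
    then have "W \<in> sets borel"
      unfolding W_def by (rule sets.countable_Union) (use Zb in blast)
    then have Ws: "W \<in> sets leb" by (auto simp: sets_leb W_def)
    have "measure leb (B - W) \<le> \<delta> / 2"
    proof -
      have "measure leb (B - W) = measure lebesgue (B - W)" using B Ws by (intro measure_leb) auto
      also have "\<dots> \<le> measure lebesgue (B - T)"
        using TW B Ws T(3) by (intro measure_mono_fmeasurable) (auto simp: sets_leb)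
      also have "\<dots> \<le> \<delta> / 2" by (rule lessD[OF T(3,4)])
      finally show ?thesis .
    qed
    moreover have "measure leb (W - B) \<le> \<delta> / 2"
    proof -
      have "measure leb (W - B) = measure lebesgue (W - B)" using B Ws by (intro measure_leb) auto
      also have "\<dots> \<le> measure lebesgue (U - T)"
        using WU T(2) B Ws U(3) by (intro measure_mono_fmeasurable) (auto simp: sets_leb)
      also have "\<dots> \<le> \<delta> / 2" by (rule lessD[OF U(3,4)])
      finally show ?thesis .
    qed
    ultimately show "\<exists>W\<subseteq>\<Omega>. (\<forall>x\<in>W. branch_domain n x \<inter> \<Omega> \<subseteq> W) \<and> W \<in> sets leb \<and> measure leb (B - W) + measure leb (W - B) \<le> \<delta>"
      using Wcl Ws by (intro exI[of _ W]) (auto simp: sets_leb)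
  qed
qed

text \<open>
  Both distortion conditions follow from \<open>cylinder_measure_bounds\<close>, applied to \<open>E\<close> and to the
  whole space: the unknown derivative cancels in the product, and the measure of the image,
  which remains, lies between \<open>c0\<close> and the total measure.
\<close>

theorem markov_measure_leb:
  obtains D c0 where "markov_measure leb g sym (\<lambda>I. g ` I \<inter> \<Omega>) D c0"
proof -
  interpret leb: finite_measure leb by (rule finite_leb)
  obtain c0 where c0: "c0 > 0" "\<And>I. I \<in> P \<Longrightarrow> c0 < measure lborel (g ` I)" by (rule big_images) blast
  obtain K where K: "K \<ge> 1" and bounds:
    "\<And>n x. \<lbrakk>x \<in> \<Omega>; branch_domain n x \<noteq> {x}\<rbrakk> \<Longrightarrow> \<exists>a>0. \<forall>E\<in>sets leb.
       a * measure leb (branch_domain n x \<inter> (g ^^ Suc n) -` E) \<le> measure leb (E \<inter> g ` sym ((g ^^ n) x)) \<and>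
       measure leb (E \<inter> g ` sym ((g ^^ n) x)) \<le> a * K * measure leb (branch_domain n x \<inter> (g ^^ Suc n) -` E)"
    by (rule cylinder_measure_bounds) blast
  define M where "M = measure leb \<Omega>"
  define D where "D = K * (1 / c0 + M)"
  have M0: "M \<ge> 0" by (simp add: M_def)
  have D: "D > 0" unfolding D_def using K c0 M0 by (intro mult_pos_pos add_pos_nonneg) auto
  have \<Omega>s: "\<Omega> \<in> sets leb" by (simp add: sets_leb \<Omega>_borel)
  have dist: "measure leb (branch_domain n x \<inter> \<Omega> \<inter> (g ^^ Suc n) -` E)
        \<le> D * measure leb (branch_domain n x \<inter> \<Omega>) * measure leb (E \<inter> (g ` sym ((g ^^ n) x) \<inter> \<Omega>)) \<and>
      measure leb (branch_domain n x \<inter> \<Omega>) * measure leb (E \<inter> (g ` sym ((g ^^ n) x) \<inter> \<Omega>))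
        \<le> D * measure leb (branch_domain n x \<inter> \<Omega> \<inter> (g ^^ Suc n) -` E)"
    if x: "x \<in> \<Omega>" and E: "E \<in> sets leb" for n x E
  proof (cases "branch_domain n x = {x}")
    case True
    have null: "measure leb S = 0" if "S \<subseteq> {x}" for S
    proof -
      have "S = {} \<or> S = {x}" using that by blast
      then show ?thesis using x by (auto simp: measure_restrict_space \<Omega>_borel)
    qed
    have "measure leb (branch_domain n x \<inter> \<Omega> \<inter> (g ^^ Suc n) -` E) = 0" "measure leb (branch_domain n x \<inter> \<Omega>) = 0"
      using True by (intro null; blast)+
    then show ?thesis by simp
  next
    case False
    let ?J = "g ` sym ((g ^^ n) x)"
    have I: "sym ((g ^^ n) x) \<in> P" using \<Omega>_sym(1)[OF \<Omega>_iterate[OF x]] .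
    obtain a where a: "a > 0" and ab: "\<And>E. E \<in> sets leb \<Longrightarrow>
       a * measure leb (branch_domain n x \<inter> (g ^^ Suc n) -` E) \<le> measure leb (E \<inter> ?J) \<and>
       measure leb (E \<inter> ?J) \<le> a * K * measure leb (branch_domain n x \<inter> (g ^^ Suc n) -` E)"
      using bounds[OF x False] by blast
    have sub: "E \<subseteq> \<Omega>" using E by (simp add: sets_leb)
    have e1: "branch_domain n x \<inter> \<Omega> \<inter> (g ^^ Suc n) -` E = branch_domain n x \<inter> (g ^^ Suc n) -` E"
      using stay_in_branch_domain[OF x] sub by blast
    have e2: "E \<inter> (?J \<inter> \<Omega>) = E \<inter> ?J" using sub by blast
    have e3: "branch_domain n x \<inter> \<Omega> = branch_domain n x \<inter> (g ^^ Suc n) -` \<Omega>"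
      using stay_in_branch_domain[OF x] \<Omega>_iterate by blast
    define s t z j where "s = measure leb (branch_domain n x \<inter> (g ^^ Suc n) -` E)" and "t = measure leb (E \<inter> ?J)"
      and "z = measure leb (branch_domain n x \<inter> (g ^^ Suc n) -` \<Omega>)" and "j = measure leb (\<Omega> \<inter> ?J)"
    have nn: "s \<ge> 0" "t \<ge> 0" "z \<ge> 0" "j \<ge> 0" by (simp_all add: s_def t_def z_def j_def)
    have b: "a * s \<le> t" "t \<le> a * K * s" "a * z \<le> j" "j \<le> a * K * z"
      using ab[OF E] ab[OF \<Omega>s] unfolding s_def t_def z_def j_def by auto
    have j: "c0 \<le> j" "j \<le> M"
      using measure_image_leb[OF I] c0(2)[OF I] leb.finite_measure_mono[OF _ \<Omega>s, of "\<Omega> \<inter> ?J"]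
      unfolding j_def M_def by (auto simp: Int_commute)
    have "s \<le> D * z * t"
    proof -
      have "c0 \<le> a * K * z" using b j by linarith
      have "c0 * (a * s) \<le> (a * K * z) * t"
        using \<open>c0 \<le> a * K * z\<close> b(1) c0(1) a nn K by (intro mult_mono) auto
      then have "c0 * s \<le> K * z * t" using a by (simp add: mult_ac)
      then have "s \<le> K * (1 / c0) * z * t" using c0(1) by (simp add: field_simps)
      also have "\<dots> \<le> D * z * t"
        unfolding D_def using K M0 nn by (intro mult_right_mono mult_left_mono) auto
      finally show ?thesis .
    qed
    moreover have "z * t \<le> D * s"
    proof -
      have "(a * z) * t \<le> j * (a * K * s)" using b nn a by (intro mult_mono) auto
      then have "z * t \<le> K * j * s" using a by (simp add: mult_ac)
      also have "\<dots> \<le> D * s"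
        unfolding D_def using K j c0(1) nn by (intro mult_right_mono mult_left_mono) (auto intro: add_increasing)
      finally show ?thesis .
    qed
    ultimately show ?thesis unfolding e1 e2 unfolding e3 s_def t_def z_def by blast
  qed
  have "markov_measure leb g sym (\<lambda>I. g ` I \<inter> \<Omega>) D c0"
  proof
    show "g \<in> leb \<rightarrow>\<^sub>M leb" by (rule measurable_g_leb)
    show "sym \<in> leb \<rightarrow>\<^sub>M count_space UNIV" by (rule measurable_sym_leb)
    show "countable (sym ` space leb)" unfolding space_leb by (rule countable_sym_\<Omega>)
    show "0 < c0" "0 < D" by (fact c0(1), fact D)
    fix x assume x: "x \<in> space leb"
    then have x': "x \<in> \<Omega>" by (simp add: space_leb)
    show "g ` sym x \<inter> \<Omega> \<in> sets leb" using image_leb[OF \<Omega>_sym(1)[OF x']] .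
    show "c0 \<le> measure leb (g ` sym x \<inter> \<Omega>)"
      using measure_image_leb c0(2) \<Omega>_sym(1)[OF x'] by (simp add: less_imp_le)
    fix E n assume E: "E \<in> sets leb"
    show "measure leb ({y \<in> space leb. \<forall>i\<le>n. sym ((g ^^ i) y) = sym ((g ^^ i) x)} \<inter> (g ^^ Suc n) -` E)
        \<le> D * measure leb {y \<in> space leb. \<forall>i\<le>n. sym ((g ^^ i) y) = sym ((g ^^ i) x)}
          * measure leb (E \<inter> (g ` sym ((g ^^ n) x) \<inter> \<Omega>))"
      using dist[OF x' E, of n] unfolding space_leb cyl_eq_branch_domain[OF x'] by blast
    show "measure leb {y \<in> space leb. \<forall>i\<le>n. sym ((g ^^ i) y) = sym ((g ^^ i) x)}
          * measure leb (E \<inter> (g ` sym ((g ^^ n) x) \<inter> \<Omega>))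
        \<le> D * measure leb ({y \<in> space leb. \<forall>i\<le>n. sym ((g ^^ i) y) = sym ((g ^^ i) x)} \<inter> (g ^^ Suc n) -` E)"
      using dist[OF x' E, of n] unfolding space_leb cyl_eq_branch_domain[OF x'] by blast
  next
    fix B :: "real set" and \<delta> :: real assume "B \<in> sets leb" "0 < \<delta>"
    from cylinders_approximate[OF this]
    show "\<forall>\<^sub>F n in sequentially. \<exists>W\<subseteq>space leb.
      (\<forall>x\<in>W. {y \<in> space leb. \<forall>i\<le>n. sym ((g ^^ i) y) = sym ((g ^^ i) x)} \<subseteq> W) \<and>
      measure leb (B - W) + measure leb (W - B) \<le> \<delta>"
    proof eventually_elim
      case (elim n)
      then obtain W where W: "W \<subseteq> \<Omega>" "\<forall>x\<in>W. branch_domain n x \<inter> \<Omega> \<subseteq> W" "measure leb (B - W) + measure leb (W - B) \<le> \<delta>"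
        by blast
      then have "\<forall>x\<in>W. {y \<in> \<Omega>. \<forall>i\<le>n. sym ((g ^^ i) y) = sym ((g ^^ i) x)} \<subseteq> W"
        using cyl_eq_branch_domain by blast
      then show ?case unfolding space_leb using W by blast
    qed
  qed
  then show thesis using that by blast
qed

end

section \<open>The invariant measure of an expanding interval map\<close>

locale expanding_interval_map_acip = expanding_interval_map g Y P
  for g Y P + fixes N :: "real measure"
  assumes acip: "unique_acip g Y N"
begin

lemma N_sets: "sets N = sets (restrict_space borel Y)" and N_prob: "prob_space N"
  and N_invariant: "invariant_measure g N" and N_ac: "absolutely_continuous (restrict_space lborel Y) N"
  using acip unfolding unique_acip_def acip_def by blast+

sublocale N: prob_space N by (rule N_prob)

lemma sets_N: "E \<in> sets N \<longleftrightarrow> E \<in> sets borel \<and> E \<subseteq> Y"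
  unfolding N_sets using Y_borel by (auto simp: sets_restrict_space_iff)

lemma space_N: "space N = Y"
  using sets_eq_imp_space_eq[OF N_sets] by (simp add: space_restrict_space)

lemma N_null: assumes "E \<in> null_sets lborel" "E \<subseteq> Y" shows "E \<in> null_sets N"
proof -
  have "E \<in> null_sets (restrict_space lborel Y)"
    using assms Y_borel by (subst null_sets_restrict_space) auto
  then show ?thesis using N_ac unfolding absolutely_continuous_def by blast
qed

lemma leb_sets_N: "E \<in> sets leb \<Longrightarrow> E \<in> sets N"
  using \<Omega>_subset by (auto simp: sets_leb sets_N)

lemma AE_\<Omega>: "AE x in N. x \<in> \<Omega>"
  by (rule AE_I'[OF N_null[OF \<Omega>_null]]) (auto simp: space_N)

lemma N_pre: assumes "E \<in> sets leb" shows "measure N (g -` E \<inter> \<Omega>) = measure N E"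
proof -
  have E: "E \<in> sets N" using leb_sets_N[OF assms] .
  have inv: "g -` E \<inter> Y \<in> sets N" "emeasure N (g -` E \<inter> Y) = emeasure N E"
    using N_invariant E unfolding invariant_measure_def space_N by blast+
  have "g -` E \<inter> \<Omega> \<in> sets leb"
    using measurable_sets[OF measurable_g_leb assms] by (simp add: space_leb)
  then have "measure N (g -` E \<inter> \<Omega>) = measure N (g -` E \<inter> Y)"
    using AE_\<Omega> \<Omega>_subset by (intro N.finite_measure_eq_AE) (auto intro: leb_sets_N inv)
  then show ?thesis using inv(2) by (simp add: measure_def)
qed

lemma N_pre_iterate: "E \<in> sets leb \<Longrightarrow> measure N ((g ^^ n) -` E \<inter> \<Omega>) = measure N E"
proof (induction n)
  case 0
  then have "E \<inter> \<Omega> = E" by (auto simp: sets_leb)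
  then show ?case by simp
next
  case (Suc n)
  have s: "(g ^^ n) -` E \<inter> \<Omega> \<in> sets leb"
    using measurable_sets[OF measurable_iterate_leb Suc.prems] by (simp only: space_leb)
  have "(g ^^ Suc n) -` E \<inter> \<Omega> = g -` ((g ^^ n) -` E \<inter> \<Omega>) \<inter> \<Omega>"
    unfolding funpow_Suc_right using \<Omega>_step by auto
  then have "measure N ((g ^^ Suc n) -` E \<inter> \<Omega>) = measure N ((g ^^ n) -` E \<inter> \<Omega>)"
    using N_pre[OF s] by simp
  also have "\<dots> = measure N E" using Suc by blast
  finally show ?case .
qed

text \<open>
  Conditioning on an invariant set of positive measure yields another invariant, absolutely
  continuous probability measure.
\<close>

lemma N_ergodic:
  assumes V: "V \<in> sets leb" and inv: "g -` V \<inter> \<Omega> = V" and pos: "measure N V > 0"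
  shows "measure N V = 1"
proof -
  let ?U = "uniform_measure N V"
  have VN: "V \<in> sets N" using leb_sets_N[OF V] .
  have V\<Omega>: "V \<subseteq> \<Omega>" using V by (simp add: sets_leb)
  have V0: "emeasure N V \<noteq> 0" "emeasure N V \<noteq> \<infinity>"
    using pos by (auto simp: N.emeasure_eq_measure)
  have "acip g Y ?U"
    unfolding acip_def
  proof (intro conjI)
    show "sets ?U = sets (restrict_space borel Y)" using N_sets by simp
    show "prob_space ?U" using V0 by (intro prob_space_uniform_measure) auto
    show "invariant_measure g ?U"
      unfolding invariant_measure_def
    proof (intro ballI conjI)
      fix A assume "A \<in> sets ?U"
      then have A: "A \<in> sets N" by simp
      have pre: "g -` A \<inter> Y \<in> sets N"
        using N_invariant A unfolding invariant_measure_def space_N by blast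
      then show "g -` A \<inter> space ?U \<in> sets ?U" by (simp add: space_N)
      have AV: "A \<inter> V \<in> sets leb" using A V by (auto simp: sets_leb sets_N)
      have "V \<inter> (g -` A \<inter> Y) = g -` (A \<inter> V) \<inter> \<Omega>"
        using inv V\<Omega> \<Omega>_subset by blast
      then have "measure N (V \<inter> (g -` A \<inter> Y)) = measure N (A \<inter> V)"
        using N_pre[OF AV] by simp
      then show "emeasure ?U (g -` A \<inter> space ?U) = emeasure ?U A"
        using pre A VN by (simp add: space_N N.emeasure_eq_measure Int_commute)
    qed
    show "absolutely_continuous (restrict_space lborel Y) ?U"
      unfolding absolutely_continuous_def
    proof
      fix E assume "E \<in> null_sets (restrict_space lborel Y)"
      then have "E \<in> null_sets N" using N_ac unfolding absolutely_continuous_def by blast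
      then have "E \<in> sets N" "V \<inter> E \<in> null_sets N"
        using VN null_sets_subset[of E N "V \<inter> E"] by auto
      then show "E \<in> null_sets ?U" using VN by (auto simp: null_sets_def)
    qed
  qed
  then have "?U = N" using acip unfolding unique_acip_def by blast
  then have "measure N V = measure ?U V" by simp
  also have "\<dots> = 1" using V0 VN pos by (subst measure_uniform_measure) (auto simp: N.emeasure_eq_measure)
  finally show ?thesis .
qed

text \<open>
  Countably many elements cover almost everything, so one of them has positive measure. The set
  of points that visit it infinitely often has at least that measure, being the decreasing limit
  of sets that contain preimages of the element; by ergodicity it has full measure.
\<close>

lemma recurrent_element:
  obtains i0 where "i0 \<in> sym ` \<Omega>" "measure N {x \<in> \<Omega>. \<exists>\<^sub>\<infinity>n. sym ((g ^^ n) x) = i0} = 1"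
proof -
  have s: "{x \<in> \<Omega>. sym x = i} \<in> sets leb" for i
  proof -
    have "sym -` {i} \<inter> space leb \<in> sets leb" by (rule measurable_sets[OF measurable_sym_leb]) simp
    then show ?thesis by (simp add: space_leb vimage_def Int_def conj_commute)
  qed
  have "\<exists>i\<in>sym ` \<Omega>. measure N {x \<in> \<Omega>. sym x = i} \<noteq> 0"
  proof (rule ccontr)
    assume "\<not> ?thesis"
    then have "{x \<in> \<Omega>. sym x = i} \<in> null_sets N" if "i \<in> sym ` \<Omega>" for i
      using that leb_sets_N[OF s] by (auto simp: null_sets_def N.emeasure_eq_measure)
    then have "(\<Union>i\<in>sym ` \<Omega>. {x \<in> \<Omega>. sym x = i}) \<in> null_sets N"
      by (intro null_sets_UN' countable_sym_\<Omega>)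
    moreover have "(\<Union>i\<in>sym ` \<Omega>. {x \<in> \<Omega>. sym x = i}) = \<Omega>" by blast
    ultimately have "AE x in N. x \<notin> \<Omega>" using AE_not_in by auto
    with AE_\<Omega> have "AE x in N. False" by eventually_elim simp
    then show False using N.AE_False by blast
  qed
  then obtain i0 where i0: "i0 \<in> sym ` \<Omega>" "measure N {x \<in> \<Omega>. sym x = i0} > 0"
    by (auto simp: zero_less_measure_iff)
  let ?A = "{x \<in> \<Omega>. sym x = i0}"
  define T where "T n = (\<Union>k\<in>{n..}. (g ^^ k) -` ?A \<inter> \<Omega>)" for n
  define V where "V = {x \<in> \<Omega>. \<exists>\<^sub>\<infinity>n. sym ((g ^^ n) x) = i0}"
  have pre: "(g ^^ k) -` ?A \<inter> \<Omega> \<in> sets leb" for k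
    using measurable_sets[OF measurable_iterate_leb s] by (simp only: space_leb)
  have T: "T n \<in> sets leb" for n unfolding T_def using pre by (intro sets.countable_UN') auto
  have VT: "V = (\<Inter>n. T n)"
    unfolding V_def T_def INFM_nat_le using \<Omega>_iterate by (auto simp: Bex_def)
  have Vs: "V \<in> sets leb" unfolding VT using T by (intro sets.countable_INT) auto
  have "(\<lambda>n. measure N (T n)) \<longlonglongrightarrow> measure N (\<Inter>n. T n)"
  proof (rule N.finite_Lim_measure_decseq)
    show "range T \<subseteq> sets N" using T leb_sets_N by blast
    show "decseq T" unfolding decseq_def T_def by (intro allI impI UN_mono) auto
  qed
  moreover have "measure N ?A \<le> measure N (T n)" for n
  proof -
    have "measure N ?A = measure N ((g ^^ n) -` ?A \<inter> \<Omega>)" using N_pre_iterate[OF s] by simp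
    also have "\<dots> \<le> measure N (T n)"
      using T leb_sets_N by (intro N.finite_measure_mono) (auto simp: T_def)
    finally show ?thesis .
  qed
  ultimately have "measure N ?A \<le> measure N V" unfolding VT by (intro LIMSEQ_le_const) auto
  then have pos: "measure N V > 0" using i0 by linarith
  have "g -` V \<inter> \<Omega> = V"
  proof -
    have "(\<exists>\<^sub>\<infinity>n. sym ((g ^^ n) (g x)) = i0) \<longleftrightarrow> (\<exists>\<^sub>\<infinity>n. sym ((g ^^ n) x) = i0)" for x
      using eventually_sequentially_Suc[of "\<lambda>k. sym ((g ^^ k) x) \<noteq> i0"]
      by (simp add: frequently_def cofinite_eq_sequentially funpow_swap1)
    then show ?thesis unfolding V_def using \<Omega>_step by auto
  qed
  then have "measure N V = 1" using N_ergodic[OF Vs _ pos] by blast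
  then show thesis using that i0(1) unfolding V_def by blast
qed

abbreviation "nu \<equiv> restrict_space N \<Omega>"

lemma \<Omega>_N: "\<Omega> \<in> sets N"
  by (rule leb_sets_N) (simp add: sets_leb \<Omega>_borel)

lemma sets_nu: "sets nu = sets leb"
proof (rule set_eqI)
  show "E \<in> sets nu \<longleftrightarrow> E \<in> sets leb" for E
    using \<Omega>_N order_trans[OF _ \<Omega>_subset, of E]
    by (auto simp: sets_restrict_space_iff sets_leb sets_N)
qed

lemma space_nu: "space nu = \<Omega>"
  using sets_eq_imp_space_eq[OF sets_nu] by (simp add: space_leb)

lemma measure_nu: "E \<subseteq> \<Omega> \<Longrightarrow> measure nu E = measure N E"
  using \<Omega>_N by (intro measure_restrict_space) auto

lemma prob_space_nu: "prob_space nu"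
proof
  have "measure N \<Omega> = 1" using AE_\<Omega> \<Omega>_N N.prob_eq_1 by blast
  then show "emeasure nu (space nu) = 1"
    unfolding space_nu using \<Omega>_N by (simp add: emeasure_restrict_space N.emeasure_eq_measure)
qed

lemma AE_nu_iff: "(AE x in nu. Q x) \<longleftrightarrow> (AE x in N. Q x)"
proof -
  have "(AE x in nu. Q x) \<longleftrightarrow> (AE x in N. x \<in> \<Omega> \<longrightarrow> Q x)"
    using \<Omega>_N by (intro AE_restrict_space_iff) auto
  also have "\<dots> \<longleftrightarrow> (AE x in N. Q x)"
    using AE_\<Omega> by (auto intro: AE_mp)
  finally show ?thesis .
qed

lemma AE_leb_imp_AE_N: assumes "AE x in leb. Q x" shows "AE x in N. Q x"
proof -
  obtain E where E: "{x \<in> space leb. \<not> Q x} \<subseteq> E" "E \<in> null_sets leb"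
    using assms by (auto simp: eventually_ae_filter)
  then have "E \<in> null_sets lborel" "E \<subseteq> \<Omega>"
    using \<Omega>_borel by (subst (asm) null_sets_restrict_space; auto)+
  then have "E \<in> null_sets N" using N_null \<Omega>_subset by blast
  then have "AE x in N. x \<notin> E" by (rule AE_not_in)
  with AE_\<Omega> show ?thesis
  proof eventually_elim
    case (elim x)
    then show ?case using E(1) by (auto simp: space_leb)
  qed
qed

text \<open>
  The period \<open>K + k\<close> consists of the \<open>k\<close> steps in which hits are expected and the \<open>K\<close> steps for
  reaching the base element.
\<close>

theorem exponential_hitting_acip:
  obtains G K C \<rho> where "G \<in> sets leb" "measure N G = 1" "0 \<le> \<rho>" "\<rho> < (1::real)"
    and "\<And>S k q. C \<le> real k * measure N {x \<in> \<Omega>. sym x \<in> S} \<Longrightarrow>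
      measure leb {x \<in> G. \<forall>j<q * (K + k). sym ((g ^^ Suc j) x) \<notin> S} \<le> \<rho> ^ q * measure leb G"
proof -
  obtain D c0 where mm: "markov_measure leb g sym (\<lambda>I. g ` I \<inter> \<Omega>) D c0" by (rule markov_measure_leb)
  obtain i0 where i0: "i0 \<in> sym ` \<Omega>" "measure N {x \<in> \<Omega>. \<exists>\<^sub>\<infinity>n. sym ((g ^^ n) x) = i0} = 1"
    by (rule recurrent_element)
  have "recurrent_markov_measure leb g sym (\<lambda>I. g ` I \<inter> \<Omega>) D c0 nu i0"
    unfolding recurrent_markov_measure_def recurrent_markov_measure_axioms_def
  proof (intro conjI allI impI)
    show "markov_measure leb g sym (\<lambda>I. g ` I \<inter> \<Omega>) D c0" by (rule mm)
    show "prob_space nu" by (rule prob_space_nu)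
    show "sets nu = sets leb" by (rule sets_nu)
    show "absolutely_continuous leb nu"
      unfolding absolutely_continuous_def
    proof
      fix E assume E: "E \<in> null_sets leb"
      then have "E \<in> null_sets lborel" "E \<subseteq> \<Omega>"
        using \<Omega>_borel by (subst (asm) null_sets_restrict_space; auto)+
      then have "E \<in> null_sets N" using N_null \<Omega>_subset by blast
      then show "E \<in> null_sets nu"
        using \<Omega>_N \<open>E \<subseteq> \<Omega>\<close> by (subst null_sets_restrict_space) auto
    qed
    show "measure nu (g -` E \<inter> space leb) = measure nu E" if "E \<in> sets leb" for E
      using N_pre[OF that] that by (simp add: space_leb measure_nu sets_leb)
    show "i0 \<in> sym ` space leb" using i0 by (simp add: space_leb)
    show "measure nu {x \<in> space leb. \<exists>\<^sub>\<infinity>n. sym ((g ^^ n) x) = i0} = 1"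
      using i0(2) by (subst measure_nu) (auto simp: space_leb)
  qed
  then interpret rmm: recurrent_markov_measure leb g sym "\<lambda>I. g ` I \<inter> \<Omega>" D c0 nu i0 .
  obtain G K C \<rho> where G: "G \<in> sets leb" "measure nu G = 1" "0 \<le> \<rho>" "\<rho> < (1::real)"
    and hit: "\<And>S N q. C \<le> real N * measure nu (rmm.region S) \<Longrightarrow>
      measure leb {x \<in> G. \<forall>j<q * (K + N). sym ((g ^^ Suc j) x) \<notin> S} \<le> \<rho> ^ q * measure leb G"
    by (rule rmm.exponential_hitting) blast
  show thesis
  proof (rule that[of G \<rho> C K])
    show "measure N G = 1" using G measure_nu[of G] by (simp add: sets_leb)
    fix S k q assume "C \<le> real k * measure N {x \<in> \<Omega>. sym x \<in> S}"
    then have "C \<le> real k * measure nu (rmm.region S)" unfolding space_leb by (subst measure_nu) auto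
    then show "measure leb {x \<in> G. \<forall>j<q * (K + k). sym ((g ^^ Suc j) x) \<notin> S} \<le> \<rho> ^ q * measure leb G"
      by (rule hit)
  qed (use G in auto)
qed

end

section \<open>Growth of return time sums\<close>

context expanding_interval_map_acip begin

lemma measurable_iterate_nu: "g ^^ n \<in> nu \<rightarrow>\<^sub>M nu"
  using measurable_iterate_leb measurable_cong_sets[OF sets_nu sets_nu] by blast

lemma distr_iterate: "distr nu nu (g ^^ n) = nu"
proof (rule measure_eqI)
  interpret nu: prob_space nu by (rule prob_space_nu)
  fix E assume "E \<in> sets (distr nu nu (g ^^ n))"
  then have E: "E \<in> sets nu" by simp
  have "emeasure (distr nu nu (g ^^ n)) E = emeasure nu ((g ^^ n) -` E \<inter> \<Omega>)"
    using emeasure_distr[OF measurable_iterate_nu E] by (simp only: space_nu)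
  also have "\<dots> = ennreal (measure N ((g ^^ n) -` E \<inter> \<Omega>))"
    by (simp add: nu.emeasure_eq_measure measure_nu)
  also have "\<dots> = emeasure nu E"
    using N_pre_iterate[of E n] E unfolding sets_nu
    by (simp add: nu.emeasure_eq_measure measure_nu sets_leb)
  finally show "emeasure (distr nu nu (g ^^ n)) E = emeasure nu E" .
qed simp

lemma nn_integral_iterate:
  assumes "u \<in> borel_measurable nu"
  shows "(\<integral>\<^sup>+ x. u ((g ^^ n) x) \<partial>nu) = (\<integral>\<^sup>+ x. u x \<partial>nu)"
proof -
  have "(\<integral>\<^sup>+ x. u x \<partial>nu) = (\<integral>\<^sup>+ x. u x \<partial>distr nu nu (g ^^ n))" by (simp only: distr_iterate)
  also have "\<dots> = (\<integral>\<^sup>+ x. u ((g ^^ n) x) \<partial>nu)"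
    by (rule nn_integral_distr[OF measurable_iterate_nu]) (simp only: distr_iterate assms)
  finally show ?thesis by simp
qed

text \<open>
  The period in \<open>exponential_hitting_acip\<close> is of order \<open>2\<^bsup>\<kappa>i\<^esup>\<close>, so \<open>2\<^sup>i\<close> steps contain at least
  \<open>i\<close> periods for large \<open>i\<close>, and the failure probabilities are bounded by the geometric series
  with ratio \<open>\<rho>\<close>.
\<close>

lemma hits_eventually:
  fixes S :: "nat \<Rightarrow> real set set"
  assumes b: "b > 0" and \<kappa>: "0 \<le> \<kappa>" "\<kappa> < 1"
    and tail: "\<And>i. b * 2 powr (- \<kappa> * real i) \<le> measure N {x \<in> \<Omega>. sym x \<in> S i}"
  shows "AE x in N. \<forall>\<^sub>F i in sequentially. \<exists>j\<in>{1..2 ^ i}. sym ((g ^^ j) x) \<in> S i"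
proof -
  interpret leb: finite_measure leb by (rule finite_leb)
  obtain G K C \<rho> where G: "G \<in> sets leb" "measure N G = 1" and \<rho>: "0 \<le> \<rho>" "\<rho> < (1::real)"
    and hit: "\<And>S k q. C \<le> real k * measure N {x \<in> \<Omega>. sym x \<in> S} \<Longrightarrow>
      measure leb {x \<in> G. \<forall>j<q * (K + k). sym ((g ^^ Suc j) x) \<notin> S} \<le> \<rho> ^ q * measure leb G"
    by (rule exponential_hitting_acip) blast
  define B where "B = real K + 2 + \<bar>C\<bar> / b"
  have "0 \<le> \<bar>C\<bar> / b" using b by simp
  then have B: "B > 0" unfolding B_def by linarith
  \<comment> \<open>The successor keeps the divisor \<open>K + k i\<close> positive.\<close>
  define k where "k i = Suc (nat \<lceil>\<bar>C\<bar> / b * 2 powr (\<kappa> * real i)\<rceil>)" for i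
  define q where "q i = 2 ^ i div (K + k i)" for i
  define bad where "bad i = {x \<in> G. \<forall>j<q i * (K + k i). sym ((g ^^ Suc j) x) \<notin> S i}" for i
  have k_ge: "C \<le> real (k i) * measure N {x \<in> \<Omega>. sym x \<in> S i}" for i
  proof -
    have "C \<le> \<bar>C\<bar> / b * 2 powr (\<kappa> * real i) * (b * 2 powr (- \<kappa> * real i))"
      using b by (simp add: powr_minus)
    also have "\<dots> \<le> real (k i) * measure N {x \<in> \<Omega>. sym x \<in> S i}"
    proof (rule mult_mono[OF _ tail])
      have "\<bar>C\<bar> / b * 2 powr (\<kappa> * real i) \<ge> 0" using b by simp
      then show "\<bar>C\<bar> / b * 2 powr (\<kappa> * real i) \<le> real (k i)" unfolding k_def by linarith
    qed (use b in auto)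
    finally show ?thesis .
  qed
  have k_le: "real (K + k i) \<le> B * 2 powr (\<kappa> * real i)" for i
  proof -
    have one: "1 \<le> 2 powr (\<kappa> * real i)" using \<kappa> by (intro ge_one_powr_ge_zero) auto
    have "\<bar>C\<bar> / b * 2 powr (\<kappa> * real i) \<ge> 0" using b by simp
    then have "real (k i) \<le> \<bar>C\<bar> / b * 2 powr (\<kappa> * real i) + 2" unfolding k_def by linarith
    then have "real (K + k i) \<le> (real K + 2) * 1 + \<bar>C\<bar> / b * 2 powr (\<kappa> * real i)" by simp
    also have "\<dots> \<le> (real K + 2) * 2 powr (\<kappa> * real i) + \<bar>C\<bar> / b * 2 powr (\<kappa> * real i)"
      using one by (intro add_right_mono mult_left_mono) auto
    also have "\<dots> = B * 2 powr (\<kappa> * real i)" by (simp add: B_def algebra_simps)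
    finally show ?thesis .
  qed
  have q_ge: "\<forall>\<^sub>F i in sequentially. i \<le> q i"
  proof -
    define d where "d = 1 - \<kappa>"
    have "d > 0" using \<kappa> by (simp add: d_def)
    then have "\<forall>\<^sub>F i::nat in sequentially. real i * B \<le> 2 powr (d * real i)"
      using B by real_asymp
    then show ?thesis
    proof eventually_elim
      case (elim i)
      have "real (i * (K + k i)) \<le> real i * (B * 2 powr (\<kappa> * real i))"
        using k_le[of i] by (simp only: of_nat_mult) (rule mult_left_mono, auto)
      also have "\<dots> = real i * B * 2 powr (\<kappa> * real i)" by simp
      also have "\<dots> \<le> 2 powr (d * real i) * 2 powr (\<kappa> * real i)" using elim by (intro mult_right_mono) auto
      also have "\<dots> = 2 powr (real i)" by (simp add: d_def powr_add[symmetric] algebra_simps)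
      also have "\<dots> = real (2 ^ i)" by (simp add: powr_realpow)
      finally have "i * (K + k i) \<le> 2 ^ i" by (simp only: of_nat_le_iff)
      then show ?case unfolding q_def by (subst less_eq_div_iff_mult_less_eq) (auto simp: k_def)
    qed
  qed
  have bad_sets: "bad i \<in> sets leb" for i
  proof -
    have m: "(\<lambda>x. sym ((g ^^ Suc j) x)) \<in> leb \<rightarrow>\<^sub>M count_space UNIV" for j
      using measurable_compose[OF measurable_iterate_leb measurable_sym_leb] .
    have "bad i = G - (\<Union>j<q i * (K + k i). (\<lambda>x. sym ((g ^^ Suc j) x)) -` S i \<inter> space leb)"
      unfolding bad_def using sets.sets_into_space[OF G(1)] by auto
    also have "\<dots> \<in> sets leb"
      using measurable_sets[OF m] G(1) by (intro sets.Diff sets.finite_UN) auto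
    finally show ?thesis .
  qed
  have "summable (\<lambda>i. measure leb (bad i))"
  proof (rule summable_comparison_test_ev)
    show "summable (\<lambda>i. \<rho> ^ i * measure leb G)"
      using \<rho> by (intro summable_mult2 summable_geometric) auto
    show "\<forall>\<^sub>F i in sequentially. norm (measure leb (bad i)) \<le> \<rho> ^ i * measure leb G"
      using q_ge
    proof eventually_elim
      case (elim i)
      have "measure leb (bad i) \<le> \<rho> ^ q i * measure leb G"
        unfolding bad_def by (rule hit[OF k_ge])
      also have "\<dots> \<le> \<rho> ^ i * measure leb G"
        using elim \<rho> by (intro mult_right_mono power_decreasing) auto
      finally show ?case by simp
    qed
  qed
  then have "AE x in leb. \<forall>\<^sub>F i in sequentially. x \<in> space leb - bad i"
    using bad_sets by (intro borel_cantelli_AE1) (auto simp: leb.emeasure_eq_measure)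
  then have "AE x in N. \<forall>\<^sub>F i in sequentially. x \<in> space leb - bad i"
    by (rule AE_leb_imp_AE_N)
  moreover have "AE x in N. x \<in> G"
    using G leb_sets_N N.prob_eq_1 by blast
  ultimately show ?thesis
  proof eventually_elim
    case (elim x)
    from elim(1) show ?case
    proof eventually_elim
      case (elim i)
      then obtain j where j: "j < q i * (K + k i)" "sym ((g ^^ Suc j) x) \<in> S i"
        using \<open>x \<in> G\<close> unfolding bad_def by blast
      have "q i * (K + k i) \<le> 2 ^ i" unfolding q_def by (rule div_times_less_eq_dividend)
      then have "Suc j \<in> {1..2 ^ i}" using j(1) by simp
      then show ?case using j(2) by blast
    qed
  qed
qed

end

locale return_time_system = expanding_interval_map_acip g Y P N for g Y P N +
  fixes R :: "real \<Rightarrow> nat"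
  assumes R_constant: "I \<in> P \<Longrightarrow> R constant_on I"
begin

lemma R_sym:
  assumes "x \<in> \<Omega>" shows "R x \<in> A \<longleftrightarrow> sym x \<in> {I \<in> P. \<exists>y\<in>I. R y \<in> A}"
  using R_constant[OF \<Omega>_sym(1)[OF assms]] \<Omega>_sym[OF assms] unfolding constant_on_def by auto

lemma measurable_R: "R \<in> nu \<rightarrow>\<^sub>M count_space UNIV"
proof (rule measurableI)
  fix A
  have "R -` A \<inter> space nu = sym -` {I \<in> P. \<exists>y\<in>I. R y \<in> A} \<inter> space leb"
    using R_sym by (auto simp: space_nu space_leb)
  also have "\<dots> \<in> sets leb" by (rule measurable_sets[OF measurable_sym_leb]) simp
  finally show "R -` A \<inter> space nu \<in> sets nu" by (simp only: sets_nu)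
qed simp

definition return_sum :: "real \<Rightarrow> nat \<Rightarrow> nat" where
  "return_sum x n = (\<Sum>j<n. R ((g ^^ j) x))"

lemma mono_return_sum: "mono (return_sum x)"
  unfolding return_sum_def by (intro monoI sum_mono2) auto

text \<open>
  One long return suffices: by \<open>hits_eventually\<close> a return of length at least \<open>2\<^bsup>\<gamma>'i\<^esup>\<close> occurs
  within the first \<open>2\<^sup>i\<close> steps.
\<close>

theorem return_sums_lower:
  assumes b: "b > 0" and \<beta>: "0 < \<beta>" and \<gamma>: "0 < \<gamma>" "\<gamma> * \<beta> < 1"
    and tail: "\<And>L. L \<ge> 1 \<Longrightarrow> b * L powr (- \<beta>) \<le> measure N {x \<in> \<Omega>. L \<le> real (R x)}"
  shows "AE x in N. \<forall>\<^sub>F n in sequentially. real n powr \<gamma> \<le> real (return_sum x n)"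
proof -
  define \<gamma>' where "\<gamma>' = (\<gamma> + 1 / \<beta>) / 2"
  have "\<gamma> < 1 / \<beta>" using \<gamma> \<beta> by (simp add: pos_less_divide_eq)
  then have \<gamma>': "\<gamma> < \<gamma>'" "\<gamma>' < 1 / \<beta>" by (auto simp: \<gamma>'_def)
  then have \<kappa>: "0 \<le> \<gamma>' * \<beta>" "\<gamma>' * \<beta> < 1" using \<gamma> \<beta> by (simp_all add: pos_less_divide_eq)
  define S where "S i = {I \<in> P. \<exists>y\<in>I. R y \<in> {k. 2 powr (\<gamma>' * real i) \<le> real k}}" for i
  have S: "sym x \<in> S i \<longleftrightarrow> 2 powr (\<gamma>' * real i) \<le> real (R x)" if "x \<in> \<Omega>" for x i
    using R_sym[OF that, of "{k. 2 powr (\<gamma>' * real i) \<le> real k}"] unfolding S_def by simp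
  have "AE x in N. \<forall>\<^sub>F i in sequentially. \<exists>j\<in>{1..2 ^ i}. sym ((g ^^ j) x) \<in> S i"
  proof (rule hits_eventually[OF b \<kappa>])
    fix i
    have "1 \<le> 2 powr (\<gamma>' * real i)" using \<gamma> \<gamma>' by (intro ge_one_powr_ge_zero) auto
    from tail[OF this] show "b * 2 powr (- (\<gamma>' * \<beta>) * real i) \<le> measure N {x \<in> \<Omega>. sym x \<in> S i}"
      using S by (simp add: powr_powr mult_ac cong: conj_cong)
  qed
  with AE_\<Omega> show ?thesis
  proof eventually_elim
    case (elim x)
    from elim(2) have "\<forall>\<^sub>F i in sequentially. 2 powr (\<gamma>' * real i) \<le> real (return_sum x (Suc (2 ^ i)))"
    proof eventually_elim
      case (elim i)
      then obtain j where j: "j \<in> {1..2 ^ i}" "sym ((g ^^ j) x) \<in> S i" by blast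
      then have "2 powr (\<gamma>' * real i) \<le> real (R ((g ^^ j) x))" using S[OF \<Omega>_iterate[OF \<open>x \<in> \<Omega>\<close>]] by blast
      also have "R ((g ^^ j) x) \<le> return_sum x (Suc (2 ^ i))"
        unfolding return_sum_def using j(1) by (intro member_le_sum) auto
      finally show ?case by simp
    qed
    then show ?case by (rule dyadic_lower[OF mono_return_sum \<gamma>(1) \<gamma>'(1)])
  qed
qed

text \<open>
  With \<open>\<theta> < \<beta>\<close> the power \<open>R\<^bsup>\<theta>\<^esup>\<close> is integrable, and \<open>T\<^sub>n\<^bsup>\<theta>\<^esup>\<close> is at most the sum of the \<open>n\<close>
  powers. The exponents are chosen such that \<open>\<gamma>' * \<theta> > 1\<close>, which makes the bounds from Markov's
  inequality summable over powers of 2.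
\<close>

theorem return_sums_upper:
  assumes \<beta>: "0 < \<beta>" "\<beta> < 1" and \<gamma>: "1 < \<gamma> * \<beta>"
    and tail: "\<forall>\<^sub>F n in sequentially. measure N {x \<in> \<Omega>. R x = n} \<le> c * real n powr (- \<beta> - 1)"
  shows "AE x in N. \<forall>\<^sub>F n in sequentially. real (return_sum x n) \<le> real n powr \<gamma>"
proof -
  interpret nu: prob_space nu by (rule prob_space_nu)
  note [measurable] = measurable_R measurable_iterate_nu
  define \<gamma>' where "\<gamma>' = (\<gamma> + 1 / \<beta>) / 2"
  have "1 / \<beta> < \<gamma>" using \<gamma> \<beta> by (simp add: pos_divide_less_eq)
  then have \<gamma>': "1 / \<beta> < \<gamma>'" "\<gamma>' < \<gamma>" by (auto simp: \<gamma>'_def)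
  have "0 < 1 / \<beta>" using \<beta> by simp
  then have \<gamma>'0: "0 < \<gamma>'" using \<gamma>'(1) by linarith
  \<comment> \<open>Any \<open>\<theta>\<close> strictly between \<open>1 / \<gamma>'\<close> and \<open>\<beta>\<close> works.\<close>
  define \<theta> where "\<theta> = (\<beta> + 1 / \<gamma>') / 2"
  have "1 / \<gamma>' < \<beta>" using \<gamma>'(1) \<gamma>'0 \<beta> by (simp add: field_simps)
  then have \<theta>: "1 / \<gamma>' < \<theta>" "\<theta> < \<beta>" by (auto simp: \<theta>_def)
  have "0 < 1 / \<gamma>'" using \<gamma>'0 by simp
  then have \<theta>0: "0 < \<theta>" "\<theta> \<le> 1" using \<theta> \<beta> by linarith+
  have \<theta>\<gamma>: "1 < \<gamma>' * \<theta>" using \<theta>(1) \<gamma>'0 by (simp add: pos_divide_less_eq mult.commute)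
  define u where "u x = ennreal (real (R x) powr \<theta>)" for x
  have u[measurable]: "u \<in> borel_measurable nu" unfolding u_def by measurable
  define \<phi> where "\<phi> = (\<integral>\<^sup>+ x. u x \<partial>nu)"
  have "\<phi> < \<infinity>"
  proof -
    have u_eq: "u x = (\<Sum>n. ennreal (real n powr \<theta>) * indicator {y \<in> \<Omega>. R y = n} x)" if "x \<in> space nu" for x
      using that by (subst suminf_finite[of "{R x}"]) (auto simp: u_def space_nu)
    have A: "{y \<in> \<Omega>. R y = n} \<in> sets nu" for n
      using measurable_sets[OF measurable_R, of "{n}"] by (simp add: space_nu vimage_def Int_def conj_commute)
    have "\<phi> = (\<integral>\<^sup>+ x. (\<Sum>n. ennreal (real n powr \<theta>) * indicator {y \<in> \<Omega>. R y = n} x) \<partial>nu)"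
      unfolding \<phi>_def by (rule nn_integral_cong[OF u_eq])
    also have "\<dots> = (\<Sum>n. \<integral>\<^sup>+ x. ennreal (real n powr \<theta>) * indicator {y \<in> \<Omega>. R y = n} x \<partial>nu)"
      using A by (intro nn_integral_suminf) auto
    also have "\<dots> = (\<Sum>n. ennreal (real n powr \<theta> * measure N {y \<in> \<Omega>. R y = n}))"
      using A by (simp add: nn_integral_cmult_indicator nu.emeasure_eq_measure measure_nu ennreal_mult)
    also have "\<dots> < \<infinity>"
    proof -
      have "summable (\<lambda>n. real n powr \<theta> * measure N {y \<in> \<Omega>. R y = n})"
      proof (rule summable_comparison_test_ev)
        show "summable (\<lambda>n. c * real n powr (\<theta> - \<beta> - 1))"
          using \<theta> by (intro summable_mult) (simp add: summable_real_powr_iff)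
        show "\<forall>\<^sub>F n in sequentially. norm (real n powr \<theta> * measure N {y \<in> \<Omega>. R y = n}) \<le> c * real n powr (\<theta> - \<beta> - 1)"
          using tail
        proof eventually_elim
          case (elim n)
          have "real n powr \<theta> * measure N {y \<in> \<Omega>. R y = n} \<le> real n powr \<theta> * (c * real n powr (- \<beta> - 1))"
            using elim by (rule mult_left_mono) simp
          also have "\<dots> = c * (real n powr \<theta> * real n powr (- \<beta> - 1))" by simp
          also have "real n powr \<theta> * real n powr (- \<beta> - 1) = real n powr (\<theta> - \<beta> - 1)"
            by (simp add: powr_add[symmetric] algebra_simps)
          finally show ?case by simp
        qed
      qed
      then show ?thesis by (subst suminf_ennreal2) auto
    qed
    finally show ?thesis .
  qed
  then obtain v where v: "\<phi> = ennreal v" "v \<ge> 0" by (cases \<phi>) auto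
  define bad where "bad i = {x \<in> \<Omega>. 2 powr (\<gamma>' * real i) < real (return_sum x (2 ^ i))}" for i
  have T_meas[measurable]: "(\<lambda>x. real (return_sum x n)) \<in> borel_measurable nu" for n
    unfolding return_sum_def by measurable
  have bad_sets: "bad i \<in> sets nu" for i
  proof -
    have "{x \<in> space nu. 2 powr (\<gamma>' * real i) < real (return_sum x (2 ^ i))} \<in> sets nu" by measurable
    then show ?thesis unfolding bad_def space_nu .
  qed
  have bad_le: "measure nu (bad i) \<le> v * (2 powr (1 - \<gamma>' * \<theta>)) ^ i" for i
  proof -
    define w where "w x = (\<Sum>j<2 ^ i. u ((g ^^ j) x))" for x
    have w[measurable]: "w \<in> borel_measurable nu" unfolding w_def by measurable
    define C where "C = 2 powr (- (\<gamma>' * \<theta> * real i))"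
    have "bad i \<subseteq> {x \<in> space nu. 1 \<le> ennreal C * w x}"
    proof
      fix x assume x: "x \<in> bad i"
      have "(2 powr (\<gamma>' * real i)) powr \<theta> \<le> real (return_sum x (2 ^ i)) powr \<theta>"
        using x \<theta>0 by (intro powr_mono2) (auto simp: bad_def)
      also have "\<dots> \<le> (\<Sum>j<2 ^ i. real (R ((g ^^ j) x)) powr \<theta>)"
        unfolding return_sum_def of_nat_sum by (rule powr_sum_le) (use \<theta>0 in auto)
      finally have "C * 2 powr (\<gamma>' * \<theta> * real i) \<le> C * (\<Sum>j<2 ^ i. real (R ((g ^^ j) x)) powr \<theta>)"
        by (intro mult_left_mono) (simp_all add: powr_powr mult_ac C_def)
      then have "1 \<le> C * (\<Sum>j<2 ^ i. real (R ((g ^^ j) x)) powr \<theta>)"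
        by (simp add: C_def flip: powr_add)
      then have "ennreal 1 \<le> ennreal (C * (\<Sum>j<2 ^ i. real (R ((g ^^ j) x)) powr \<theta>))" by (rule ennreal_leI)
      also have "\<dots> = ennreal C * w x"
        unfolding w_def u_def by (subst sum_ennreal) (auto simp: C_def ennreal_mult sum_nonneg)
      finally show "x \<in> {x \<in> space nu. 1 \<le> ennreal C * w x}" using x by (simp add: bad_def space_nu)
    qed
    then have "emeasure nu (bad i) \<le> emeasure nu {x \<in> space nu. 1 \<le> ennreal C * w x}"
      by (intro emeasure_mono) measurable
    also have "\<dots> \<le> ennreal C * (\<integral>\<^sup>+ x. w x * indicator (space nu) x \<partial>nu)"
      by (rule nn_integral_Markov_inequality) auto
    also have "(\<integral>\<^sup>+ x. w x * indicator (space nu) x \<partial>nu) = (\<integral>\<^sup>+ x. w x \<partial>nu)"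
      by (intro nn_integral_cong) simp
    also have "(\<integral>\<^sup>+ x. w x \<partial>nu) = (\<Sum>j<2 ^ i. \<integral>\<^sup>+ x. u ((g ^^ j) x) \<partial>nu)"
      unfolding w_def by (intro nn_integral_sum) measurable
    also have "\<dots> = ennreal (2 ^ i * v)"
      unfolding nn_integral_iterate[OF u] using v by (simp add: \<phi>_def[symmetric] ennreal_mult ennreal_power[symmetric])
    also have "ennreal C * ennreal (2 ^ i * v) = ennreal (C * (2 ^ i * v))"
      using v by (simp add: C_def ennreal_mult)
    finally have "measure nu (bad i) \<le> C * (2 ^ i * v)"
      using v by (simp add: nu.emeasure_eq_measure C_def)
    also have "C * 2 ^ i = (2 powr (1 - \<gamma>' * \<theta>)) ^ i"
    proof -
      have "C * 2 ^ i = 2 powr (- (\<gamma>' * \<theta> * real i)) * 2 powr real i" by (simp add: C_def powr_realpow)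
      also have "\<dots> = 2 powr ((1 - \<gamma>' * \<theta>) * real i)" by (simp add: powr_add[symmetric] algebra_simps)
      also have "\<dots> = (2 powr (1 - \<gamma>' * \<theta>)) powr real i" by (simp add: powr_powr)
      finally show ?thesis by (simp add: powr_realpow)
    qed
    then have "C * (2 ^ i * v) = v * (2 powr (1 - \<gamma>' * \<theta>)) ^ i" by simp
    finally show ?thesis .
  qed
  have "summable (\<lambda>i. measure nu (bad i))"
  proof (rule summable_comparison_test)
    have "2 powr (1 - \<gamma>' * \<theta>) < 1" using \<theta>\<gamma> by (simp add: powr_less_one)
    then show "summable (\<lambda>i. v * (2 powr (1 - \<gamma>' * \<theta>)) ^ i)"
      by (intro summable_mult summable_geometric) simp
    show "\<exists>M. \<forall>i\<ge>M. norm (measure nu (bad i)) \<le> v * (2 powr (1 - \<gamma>' * \<theta>)) ^ i"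
      using bad_le by simp
  qed
  then have "AE x in nu. \<forall>\<^sub>F i in sequentially. x \<in> space nu - bad i"
    using bad_sets by (intro borel_cantelli_AE1) (auto simp: nu.emeasure_eq_measure)
  then have "AE x in N. \<forall>\<^sub>F i in sequentially. x \<in> space nu - bad i" by (simp only: AE_nu_iff)
  then show ?thesis
  proof eventually_elim
    case (elim x)
    then have "\<forall>\<^sub>F i in sequentially. real (return_sum x (2 ^ i)) \<le> 2 powr (\<gamma>' * real i)"
      by eventually_elim (auto simp: bad_def space_nu)
    then show ?case by (rule dyadic_upper[OF mono_return_sum \<gamma>'0 \<gamma>'(2)])
  qed
qed

end

section \<open>Orbits of the original map\<close>

lemma filterlim_ipow: assumes "0 < a" shows "filterlim (\<lambda>n. ipow n a) at_top sequentially"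
  unfolding filterlim_at_top
proof
  fix B :: nat
  have "\<forall>\<^sub>F n in sequentially. real B \<le> real n powr a" using assms by real_asymp
  then show "\<forall>\<^sub>F n in sequentially. B \<le> ipow n a" unfolding le_ipow_iff .
qed

text \<open>
  Here \<open>\<tau> m\<close> is the time of the \<open>m\<close>-th visit and \<open>w k m\<close> is the value of the \<open>k\<close>-th target
  function at the place of that visit. When \<open>\<tau> m \<le> ipow m b\<close>, the value at the actual time is at
  least the value at time \<open>ipow m b\<close>, and every \<open>m \<le> ipow n (1 / b)\<close> is visited by time \<open>n\<close>. The
  finitely many other \<open>m\<close> go into the constant.
\<close>

lemma sum_visits_lower:
  fixes w :: "nat \<Rightarrow> nat \<Rightarrow> real" and s :: "nat \<Rightarrow> real"
  assumes tau: "strict_mono \<tau>" and b: "b > 0"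
    and s: "\<And>m. 1 \<le> \<tau> m \<Longrightarrow> s (\<tau> m) = w (\<tau> m) m" and s0: "\<And>k. 1 \<le> k \<Longrightarrow> 0 \<le> s k"
    and anti: "\<And>k l m. \<lbrakk>1 \<le> k; k \<le> l\<rbrakk> \<Longrightarrow> w l m \<le> w k m"
    and ev: "\<forall>\<^sub>F m in sequentially. real (\<tau> m) \<le> real m powr b"
  obtains c where "\<And>n. (\<Sum>m=1..ipow n (1 / b). w (ipow m b) m) \<le> c + (\<Sum>k=1..n. s k)"
proof -
  obtain m0 where m0: "\<And>m. m \<ge> m0 \<Longrightarrow> \<tau> m \<le> ipow m b"
    using ev unfolding le_ipow_iff[symmetric] eventually_sequentially by blast
  define m1 where "m1 = Suc m0"
  define c where "c = (\<Sum>m=1..<m1. \<bar>w (ipow m b) m\<bar>)"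
  have "(\<Sum>m=1..ipow n (1 / b). w (ipow m b) m) \<le> c + (\<Sum>k=1..n. s k)" for n
  proof -
    let ?N = "ipow n (1 / b)"
    have "(\<Sum>m=1..?N. w (ipow m b) m) = (\<Sum>m\<in>{1..?N} \<inter> {..<m1}. w (ipow m b) m) + (\<Sum>m\<in>{1..?N} - {..<m1}. w (ipow m b) m)"
      by (rule sum.Int_Diff) simp
    also have "(\<Sum>m\<in>{1..?N} \<inter> {..<m1}. w (ipow m b) m) \<le> (\<Sum>m\<in>{1..?N} \<inter> {..<m1}. \<bar>w (ipow m b) m\<bar>)"
      by (intro sum_mono) auto
    also have "\<dots> \<le> c" unfolding c_def by (intro sum_mono2) auto
    also have "(\<Sum>m\<in>{1..?N} - {..<m1}. w (ipow m b) m) \<le> (\<Sum>m\<in>{1..?N} - {..<m1}. s (\<tau> m))"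
    proof (rule sum_mono)
      fix m assume "m \<in> {1..?N} - {..<m1}"
      then have m: "m1 \<le> m" by auto
      have t1: "1 \<le> \<tau> m" using strict_mono_imp_increasing[OF tau, of m] m by (simp add: m1_def)
      have "\<tau> m \<le> ipow m b" using m0 m by (simp add: m1_def)
      then show "w (ipow m b) m \<le> s (\<tau> m)" using anti[OF t1] s[OF t1] by simp
    qed
    also have "\<dots> = (\<Sum>k\<in>\<tau> ` ({1..?N} - {..<m1}). s k)"
      using strict_mono_imp_inj_on[OF tau] by (subst sum.reindex) (auto intro: inj_on_subset)
    also have "\<dots> \<le> (\<Sum>k=1..n. s k)"
    proof (rule sum_mono2)
      show "\<tau> ` ({1..?N} - {..<m1}) \<subseteq> {1..n}"
      proof (rule image_subsetI)
        fix m assume "m \<in> {1..?N} - {..<m1}"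
        then have m: "m \<in> {1..?N}" "\<not> m < m1" by auto
        have "1 \<le> \<tau> m" using strict_mono_imp_increasing[OF tau, of m] m by simp
        moreover have "\<tau> m \<le> n"
        proof -
          have "real m \<le> real n powr (1 / b)" using m le_ipow_iff by auto
          then have "real m powr b \<le> (real n powr (1 / b)) powr b" using b by (intro powr_mono2) auto
          also have "\<dots> = real n" using b by (simp add: powr_powr)
          finally have "real (ipow m b) \<le> real n" using ipow_le[of m b] by linarith
          moreover have "\<tau> m \<le> ipow m b" using m0 m by (simp add: m1_def)
          ultimately show ?thesis by linarith
        qed
        ultimately show "\<tau> m \<in> {1..n}" by simp
      qed
    qed (use s0 in auto)
    finally show ?thesis by simp
  qed
  then show thesis using that by blast
qed

lemma sum_visits_upper:
  fixes w :: "nat \<Rightarrow> nat \<Rightarrow> real" and s :: "nat \<Rightarrow> real"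
  assumes tau: "strict_mono \<tau>" and b: "b > 0"
    and s: "\<And>m. 1 \<le> \<tau> m \<Longrightarrow> s (\<tau> m) = w (\<tau> m) m" and s_zero: "\<And>k. k \<notin> range \<tau> \<Longrightarrow> s k = 0"
    and w0: "\<And>k m. 1 \<le> k \<Longrightarrow> 0 \<le> w k m"
    and anti: "\<And>k l m. \<lbrakk>1 \<le> k; k \<le> l\<rbrakk> \<Longrightarrow> w l m \<le> w k m"
    and ev: "\<forall>\<^sub>F m in sequentially. real m powr b \<le> real (\<tau> m)"
  obtains c where "\<And>n. (\<Sum>k=1..n. s k) \<le> c + (\<Sum>m=1..ipow n (1 / b). w (ipow m b) m)"
proof -
  obtain m0 where m0: "\<And>m. m \<ge> m0 \<Longrightarrow> real m powr b \<le> real (\<tau> m)"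
    using ev unfolding eventually_sequentially by blast
  define m1 where "m1 = Suc m0"
  define c where "c = (\<Sum>m<m1. \<bar>s (\<tau> m)\<bar>)"
  have "(\<Sum>k=1..n. s k) \<le> c + (\<Sum>m=1..ipow n (1 / b). w (ipow m b) m)" for n
  proof -
    let ?N = "ipow n (1 / b)"
    define A where "A = {m. 1 \<le> \<tau> m \<and> \<tau> m \<le> n}"
    have A_fin: "finite A"
      by (rule finite_subset[of _ "{..n}"]) (use strict_mono_imp_increasing[OF tau] order_trans in \<open>auto simp: A_def\<close>)
    have w0': "0 \<le> w (ipow m b) m" if "1 \<le> m" for m
      using w0 ipow_ge_1[OF that] b by simp
    have "(\<Sum>k=1..n. s k) = (\<Sum>k\<in>\<tau> ` A. s k)"
    proof (rule sum.mono_neutral_right)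
      show "\<forall>k\<in>{1..n} - \<tau> ` A. s k = 0"
      proof
        fix k assume k: "k \<in> {1..n} - \<tau> ` A"
        then have "k \<notin> range \<tau>" by (auto simp: A_def)
        then show "s k = 0" by (rule s_zero)
      qed
    qed (auto simp: A_def)
    also have "\<dots> = (\<Sum>m\<in>A. s (\<tau> m))"
      using strict_mono_imp_inj_on[OF tau] by (subst sum.reindex) (auto intro: inj_on_subset)
    also have "\<dots> = (\<Sum>m\<in>A \<inter> {..<m1}. s (\<tau> m)) + (\<Sum>m\<in>A - {..<m1}. s (\<tau> m))"
      by (rule sum.Int_Diff[OF A_fin])
    also have "(\<Sum>m\<in>A \<inter> {..<m1}. s (\<tau> m)) \<le> (\<Sum>m\<in>A \<inter> {..<m1}. \<bar>s (\<tau> m)\<bar>)"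
      by (intro sum_mono) auto
    also have "\<dots> \<le> c" unfolding c_def by (intro sum_mono2) auto
    also have "(\<Sum>m\<in>A - {..<m1}. s (\<tau> m)) \<le> (\<Sum>m\<in>A - {..<m1}. w (ipow m b) m)"
    proof (rule sum_mono)
      fix m assume m: "m \<in> A - {..<m1}"
      then have t1: "1 \<le> \<tau> m" by (simp add: A_def)
      have "real (ipow m b) \<le> real (\<tau> m)" using m m0[of m] ipow_le[of m b] by (simp add: m1_def)
      then have "ipow m b \<le> \<tau> m" by simp
      moreover have "1 \<le> ipow m b" using m b by (intro ipow_ge_1) (auto simp: m1_def)
      ultimately show "s (\<tau> m) \<le> w (ipow m b) m" using anti s[OF t1] by simp
    qed
    also have "\<dots> \<le> (\<Sum>m=1..?N. w (ipow m b) m)"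
    proof (rule sum_mono2)
      show "A - {..<m1} \<subseteq> {1..?N}"
      proof
        fix m assume m: "m \<in> A - {..<m1}"
        then have "real m powr b \<le> real n" using m0[of m] by (simp add: A_def m1_def)
        then have "(real m powr b) powr (1 / b) \<le> real n powr (1 / b)" using b by (intro powr_mono2) auto
        then have "real m \<le> real n powr (1 / b)" using b by (simp add: powr_powr)
        then show "m \<in> {1..?N}" using m unfolding le_ipow_iff[symmetric] by (simp add: m1_def)
      qed
    qed (use w0' in auto)
    finally show ?thesis by simp
  qed
  then show thesis using that by blast
qed

lemma partial_sums_at_top:
  fixes a :: "nat \<Rightarrow> real"
  assumes a: "\<And>k. 0 \<le> a (Suc k)" and inf: "(\<Sum>k. ennreal (a (Suc k))) = \<infinity>"
  shows "filterlim (\<lambda>N. \<Sum>k=1..N. a k) at_top sequentially"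
  unfolding filterlim_at_top
proof
  fix B :: real
  have eq: "(\<Sum>k<N. a (Suc k)) = (\<Sum>k=1..N. a k)" for N
    by (simp add: sum.atLeast1_atMost_eq)
  have "\<exists>N. B \<le> (\<Sum>k<N. a (Suc k))"
  proof (rule ccontr)
    assume "\<not> ?thesis"
    then have "(\<Sum>k<N. ennreal (a (Suc k))) \<le> ennreal B" for N
      using a by (subst sum_ennreal) (auto intro!: ennreal_leI simp: not_le less_imp_le)
    then have "(\<Sum>k. ennreal (a (Suc k))) \<le> ennreal B"
      unfolding suminf_eq_SUP by (intro SUP_least)
    then show False using inf by (simp add: top_unique)
  qed
  then obtain N where N: "B \<le> (\<Sum>k<N. a (Suc k))" by blast
  show "\<forall>\<^sub>F N in sequentially. B \<le> (\<Sum>k=1..N. a k)"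
    unfolding eventually_sequentially
  proof (intro exI[of _ N] allI impI)
    fix N' assume "N \<le> N'"
    then have "(\<Sum>k<N. a (Suc k)) \<le> (\<Sum>k<N'. a (Suc k))" using a by (intro sum_mono2) auto
    then show "B \<le> (\<Sum>k=1..N'. a k)" using N eq by simp
  qed
qed

text \<open>
  The base transformation \<open>f\<close> and its induced map.
\<close>

locale induced_markov_system =
  fixes M :: "real measure" and f :: "real \<Rightarrow> real" and Y :: "real set" and P :: "real set set" and \<beta> :: real
  assumes f_measurable: "f \<in> M \<rightarrow>\<^sub>M M" and f_invariant: "invariant_measure f M"
    and f_ergodic: "ergodic_map f M" and Y_sets: "Y \<in> sets M"
    and A1: "markov_partition_big_images (induced_map f Y) Y P"
    and A2: "uniformly_expanding (induced_map f Y) P"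
    and A3: "bounded_distortion (induced_map f Y) P"
    and A4: "unique_acip (induced_map f Y) Y (restrict_space M Y)"
    and A5: "return_time_constant_on f Y P"
    and A6: "return_time_tail f Y (restrict_space M Y) \<beta>"

sublocale induced_markov_system \<subseteq>
  return_time_system "induced_map f Y" Y P "restrict_space M Y" "return_time f Y"
  using A1 A2 A3 A4 A5
  by unfold_locales (auto simp: return_time_constant_on_def)

context induced_markov_system
begin

abbreviation "R \<equiv> return_time f Y"
abbreviation "g \<equiv> induced_map f Y"
abbreviation "N \<equiv> restrict_space M Y"

lemma Y_space: "Y \<subseteq> space M"
  using Y_sets by (rule sets.sets_into_space)

lemma beta: "0 < \<beta>" "\<beta> < 1"
  using A6 by (auto simp: return_time_tail_def)

lemma return_time_props:
  assumes "y \<in> \<Omega>"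
  shows "1 \<le> R y" "(f ^^ R y) y = g y" "\<And>k. \<lbrakk>1 \<le> k; k < R y\<rbrakk> \<Longrightarrow> (f ^^ k) y \<notin> Y"
proof -
  have "\<exists>n\<ge>1. (f ^^ n) y \<in> Y"
    using A5 \<Omega>_sym[OF assms] unfolding return_time_constant_on_def by blast
  then have "1 \<le> R y \<and> (f ^^ R y) y \<in> Y"
    unfolding return_time_def by (rule LeastI_ex)
  then show "1 \<le> R y" by blast
  show "(f ^^ R y) y = g y" by (simp add: induced_map_def)
  show "(f ^^ k) y \<notin> Y" if "1 \<le> k" "k < R y" for k
    using not_less_Least[of k "\<lambda>n. 1 \<le> n \<and> (f ^^ n) y \<in> Y"] that unfolding return_time_def by blast
qed

lemma strict_mono_return_sum: "y \<in> \<Omega> \<Longrightarrow> strict_mono (return_sum y)"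
  using return_time_props(1)[OF \<Omega>_iterate] by (intro strict_monoI_Suc) (simp add: return_sum_def Suc_le_eq)

lemma iterate_return_sum: assumes y: "y \<in> \<Omega>" shows "(f ^^ return_sum y m) y = (g ^^ m) y"
proof (induction m)
  case (Suc m)
  have "return_sum y (Suc m) = R ((g ^^ m) y) + return_sum y m" by (simp add: return_sum_def)
  then have "(f ^^ return_sum y (Suc m)) y = (f ^^ R ((g ^^ m) y)) ((g ^^ m) y)"
    using Suc by (simp add: funpow_add)
  then show ?case using return_time_props(2)[OF \<Omega>_iterate[OF y]] by simp
qed (simp add: return_sum_def)

text \<open>
  Between two consecutive sums of return times the orbit is away from \<open>Y\<close>.
\<close>

lemma visit_times:
  assumes y: "y \<in> \<Omega>" and k: "(f ^^ k) y \<in> Y" shows "k \<in> range (return_sum y)"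
proof -
  have "\<exists>m. return_sum y m \<le> k \<and> k < return_sum y (Suc m)"
  proof (induction k)
    case 0
    have "return_sum y 0 = 0" by (simp add: return_sum_def)
    then show ?case using strict_monoD[OF strict_mono_return_sum[OF y], of 0 1] by auto
  next
    case (Suc k)
    then obtain m where m: "return_sum y m \<le> k" "k < return_sum y (Suc m)" by blast
    show ?case
    proof (cases "Suc k < return_sum y (Suc m)")
      case True
      then show ?thesis using m by (intro exI[of _ m]) auto
    next
      case False
      then have "Suc k = return_sum y (Suc m)" using m by simp
      then show ?thesis using strict_monoD[OF strict_mono_return_sum[OF y], of "Suc m" "Suc (Suc m)"]
        by (intro exI[of _ "Suc m"]) auto
    qed
  qed
  then obtain m where m: "return_sum y m \<le> k" "k < return_sum y (Suc m)" by blast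
  have "k = return_sum y m"
  proof (rule ccontr)
    assume "k \<noteq> return_sum y m"
    then have j: "1 \<le> k - return_sum y m" "k - return_sum y m < R ((g ^^ m) y)" using m by (auto simp: return_sum_def)
    have "(f ^^ k) y = (f ^^ (k - return_sum y m + return_sum y m)) y" using m by simp
    also have "\<dots> = (f ^^ (k - return_sum y m)) ((g ^^ m) y)" by (simp only: funpow_add o_apply iterate_return_sum[OF y])
    finally show False using return_time_props(3)[OF \<Omega>_iterate[OF y] j] k by simp
  qed
  then show ?thesis by blast
qed

lemma iterate_measurable: "f ^^ n \<in> M \<rightarrow>\<^sub>M M"
proof (induction n)
  case (Suc n)
  show ?case unfolding funpow.simps(2) by (rule measurable_comp[OF Suc f_measurable])
qed (simp add: id_def)

lemma iterate_null:
  assumes "B \<in> null_sets M" shows "(f ^^ n) -` B \<inter> space M \<in> null_sets M"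
proof (induction n)
  case 0
  then show ?case using assms by (auto intro: null_sets_subset[OF assms] simp: null_sets.Int_space_eq2)
next
  case (Suc n)
  let ?E = "(f ^^ n) -` B \<inter> space M"
  have "(f ^^ Suc n) -` B \<inter> space M = f -` ?E \<inter> space M"
    unfolding funpow_Suc_right using measurable_space[OF f_measurable] by auto
  moreover have "f -` ?E \<inter> space M \<in> null_sets M"
    using f_invariant Suc unfolding invariant_measure_def null_sets_def by auto
  ultimately show ?case by (simp only:)
qed

text \<open>
  The points that visit \<open>Y\<close> infinitely often form a strictly invariant set, which contains
  almost all of \<open>Y\<close>.
\<close>

lemma AE_visits: "AE x in M. \<exists>n. (f ^^ n) x \<in> Y"
proof -
  define V where "V = {x \<in> space M. \<exists>\<^sub>\<infinity>n. (f ^^ n) x \<in> Y}"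
  have space_iter: "(f ^^ n) x \<in> space M" if "x \<in> space M" for n x
    using measurable_space[OF iterate_measurable that] .
  define U where "U n = (\<Union>k\<in>{n..}. (f ^^ k) -` Y \<inter> space M)" for n
  have "U n \<in> sets M" for n
    unfolding U_def using measurable_sets[OF iterate_measurable Y_sets] by (intro sets.countable_UN') blast+
  then have "(\<Inter>n. U n) \<in> sets M" by (intro sets.countable_INT) auto
  moreover have "V = (\<Inter>n. U n)"
    unfolding V_def U_def INFM_nat_le by (auto simp: Bex_def)
  ultimately have V_sets: "V \<in> sets M" by simp
  have "f -` V \<inter> space M = V"
  proof -
    have "(\<exists>\<^sub>\<infinity>n. (f ^^ n) (f x) \<in> Y) \<longleftrightarrow> (\<exists>\<^sub>\<infinity>n. (f ^^ n) x \<in> Y)" for x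
      using eventually_sequentially_Suc[of "\<lambda>k. (f ^^ k) x \<notin> Y"]
      by (simp add: frequently_def cofinite_eq_sequentially funpow_swap1)
    then show ?thesis unfolding V_def using measurable_space[OF f_measurable] by auto
  qed
  then have "emeasure M V = 0 \<or> emeasure M (space M - V) = 0"
    using f_ergodic V_sets unfolding ergodic_map_def by blast
  moreover have "emeasure M V \<noteq> 0"
  proof -
    have sub: "\<Omega> \<subseteq> V"
    proof
      fix y assume y: "y \<in> \<Omega>"
      have "\<exists>n\<ge>m. (f ^^ n) y \<in> Y" for m
        using strict_mono_imp_increasing[OF strict_mono_return_sum[OF y], of m] iterate_return_sum[OF y, of m] \<Omega>_iterate[OF y, of m] \<Omega>_subset
        by (intro exI[of _ "return_sum y m"]) auto
      then show "y \<in> V" unfolding V_def INFM_nat_le using y \<Omega>_subset Y_space by auto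
    qed
    have \<Omega>M: "\<Omega> \<in> sets M" using \<Omega>_N Y_sets by (auto simp: sets_restrict_space_iff)
    have "emeasure M \<Omega> = emeasure N \<Omega>"
      using \<Omega>_subset Y_sets by (intro emeasure_restrict_space[symmetric]) auto
    also have "\<dots> = 1"
      using AE_\<Omega> \<Omega>_N N.prob_eq_1 by (simp add: N.emeasure_eq_measure)
    finally show ?thesis using emeasure_mono[OF sub V_sets] by auto
  qed
  ultimately have "space M - V \<in> null_sets M" using V_sets by (auto simp: null_sets_def)
  then have "AE x in M. x \<notin> space M - V" by (rule AE_not_in)
  with AE_space show ?thesis
  proof eventually_elim
    case (elim x)
    then have "\<exists>\<^sub>\<infinity>n. (f ^^ n) x \<in> Y" by (simp add: V_def)
    then show ?case by (rule INFM_EX)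
  qed
qed

text \<open>
  An exceptional null subset of \<open>Y\<close> has null preimages under all iterates of \<open>f\<close>.
\<close>

lemma AE_first_entry:
  assumes Q: "AE y in N. Q y"
  shows "AE x in M. \<exists>l. (\<forall>k<l. (f ^^ k) x \<notin> Y) \<and> (f ^^ l) x \<in> \<Omega> \<and> Q ((f ^^ l) x)"
proof -
  have "AE y in N. y \<in> \<Omega> \<and> Q y" using AE_\<Omega> Q by eventually_elim auto
  then have "AE y in M. y \<in> Y \<longrightarrow> y \<in> \<Omega> \<and> Q y"
    using Y_sets by (subst (asm) AE_restrict_space_iff) auto
  then obtain B where B: "{y \<in> space M. \<not> (y \<in> Y \<longrightarrow> y \<in> \<Omega> \<and> Q y)} \<subseteq> B" "B \<in> null_sets M"
    by (auto simp: eventually_ae_filter)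
  have "(\<Union>n. (f ^^ n) -` B \<inter> space M) \<in> null_sets M" using iterate_null[OF B(2)] by blast
  then have "AE x in M. x \<notin> (\<Union>n. (f ^^ n) -` B \<inter> space M)" by (rule AE_not_in)
  with AE_visits AE_space show ?thesis
  proof eventually_elim
    case (elim x)
    define l where "l = (LEAST n. (f ^^ n) x \<in> Y)"
    have l: "(f ^^ l) x \<in> Y" unfolding l_def using elim(1) by (rule LeastI_ex)
    have "(f ^^ k) x \<notin> Y" if "k < l" for k using that not_less_Least unfolding l_def by blast
    moreover have "(f ^^ l) x \<notin> B" using elim by blast
    then have "(f ^^ l) x \<in> \<Omega> \<and> Q ((f ^^ l) x)"
      using B(1) l Y_space by blast
    ultimately show ?case by blast
  qed
qed

text \<open>
  The measures in the tail condition are eventually positive, hence belong to measurable sets;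
  so for large \<open>n\<close> a null set may be removed.
\<close>

lemma return_time_measure:
  obtains c where "c > 0"
    "\<forall>\<^sub>F n in sequentially. real n powr (- \<beta> - 1) / c \<le> measure N {x \<in> \<Omega>. R x = n} \<and>
       measure N {x \<in> \<Omega>. R x = n} \<le> c * real n powr (- \<beta> - 1)"
proof -
  obtain c where c: "c > 0" "\<forall>\<^sub>F n in sequentially.
      inverse c \<le> measure N {x \<in> Y. R x = n} / real n powr (- \<beta> - 1) \<and>
      measure N {x \<in> Y. R x = n} / real n powr (- \<beta> - 1) \<le> c"
    using A6 unfolding return_time_tail_def same_order_def by blast
  have "\<forall>\<^sub>F n in sequentially. real n powr (- \<beta> - 1) / c \<le> measure N {x \<in> \<Omega>. R x = n} \<and>
       measure N {x \<in> \<Omega>. R x = n} \<le> c * real n powr (- \<beta> - 1)"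
    using c(2) eventually_gt_at_top[of 0]
  proof eventually_elim
    case (elim n)
    have pos: "real n powr (- \<beta> - 1) > 0" using elim by simp
    have "0 < inverse c" using c by simp
    then have "measure N {x \<in> Y. R x = n} \<noteq> 0" using elim by auto
    then have Ys: "{x \<in> Y. R x = n} \<in> sets N" using measure_notin_sets by blast
    have \<Omega>s: "{x \<in> \<Omega>. R x = n} \<in> sets N"
    proof -
      have "{x \<in> \<Omega>. R x = n} \<in> sets leb"
        using measurable_sets[OF measurable_R, of "{n}"] unfolding sets_nu space_nu
        by (simp add: vimage_def Int_def conj_commute)
      then show ?thesis by (rule leb_sets_N)
    qed
    have "measure N {x \<in> \<Omega>. R x = n} = measure N {x \<in> Y. R x = n}"
    proof (rule N.finite_measure_eq_AE[OF _ \<Omega>s Ys])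
      show "AE x in N. (x \<in> {x \<in> \<Omega>. R x = n}) = (x \<in> {x \<in> Y. R x = n})"
        using AE_\<Omega> by eventually_elim (use \<Omega>_subset in auto)
    qed
    then show ?case using elim(1) pos c(1) by (simp add: field_simps)
  qed
  then show thesis using that c(1) by blast
qed

text \<open>
  Of the level sets, those with values between \<open>K\<close> and \<open>2 * K\<close> are enough, where \<open>K\<close> is \<open>L\<close>
  rounded up and made large enough for the tail condition to apply.
\<close>

lemma return_time_tail_ge:
  obtains b where "b > 0" "\<And>L. L \<ge> 1 \<Longrightarrow> b * L powr (- \<beta>) \<le> measure N {x \<in> \<Omega>. L \<le> real (R x)}"
proof -
  obtain c where c: "c > 0" and ev:
    "\<forall>\<^sub>F n in sequentially. real n powr (- \<beta> - 1) / c \<le> measure N {x \<in> \<Omega>. R x = n} \<and>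
       measure N {x \<in> \<Omega>. R x = n} \<le> c * real n powr (- \<beta> - 1)"
    by (rule return_time_measure) blast
  then obtain n0 where n0: "\<And>n. n \<ge> n0 \<Longrightarrow> real n powr (- \<beta> - 1) / c \<le> measure N {x \<in> \<Omega>. R x = n}"
    unfolding eventually_sequentially by blast
  define b where "b = 2 powr (- \<beta> - 1) * (2 + real n0) powr (- \<beta>) / c"
  have "b * L powr (- \<beta>) \<le> measure N {x \<in> \<Omega>. L \<le> real (R x)}" if L: "L \<ge> 1" for L
  proof -
    define K where "K = nat \<lceil>L\<rceil> + n0"
    have K: "L \<le> real K" "n0 \<le> K" "real K \<le> (2 + real n0) * L" "K > 0"
    proof -
      show "L \<le> real K" "n0 \<le> K" unfolding K_def by linarith+
      have "real n0 * 1 \<le> real n0 * L" using L by (intro mult_left_mono) auto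
      moreover have "real (nat \<lceil>L\<rceil>) \<le> L + 1" using L by linarith
      ultimately show "real K \<le> (2 + real n0) * L" using L by (simp add: K_def algebra_simps)
      show "K > 0" using L unfolding K_def by linarith
    qed
    have s: "{x \<in> \<Omega>. R x \<in> A} \<in> sets N" for A
    proof -
      have "{x \<in> \<Omega>. R x \<in> A} \<in> sets leb"
        using measurable_sets[OF measurable_R, of A] unfolding sets_nu space_nu
        by (simp add: vimage_def Int_def conj_commute)
      then show ?thesis by (rule leb_sets_N)
    qed
    have s1: "{x \<in> \<Omega>. R x = n} \<in> sets N" for n using s[of "{n}"] by simp
    have "b * L powr (- \<beta>) = 2 powr (- \<beta> - 1) * ((2 + real n0) * L) powr (- \<beta>) / c"
      using L by (simp add: b_def powr_mult)
    also have "\<dots> \<le> 2 powr (- \<beta> - 1) * real K powr (- \<beta>) / c"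
      using K L c beta by (intro divide_right_mono mult_left_mono powr_mono2') auto
    also have "\<dots> = real K * ((2 * real K) powr (- \<beta> - 1) / c)"
      using K by (simp add: powr_mult powr_diff)
    also have "\<dots> = (\<Sum>n\<in>{K..<2 * K}. (2 * real K) powr (- \<beta> - 1) / c)" by simp
    also have "\<dots> \<le> (\<Sum>n\<in>{K..<2 * K}. measure N {x \<in> \<Omega>. R x = n})"
    proof (rule sum_mono)
      fix n assume n: "n \<in> {K..<2 * K}"
      have "(2 * real K) powr (- \<beta> - 1) / c \<le> real n powr (- \<beta> - 1) / c"
        using n K c beta by (intro divide_right_mono powr_mono2') auto
      also have "\<dots> \<le> measure N {x \<in> \<Omega>. R x = n}" using n K by (intro n0) auto
      finally show "(2 * real K) powr (- \<beta> - 1) / c \<le> measure N {x \<in> \<Omega>. R x = n}" .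
    qed
    also have "\<dots> = measure N (\<Union>n\<in>{K..<2 * K}. {x \<in> \<Omega>. R x = n})"
      using s1 by (intro N.finite_measure_finite_Union[symmetric]) (auto simp: disjoint_family_on_def)
    also have "\<dots> \<le> measure N {x \<in> \<Omega>. L \<le> real (R x)}"
      using s[of "{n. L \<le> real n}"] K by (intro N.finite_measure_mono) auto
    finally show ?thesis .
  qed
  moreover have "b > 0" using c by (simp add: b_def)
  ultimately show thesis using that by blast
qed

end

section \<open>Decreasing sequences of targets\<close>

locale decreasing_targets = induced_markov_system M f Y P \<beta>
  for M f Y P \<beta> +
  fixes p :: "nat \<Rightarrow> real \<Rightarrow> real"
  assumes p_measurable: "\<And>n. n \<ge> 1 \<Longrightarrow> p n \<in> borel_measurable M"
    and p_nonneg: "\<And>n x. n \<ge> 1 \<Longrightarrow> x \<in> space M \<Longrightarrow> p n x \<ge> 0"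
    and p_Suc_le: "\<And>n x. n \<ge> 1 \<Longrightarrow> x \<in> space M \<Longrightarrow> p (Suc n) x \<le> p n x"
    and p_support: "\<And>n. n \<ge> 1 \<Longrightarrow> {x \<in> space M. p n x \<noteq> 0} \<subseteq> Y"
begin

lemma p_antimono: assumes "1 \<le> k" "k \<le> l" "x \<in> space M" shows "p l x \<le> p k x"
  using assms(2)
proof (induction l rule: dec_induct)
  case (step l)
  then show ?case using p_Suc_le[of l x] assms by simp
qed simp

lemma \<Omega>_space: "y \<in> \<Omega> \<Longrightarrow> y \<in> space M"
  using \<Omega>_subset Y_space by blast

lemma mean_antimono: "\<lbrakk>1 \<le> k; k \<le> l\<rbrakk> \<Longrightarrow> mean M (p l) \<le> mean M (p k)"
  unfolding mean_def by (intro nn_integral_mono ennreal_leI p_antimono)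

definition visit_sum :: "real \<Rightarrow> real \<Rightarrow> nat \<Rightarrow> real" where
  "visit_sum b y n = (\<Sum>m=1..n. p (ipow m b) ((g ^^ m) y))"

definition orbit_sum :: "real \<Rightarrow> nat \<Rightarrow> real" where
  "orbit_sum x n = (\<Sum>k=1..n. p k ((f ^^ k) x))"

text \<open>
  The value of \<open>s\<close> at time 0 is set to 0, so that \<open>s\<close> vanishes at all times at which \<open>Y\<close> is not
  visited.
\<close>

lemma orbit_visits:
  assumes x: "x \<in> space M" and entry: "\<forall>k<l. (f ^^ k) x \<notin> Y" and y: "(f ^^ l) x \<in> \<Omega>"
  defines "\<tau> \<equiv> \<lambda>m. l + return_sum ((f ^^ l) x) m"
    and "s \<equiv> \<lambda>k. if k = 0 then 0 else p k ((f ^^ k) x)"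
  shows "strict_mono \<tau>"
    and "\<And>m. 1 \<le> \<tau> m \<Longrightarrow> s (\<tau> m) = p (\<tau> m) ((g ^^ m) ((f ^^ l) x))"
    and "\<And>k. k \<notin> range \<tau> \<Longrightarrow> s k = 0"
    and "\<And>k. 0 \<le> s k" and "orbit_sum x n = (\<Sum>k=1..n. s k)"
proof -
  have space: "(f ^^ k) x \<in> space M" for k using measurable_space[OF iterate_measurable x] .
  show "strict_mono \<tau>" using strict_mono_return_sum[OF y] by (auto simp: \<tau>_def strict_mono_def)
  show "s (\<tau> m) = p (\<tau> m) ((g ^^ m) ((f ^^ l) x))" if "1 \<le> \<tau> m" for m
  proof -
    have "(f ^^ \<tau> m) x = (f ^^ return_sum ((f ^^ l) x) m) ((f ^^ l) x)"
      by (simp only: \<tau>_def add.commute[of l] funpow_add o_apply)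
    then show ?thesis using that iterate_return_sum[OF y] by (simp add: s_def)
  qed
  show "s k = 0" if k: "k \<notin> range \<tau>" for k
  proof -
    have "(f ^^ k) x \<notin> Y"
    proof
      assume kY: "(f ^^ k) x \<in> Y"
      then have lk: "l \<le> k" using entry not_less by blast
      have "(f ^^ k) x = (f ^^ (k - l + l)) x" using lk by simp
      also have "\<dots> = (f ^^ (k - l)) ((f ^^ l) x)" by (simp only: funpow_add o_apply)
      finally have "k - l \<in> range (return_sum ((f ^^ l) x))" using visit_times[OF y] kY by simp
      then obtain m where "k - l = return_sum ((f ^^ l) x) m" by blast
      then have "k = \<tau> m" using lk by (simp add: \<tau>_def)
      then show False using k by blast
    qed
    then show ?thesis using p_support[of k] space[of k] by (auto simp: s_def)
  qed
  show "0 \<le> s k" for k using p_nonneg[of k] space[of k] by (simp add: s_def)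
  show "orbit_sum x n = (\<Sum>k=1..n. s k)"
    unfolding orbit_sum_def s_def by (intro sum.cong) auto
qed

lemma AE_orbit_sum_ge:
  assumes b: "1 / \<beta> < b" and Q: "AE y in N. Q y"
  shows "AE x in M. \<exists>y c. Q y \<and> (\<forall>n. visit_sum b y (ipow n (1 / b)) \<le> c + orbit_sum x n)"
proof -
  have "0 < 1 / \<beta>" using beta by simp
  then have b0: "0 < b" using b by linarith
  define \<gamma> where "\<gamma> = (b + 1 / \<beta>) / 2"
  have \<gamma>: "1 / \<beta> < \<gamma>" "\<gamma> < b" using b by (auto simp: \<gamma>_def)
  then have \<gamma>0: "0 < \<gamma>" using \<open>0 < 1 / \<beta>\<close> by linarith
  have \<gamma>\<beta>: "1 < \<gamma> * \<beta>" using \<gamma>(1) beta by (simp add: pos_divide_less_eq)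
  obtain c where "\<forall>\<^sub>F n in sequentially. real n powr (- \<beta> - 1) / c \<le> measure N {x \<in> \<Omega>. R x = n} \<and>
       measure N {x \<in> \<Omega>. R x = n} \<le> c * real n powr (- \<beta> - 1)"
    by (rule return_time_measure) blast
  then have "\<forall>\<^sub>F n in sequentially. measure N {x \<in> \<Omega>. R x = n} \<le> c * real n powr (- \<beta> - 1)"
    by eventually_elim blast
  from return_sums_upper[OF beta \<gamma>\<beta> this]
  have "AE y in N. \<forall>\<^sub>F n in sequentially. real (return_sum y n) \<le> real n powr \<gamma>" .
  with Q have "AE y in N. Q y \<and> (\<forall>\<^sub>F n in sequentially. real (return_sum y n) \<le> real n powr \<gamma>)"
    by eventually_elim blast
  from AE_first_entry[OF this] AE_space show ?thesis
  proof eventually_elim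
    case (elim x)
    then obtain l where l: "\<forall>k<l. (f ^^ k) x \<notin> Y" "(f ^^ l) x \<in> \<Omega>"
      and Qy: "Q ((f ^^ l) x)" and Ty: "\<forall>\<^sub>F n in sequentially. real (return_sum ((f ^^ l) x) n) \<le> real n powr \<gamma>"
      by blast
    let ?y = "(f ^^ l) x"
    note ov = orbit_visits[OF elim(2) l]
    have "\<forall>\<^sub>F n in sequentially. real l + real n powr \<gamma> \<le> real n powr b"
      using \<gamma> \<gamma>0 by real_asymp
    with Ty have growth: "\<forall>\<^sub>F m in sequentially. real (l + return_sum ?y m) \<le> real m powr b"
      by eventually_elim simp
    obtain c where "\<And>n. (\<Sum>m=1..ipow n (1 / b). p (ipow m b) ((g ^^ m) ?y)) \<le> c + (\<Sum>k=1..n. if k = 0 then 0 else p k ((f ^^ k) x))"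
    proof (rule sum_visits_lower[where \<tau> = "\<lambda>m. l + return_sum ?y m" and b = b and w = "\<lambda>k m. p k ((g ^^ m) ?y)"
          and s = "\<lambda>k. if k = 0 then 0 else p k ((f ^^ k) x)", OF ov(1) b0 ov(2) ov(4) _ growth])
      show "p l' ((g ^^ m) ?y) \<le> p k ((g ^^ m) ?y)" if "1 \<le> k" "k \<le> l'" for k l' m
        using p_antimono[OF that] \<Omega>_space \<Omega>_iterate[OF l(2)] by blast
    qed blast+
    then show ?case using Qy unfolding visit_sum_def ov(5) by blast
  qed
qed

lemma AE_orbit_sum_le:
  assumes b: "0 < b" "b < 1 / \<beta>" and Q: "AE y in N. Q y"
  shows "AE x in M. \<exists>y c. Q y \<and> (\<forall>n. orbit_sum x n \<le> c + visit_sum b y (ipow n (1 / b)))"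
proof -
  have \<gamma>\<beta>: "b * \<beta> < 1" using b beta by (simp add: pos_less_divide_eq)
  obtain d where d: "d > 0" "\<And>L. L \<ge> 1 \<Longrightarrow> d * L powr (- \<beta>) \<le> measure N {x \<in> \<Omega>. L \<le> real (R x)}"
    by (rule return_time_tail_ge) blast
  from return_sums_lower[OF d(1) beta(1) b(1) \<gamma>\<beta> d(2)]
  have "AE y in N. \<forall>\<^sub>F n in sequentially. real n powr b \<le> real (return_sum y n)" by simp
  with Q have "AE y in N. Q y \<and> (\<forall>\<^sub>F n in sequentially. real n powr b \<le> real (return_sum y n))"
    by eventually_elim blast
  from AE_first_entry[OF this] AE_space show ?thesis
  proof eventually_elim
    case (elim x)
    then obtain l where l: "\<forall>k<l. (f ^^ k) x \<notin> Y" "(f ^^ l) x \<in> \<Omega>"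
      and Qy: "Q ((f ^^ l) x)" and Ty: "\<forall>\<^sub>F n in sequentially. real n powr b \<le> real (return_sum ((f ^^ l) x) n)"
      by blast
    let ?y = "(f ^^ l) x"
    note ov = orbit_visits[OF elim(2) l]
    have space: "(g ^^ m) ?y \<in> space M" for m using \<Omega>_space \<Omega>_iterate[OF l(2)] by blast
    from Ty have growth: "\<forall>\<^sub>F m in sequentially. real m powr b \<le> real (l + return_sum ?y m)"
      by eventually_elim simp
    obtain c where "\<And>n. (\<Sum>k=1..n. if k = 0 then 0 else p k ((f ^^ k) x)) \<le> c + (\<Sum>m=1..ipow n (1 / b). p (ipow m b) ((g ^^ m) ?y))"
    proof (rule sum_visits_upper[where \<tau> = "\<lambda>m. l + return_sum ?y m" and b = b and w = "\<lambda>k m. p k ((g ^^ m) ?y)"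
          and s = "\<lambda>k. if k = 0 then 0 else p k ((f ^^ k) x)", OF ov(1) b(1) ov(2) ov(3) _ _ growth])
      show "p l' ((g ^^ m) ?y) \<le> p k ((g ^^ m) ?y)" if "1 \<le> k" "k \<le> l'" for k l' m
        using p_antimono[OF that space] .
      show "0 \<le> p k ((g ^^ m) ?y)" if "1 \<le> k" for k m
        using p_nonneg[OF that space] .
    qed blast+
    then show ?case using Qy unfolding visit_sum_def ov(5) by blast
  qed
qed

theorem orbit_sum_convergent:
  assumes b: "0 < b" "b < 1 / \<beta>" and fin: "(\<Sum>n. mean M (p (ipow (Suc n) b))) < \<infinity>"
  shows "AE x in M. convergent (orbit_sum x)"
proof -
  define u where "u m x = ennreal (p (ipow (Suc m) b) x)" for m x
  have i1: "1 \<le> ipow (Suc m) b" for m using b by (intro ipow_ge_1) auto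
  have u[measurable]: "u m \<in> borel_measurable nu" for m
  proof -
    have "p (ipow (Suc m) b) \<in> borel_measurable nu"
      by (intro measurable_restrict_space1 p_measurable i1)
    then show ?thesis unfolding u_def by measurable
  qed
  note [measurable] = measurable_iterate_nu
  have "(\<integral>\<^sup>+ y. (\<Sum>m. u m ((g ^^ Suc m) y)) \<partial>nu) = (\<Sum>m. \<integral>\<^sup>+ y. u m ((g ^^ Suc m) y) \<partial>nu)"
    by (intro nn_integral_suminf) measurable
  also have "\<dots> = (\<Sum>m. \<integral>\<^sup>+ y. u m y \<partial>nu)" by (simp only: nn_integral_iterate[OF u])
  also have "\<dots> \<le> (\<Sum>m. mean M (p (ipow (Suc m) b)))"
  proof (intro suminf_le summableI)
    fix m
    have "(\<integral>\<^sup>+ y. u m y \<partial>nu) = (\<integral>\<^sup>+ y. u m y * indicator \<Omega> y \<partial>N)"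
      using \<Omega>_N by (intro nn_integral_restrict_space) auto
    also have "\<dots> \<le> (\<integral>\<^sup>+ y. u m y \<partial>N)" by (intro nn_integral_mono) (auto split: split_indicator)
    also have "\<dots> = (\<integral>\<^sup>+ y. u m y * indicator Y y \<partial>M)"
      using Y_sets by (intro nn_integral_restrict_space) auto
    also have "\<dots> \<le> mean M (p (ipow (Suc m) b))"
      unfolding mean_def u_def by (intro nn_integral_mono) (auto split: split_indicator)
    finally show "(\<integral>\<^sup>+ y. u m y \<partial>nu) \<le> mean M (p (ipow (Suc m) b))" .
  qed
  finally have "(\<integral>\<^sup>+ y. (\<Sum>m. u m ((g ^^ Suc m) y)) \<partial>nu) \<noteq> \<infinity>" using fin by auto
  then have "AE y in nu. (\<Sum>m. u m ((g ^^ Suc m) y)) \<noteq> \<infinity>"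
    by (intro nn_integral_PInf_AE) measurable
  then have "AE y in N. (\<Sum>m. u m ((g ^^ Suc m) y)) \<noteq> \<infinity>" by (simp only: AE_nu_iff)
  with AE_\<Omega> have Q: "AE y in N. \<exists>B. \<forall>n. visit_sum b y n \<le> B"
  proof eventually_elim
    case (elim y)
    have pos: "0 \<le> p (ipow (Suc m) b) ((g ^^ Suc m) y)" for m
      using p_nonneg[OF i1] \<Omega>_space[OF \<Omega>_iterate[OF elim(1)]] by blast
    obtain B where B: "B \<ge> 0" "(\<Sum>m. u m ((g ^^ Suc m) y)) = ennreal B"
      using elim(2) by (cases "\<Sum>m. u m ((g ^^ Suc m) y)") auto
    have "visit_sum b y n \<le> B" for n
    proof -
      have "visit_sum b y n = (\<Sum>m<n. p (ipow (Suc m) b) ((g ^^ Suc m) y))"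
        unfolding visit_sum_def by (simp add: sum.atLeast1_atMost_eq del: funpow.simps)
      moreover have "ennreal (\<Sum>m<n. p (ipow (Suc m) b) ((g ^^ Suc m) y)) = (\<Sum>m<n. u m ((g ^^ Suc m) y))"
        unfolding u_def using pos by (simp only: sum_ennreal)
      moreover have "\<dots> \<le> ennreal B"
        unfolding B(2)[symmetric] by (intro sum_le_suminf summableI) auto
      ultimately have "ennreal (visit_sum b y n) \<le> ennreal B" by simp
      then show ?thesis using B(1) by (simp only: ennreal_le_iff)
    qed
    then show ?case by blast
  qed
  from AE_orbit_sum_le[OF b Q] AE_space show ?thesis
  proof eventually_elim
    case (elim x)
    then obtain y c B where *: "\<And>n. visit_sum b y n \<le> B" "\<And>n. orbit_sum x n \<le> c + visit_sum b y (ipow n (1 / b))"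
      by blast
    have "orbit_sum x n \<le> c + B" for n using * order_trans by (meson add_left_mono)
    moreover have mono: "incseq (orbit_sum x)"
    proof (rule incseq_SucI)
      fix n
      have "0 \<le> p (Suc n) ((f ^^ Suc n) x)"
        by (rule p_nonneg[OF _ measurable_space[OF iterate_measurable elim(2)]]) simp
      then show "orbit_sum x n \<le> orbit_sum x (Suc n)" by (simp add: orbit_sum_def)
    qed
    ultimately obtain L where "orbit_sum x \<longlonglongrightarrow> L"
      using incseq_convergent[of "orbit_sum x" "c + B"] by blast
    then show ?case by (rule convergentI)
  qed
qed

definition mean_sum :: "real \<Rightarrow> nat \<Rightarrow> real" where
  "mean_sum b n = (\<Sum>k=1..n. enn2real (mean M (p (ipow k b))))"

text \<open>
  A quotient with infinite denominator is 0 and cannot tend to 1.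
\<close>

lemma strong_Borel_Cantelli_finite:
  assumes sbc: "strong_Borel_Cantelli M Y g (\<lambda>k. p (ipow k b))" and b: "0 \<le> b" and k: "1 \<le> k"
  shows "mean M (p k) < \<infinity>"
proof -
  have "mean M (p 1) \<noteq> \<infinity>"
  proof
    assume top: "mean M (p 1) = \<infinity>"
    have tops: "(\<Sum>k=1..n. mean M (p (ipow k b))) = \<infinity>" if "n \<ge> 1" for n
    proof -
      have "mean M (p (ipow 1 b)) \<le> (\<Sum>k=1..n. mean M (p (ipow k b)))"
        using that by (intro member_le_sum) auto
      then show ?thesis using top by (simp add: ipow_def top_unique)
    qed
    have zero: "\<forall>\<^sub>F n in sequentially. (\<Sum>k=1..n. ennreal (p (ipow k b) ((g ^^ k) y))) / (\<Sum>k=1..n. mean M (p (ipow k b))) = 0" for y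
      using eventually_ge_at_top[of 1]
    proof eventually_elim
      case (elim n)
      show ?case unfolding tops[OF elim] by (simp add: divide_ennreal_def)
    qed
    have "AE y in N. (\<lambda>n. (\<Sum>k=1..n. ennreal (p (ipow k b) ((g ^^ k) y))) / (\<Sum>k=1..n. mean M (p (ipow k b)))) \<longlonglongrightarrow> 1"
      using sbc unfolding strong_Borel_Cantelli_def by blast
    then have "AE y in N. False"
    proof eventually_elim
      case (elim y)
      have "(\<lambda>n. (\<Sum>k=1..n. ennreal (p (ipow k b) ((g ^^ k) y))) / (\<Sum>k=1..n. mean M (p (ipow k b)))) \<longlonglongrightarrow> 0"
        using tendsto_eventually[OF zero] .
      from LIMSEQ_unique[OF elim this] show ?case by simp
    qed
    then show False using N.AE_False by blast
  qed
  then show ?thesis using mean_antimono[of 1 k] k by (simp add: top.not_eq_extremum le_less_trans)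
qed

text \<open>
  Only the bounds 1/2 and 2 on the eventual size of the quotient are retained; the loss is
  recovered by \<open>mean_sum_block\<close>.
\<close>

lemma strong_Borel_Cantelli_bounds:
  assumes sbc: "strong_Borel_Cantelli M Y g (\<lambda>k. p (ipow k b))" and b: "0 < b"
  shows "filterlim (mean_sum b) at_top sequentially"
    and "AE y in N. \<forall>\<^sub>F n in sequentially. mean_sum b n \<le> 2 * visit_sum b y n \<and> visit_sum b y n \<le> 2 * mean_sum b n"
proof -
  have i1: "1 \<le> ipow k b" if "1 \<le> k" for k using b that by (intro ipow_ge_1) auto
  have en: "mean M (p (ipow k b)) = ennreal (enn2real (mean M (p (ipow k b))))" if "1 \<le> k" for k
    using strong_Borel_Cantelli_finite[OF sbc _ i1[OF that]] b by (simp add: top.not_eq_extremum)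
  have sum_en: "(\<Sum>k=1..n. mean M (p (ipow k b))) = ennreal (mean_sum b n)" for n
  proof -
    have "(\<Sum>k=1..n. mean M (p (ipow k b))) = (\<Sum>k=1..n. ennreal (enn2real (mean M (p (ipow k b)))))"
      by (intro sum.cong refl en) auto
    then show ?thesis by (simp add: mean_sum_def)
  qed
  have "(\<Sum>k. ennreal (enn2real (mean M (p (ipow (Suc k) b))))) = \<infinity>"
    using sbc en unfolding strong_Borel_Cantelli_def by simp
  then show lim: "filterlim (mean_sum b) at_top sequentially"
    unfolding mean_sum_def by (intro partial_sums_at_top) auto
  have "AE y in N. (\<lambda>n. (\<Sum>k=1..n. ennreal (p (ipow k b) ((g ^^ k) y))) / (\<Sum>k=1..n. mean M (p (ipow k b)))) \<longlonglongrightarrow> 1"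
    using sbc unfolding strong_Borel_Cantelli_def by blast
  with AE_\<Omega> show "AE y in N. \<forall>\<^sub>F n in sequentially. mean_sum b n \<le> 2 * visit_sum b y n \<and> visit_sum b y n \<le> 2 * mean_sum b n"
  proof eventually_elim
    case (elim y)
    have pos: "0 \<le> p (ipow k b) ((g ^^ k) y)" if "1 \<le> k" for k
      using p_nonneg[OF i1[OF that]] \<Omega>_space[OF \<Omega>_iterate[OF elim(1)]] by blast
    have vs: "(\<Sum>k=1..n. ennreal (p (ipow k b) ((g ^^ k) y))) = ennreal (visit_sum b y n)" for n
      unfolding visit_sum_def by (rule sum_ennreal) (use pos in auto)
    have vs0: "0 \<le> visit_sum b y n" for n
      unfolding visit_sum_def by (rule sum_nonneg) (use pos in auto)
    have lim1: "(\<lambda>n. ennreal (visit_sum b y n) / ennreal (mean_sum b n)) \<longlonglongrightarrow> 1"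
      using elim(2) unfolding vs sum_en .
    have "ennreal (1 / 2) < ennreal 1" "ennreal 1 < ennreal 2" by (rule ennreal_lessI; simp)+
    then have "ennreal (1 / 2) < 1" "1 < ennreal 2" by (simp_all only: ennreal_1)
    note lo = order_tendstoD(1)[OF lim1 this(1)] and hi = order_tendstoD(2)[OF lim1 this(2)]
    have "\<forall>\<^sub>F n in sequentially. 0 < mean_sum b n" using lim by (simp add: filterlim_at_top_dense)
    with lo hi show ?case
    proof eventually_elim
      case (elim n)
      then have "ennreal (1 / 2) < ennreal (visit_sum b y n / mean_sum b n)" "ennreal (visit_sum b y n / mean_sum b n) < ennreal 2"
        using vs0 by (simp_all only: divide_ennreal)
      then have "1 / 2 < visit_sum b y n / mean_sum b n" "visit_sum b y n / mean_sum b n < 2"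
        using vs0 elim(3) by (simp_all only: ennreal_less_iff divide_nonneg_nonneg)
      then show ?case using elim(3) by (simp add: field_simps)
    qed
  qed
qed

lemma mean_sum_block:
  assumes fin: "\<And>k. 1 \<le> k \<Longrightarrow> mean M (p k) < \<infinity>" and b: "0 < b" "b < b'"
  obtains c where "\<And>n. 3 * mean_sum b' (ipow n (1 / b')) \<le> c + mean_sum b (ipow n (1 / b))"
proof -
  have "enn2real (mean M (p l)) \<le> enn2real (mean M (p k))" if "1 \<le> k" "k \<le> l" for k l
    using mean_antimono[OF that] fin[OF that(1)] by (intro enn2real_mono) auto
  from block_sum_le[of "\<lambda>k. enn2real (mean M (p k))", OF _ this b]
  obtain c where "\<And>n. 3 * (\<Sum>k=1..ipow n (1 / b'). enn2real (mean M (p (ipow k b'))))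
      \<le> c + (\<Sum>k=1..ipow n (1 / b). enn2real (mean M (p (ipow k b))))"
    by auto
  then show thesis using that unfolding mean_sum_def by blast
qed

lemma sum_mean_eq:
  assumes "\<And>k. 1 \<le> k \<Longrightarrow> mean M (p k) < \<infinity>" "0 \<le> b"
  shows "(\<Sum>k=1..n. mean M (p (ipow k b))) = ennreal (mean_sum b n)"
proof -
  have "(\<Sum>k=1..n. mean M (p (ipow k b))) = (\<Sum>k=1..n. ennreal (enn2real (mean M (p (ipow k b)))))"
    using assms ipow_ge_1[OF _ assms(2)] by (intro sum.cong refl) (simp add: top.not_eq_extremum)
  then show ?thesis by (simp add: mean_sum_def)
qed

text \<open>
  Since the orbit sum is at least half the mean sum for \<open>b'\<close> minus a constant, and the mean sum
  for \<open>b\<close> is at most a third of it plus a constant, it suffices that the mean sum for \<open>b'\<close> tends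
  to infinity.
\<close>

theorem orbit_sum_ge:
  assumes b: "1 / \<beta> < b'" "b' < b" and sbc: "strong_Borel_Cantelli M Y g (\<lambda>k. p (ipow k b'))"
  shows "AE x in M. \<forall>\<^sub>F n in sequentially.
    (\<Sum>k=1..ipow n (1 / b). mean M (p (ipow k b))) \<le> ennreal (orbit_sum x n)"
proof -
  have "0 < 1 / \<beta>" using beta by simp
  then have b0: "0 < b'" "0 < b" using b by linarith+
  have fin: "mean M (p k) < \<infinity>" if "1 \<le> k" for k
    using strong_Borel_Cantelli_finite[OF sbc _ that] b0 by simp
  obtain c' where c': "\<And>n. 3 * mean_sum b (ipow n (1 / b)) \<le> c' + mean_sum b' (ipow n (1 / b'))"
    using mean_sum_block[OF fin b0(1) b(2)] by blast
  have lim: "filterlim (\<lambda>n. ipow n (1 / b')) at_top sequentially" using b0 by (intro filterlim_ipow) simp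
  have lim': "filterlim (\<lambda>n. mean_sum b' (ipow n (1 / b'))) at_top sequentially"
    by (rule filterlim_compose[OF strong_Borel_Cantelli_bounds(1)[OF sbc b0(1)] lim])
  from AE_orbit_sum_ge[OF b(1) strong_Borel_Cantelli_bounds(2)[OF sbc b0(1)]] show ?thesis
  proof eventually_elim
    case (elim x)
    then obtain y c where y: "\<forall>\<^sub>F n in sequentially. mean_sum b' n \<le> 2 * visit_sum b' y n \<and> visit_sum b' y n \<le> 2 * mean_sum b' n"
      and c: "\<And>n. visit_sum b' y (ipow n (1 / b')) \<le> c + orbit_sum x n" by blast
    have "\<forall>\<^sub>F n in sequentially. 6 * c + 2 * c' \<le> mean_sum b' (ipow n (1 / b'))"
      using lim' by (simp add: filterlim_at_top)
    with eventually_compose_filterlim[OF y lim] show ?case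
    proof eventually_elim
      case (elim n)
      then have "mean_sum b (ipow n (1 / b)) \<le> orbit_sum x n" using c[of n] c'[of n] by linarith
      then show ?case using sum_mean_eq[OF fin, of b] b0 by (simp add: ennreal_leI)
    qed
  qed
qed

theorem orbit_sum_le:
  assumes b: "0 < b" "b < b'" "b' < 1 / \<beta>" and sbc: "strong_Borel_Cantelli M Y g (\<lambda>k. p (ipow k b'))"
  shows "AE x in M. \<forall>\<^sub>F n in sequentially.
    ennreal (orbit_sum x n) \<le> (\<Sum>k=1..ipow n (1 / b). mean M (p (ipow k b)))"
proof -
  have b0: "0 < b'" using b by linarith
  have fin: "mean M (p k) < \<infinity>" if "1 \<le> k" for k
    using strong_Borel_Cantelli_finite[OF sbc _ that] b0 by simp
  obtain c' where c': "\<And>n. 3 * mean_sum b' (ipow n (1 / b')) \<le> c' + mean_sum b (ipow n (1 / b))"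
    using mean_sum_block[OF fin b(1,2)] by blast
  have lim: "filterlim (\<lambda>n. ipow n (1 / b')) at_top sequentially" using b0 by (intro filterlim_ipow) simp
  have lim': "filterlim (\<lambda>n. mean_sum b' (ipow n (1 / b'))) at_top sequentially"
    by (rule filterlim_compose[OF strong_Borel_Cantelli_bounds(1)[OF sbc b0] lim])
  from AE_orbit_sum_le[OF b0 b(3) strong_Borel_Cantelli_bounds(2)[OF sbc b0]] show ?thesis
  proof eventually_elim
    case (elim x)
    then obtain y c where y: "\<forall>\<^sub>F n in sequentially. mean_sum b' n \<le> 2 * visit_sum b' y n \<and> visit_sum b' y n \<le> 2 * mean_sum b' n"
      and c: "\<And>n. orbit_sum x n \<le> c + visit_sum b' y (ipow n (1 / b'))" by blast
    have "\<forall>\<^sub>F n in sequentially. c + c' \<le> mean_sum b' (ipow n (1 / b'))"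
      using lim' by (simp add: filterlim_at_top)
    with eventually_compose_filterlim[OF y lim] show ?case
    proof eventually_elim
      case (elim n)
      then have "orbit_sum x n \<le> mean_sum b (ipow n (1 / b))" using c[of n] c'[of n] by linarith
      then show ?case using sum_mean_eq[OF fin, of b] b by (simp add: ennreal_leI)
    qed
  qed
qed

lemma divergent_mean_sum_mono:
  assumes "0 \<le> b" "b \<le> b'" and "(\<Sum>n. mean M (p (ipow (Suc n) b'))) = \<infinity>"
  shows "(\<Sum>n. mean M (p (ipow (Suc n) b))) = \<infinity>"
proof -
  have "(\<Sum>n. mean M (p (ipow (Suc n) b'))) \<le> (\<Sum>n. mean M (p (ipow (Suc n) b)))"
    using assms(1,2) by (intro suminf_le summableI mean_antimono ipow_ge_1 ipow_mono_exponent) auto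
  then show ?thesis using assms(3) by (simp add: top_unique)
qed

end

theorem theorem2p19:
  fixes M :: "real measure" and f :: "real \<Rightarrow> real" and Y :: "real set" and P :: "real set set"
    and p :: "nat \<Rightarrow> real \<Rightarrow> real" and \<alpha> \<beta> :: real
  assumes "sigma_finite_measure M" and "emeasure M (space M) = \<infinity>"
    and "f \<in> M \<rightarrow>\<^sub>M M" and "invariant_measure f M"
    and "ergodic_map f M" and "conservative_map f M"
    and "Y \<in> sets M" and "sets (restrict_space M Y) = sets (restrict_space borel Y)"
    and A1: "markov_partition_big_images (induced_map f Y) Y P"
    and A2: "uniformly_expanding (induced_map f Y) P"
    and A3: "bounded_distortion (induced_map f Y) P"
    and A4: "unique_acip (induced_map f Y) Y (restrict_space M Y)"
    and A5: "return_time_constant_on f Y P"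
    and A6: "return_time_tail f Y (restrict_space M Y) \<beta>"
    and "\<alpha> = 1 / \<beta>"
    and "\<And>n. n \<ge> 1 \<Longrightarrow> p n \<in> borel_measurable M"
    and "\<And>n x. n \<ge> 1 \<Longrightarrow> x \<in> space M \<Longrightarrow> p n x \<ge> 0"
    and "\<And>n x. n \<ge> 1 \<Longrightarrow> x \<in> space M \<Longrightarrow> p (Suc n) x \<le> p n x"
    and "\<And>n. n \<ge> 1 \<Longrightarrow> {x \<in> space M. p n x \<noteq> 0} \<subseteq> Y"
  shows
    "(\<forall>\<epsilon>1. 0 < \<epsilon>1 \<and> \<epsilon>1 < \<alpha> \<and>
        (\<Sum>n. mean M (p (ipow (Suc n) (\<alpha> + \<epsilon>1)))) = \<infinity> \<and>
        (\<forall>s. strict_mono s \<and> (\<Sum>k. mean M (p (s (Suc k)))) = \<infinity> \<longrightarrow>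
             strong_Borel_Cantelli M Y (induced_map f Y) (\<lambda>k. p (s k))) \<longrightarrow>
        (\<forall>\<epsilon>. 0 < \<epsilon> \<and> \<epsilon> \<le> \<epsilon>1 \<longrightarrow>
          (AE x in M. \<forall>\<^sub>F n in sequentially.
             (\<Sum>k=1..ipow n (1 / (\<alpha> + \<epsilon>)). mean M (p (ipow k (\<alpha> + \<epsilon>))))
               \<le> ennreal (\<Sum>k=1..n. p k ((f ^^ k) x)) \<and>
             ennreal (\<Sum>k=1..n. p k ((f ^^ k) x))
               \<le> (\<Sum>k=1..ipow n (1 / (\<alpha> - \<epsilon>)). mean M (p (ipow k (\<alpha> - \<epsilon>)))))))
     \<and>
     (\<forall>\<epsilon>2. 0 < \<epsilon>2 \<and> \<epsilon>2 < \<alpha> \<and>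
        (\<Sum>n. mean M (p (ipow (Suc n) (\<alpha> - \<epsilon>2)))) < \<infinity> \<longrightarrow>
        (AE x in M. convergent (\<lambda>n. \<Sum>k=1..n. p k ((f ^^ k) x))))"
proof -
  interpret decreasing_targets M f Y P \<beta> p
    by unfold_locales (fact assms)+
  have \<alpha>: "1 < \<alpha>" using beta \<open>\<alpha> = 1 / \<beta>\<close> by simp
  show ?thesis
  proof (intro conjI allI impI)
    fix \<epsilon>1 \<epsilon> :: real
    assume h: "0 < \<epsilon>1 \<and> \<epsilon>1 < \<alpha> \<and>
        (\<Sum>n. mean M (p (ipow (Suc n) (\<alpha> + \<epsilon>1)))) = \<infinity> \<and>
        (\<forall>s. strict_mono s \<and> (\<Sum>k. mean M (p (s (Suc k)))) = \<infinity> \<longrightarrow>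
             strong_Borel_Cantelli M Y (induced_map f Y) (\<lambda>k. p (s k)))"
      and \<epsilon>: "0 < \<epsilon> \<and> \<epsilon> \<le> \<epsilon>1"
    have sbc: "strong_Borel_Cantelli M Y g (\<lambda>k. p (ipow k b))" if "1 < b" "b \<le> \<alpha> + \<epsilon>1" for b
    proof -
      have "(\<Sum>n. mean M (p (ipow (Suc n) b))) = \<infinity>"
        using divergent_mean_sum_mono[of b "\<alpha> + \<epsilon>1"] that h by simp
      moreover have "strict_mono (\<lambda>k. ipow k b)" using that by (intro strict_mono_ipow)
      ultimately show ?thesis using h by blast
    qed
    define b1 where "b1 = \<alpha> + \<epsilon> / 2"
    \<comment> \<open>The exponent has to stay above 1 to give a strictly increasing sequence of indices, although \<open>\<alpha> - \<epsilon>\<close> may be smaller.\<close>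
    define b2 where "b2 = \<alpha> - min (\<epsilon> / 2) ((\<alpha> - 1) / 2)"
    have b1: "1 / \<beta> < b1" "b1 < \<alpha> + \<epsilon>" "1 < b1" "b1 \<le> \<alpha> + \<epsilon>1"
      using \<epsilon> \<alpha> \<open>\<alpha> = 1 / \<beta>\<close> by (auto simp: b1_def)
    have b2: "0 < \<alpha> - \<epsilon>" "\<alpha> - \<epsilon> < b2" "b2 < 1 / \<beta>" "1 < b2" "b2 \<le> \<alpha> + \<epsilon>1"
      using \<epsilon> \<alpha> h unfolding b2_def \<open>\<alpha> = 1 / \<beta>\<close>[symmetric] min_def by (auto simp: field_simps)
    from orbit_sum_ge[OF b1(1,2) sbc[OF b1(3,4)]] orbit_sum_le[OF b2(1,2,3) sbc[OF b2(4,5)]]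
    show "AE x in M. \<forall>\<^sub>F n in sequentially.
             (\<Sum>k=1..ipow n (1 / (\<alpha> + \<epsilon>)). mean M (p (ipow k (\<alpha> + \<epsilon>))))
               \<le> ennreal (\<Sum>k=1..n. p k ((f ^^ k) x)) \<and>
             ennreal (\<Sum>k=1..n. p k ((f ^^ k) x))
               \<le> (\<Sum>k=1..ipow n (1 / (\<alpha> - \<epsilon>)). mean M (p (ipow k (\<alpha> - \<epsilon>))))"
      unfolding orbit_sum_def by eventually_elim (rule eventually_conj)
  next
    fix \<epsilon>2 :: real
    assume h: "0 < \<epsilon>2 \<and> \<epsilon>2 < \<alpha> \<and> (\<Sum>n. mean M (p (ipow (Suc n) (\<alpha> - \<epsilon>2)))) < \<infinity>"
    then show "AE x in M. convergent (\<lambda>n. \<Sum>k=1..n. p k ((f ^^ k) x))"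
      using orbit_sum_convergent[of "\<alpha> - \<epsilon>2"] \<open>\<alpha> = 1 / \<beta>\<close> unfolding orbit_sum_def by simp
  qed
qed

end
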